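(* Let $g:(0,\infty)\to[0,\infty)$ be measurable and satisfy the weak feedback condition (W) $g(x)\le1$ for all $x$, and there exists $\epsilon_g>0$ such that $\sup_{x\le\epsilon_g}g(x)<1$. Let $\Lambda$ be the unique solution of the McKean–Vlasov system with initial density $g$ and let $\Lambda^N$ be the barrier of the $N$-th particle system (see context). Then for each $T\ge0$ there exists a constant $K>0$ such that for all $N\ge1$ and all $0<y\le\sqrt N\,\epsilon_g/2$, $$\mathbb{P}\left(\sup_{t\le T}\sqrt N\,(\Lambda_t^N-\Lambda_t)\ge y\right)\le 2e^{-Ky^2/(1+y/\sqrt N)}.$$
   Context: McKean–Vlasov system. A solution with initial density $g$ is a nondecreasing cadlag function $\Lambda:[0,\infty)\to[0,\infty)$ such that, with $B$ a standard Brownian motion, $X_t^x=x+B_t-\Lambda_t$ and $\tau^x=\inf\{t\ge0:X_t^x\le0\}$, one has $\Lambda_t=\int_0^\infty\mathbb{P}(\tau^x\le t)g(x)\,dx$ for all $t\ge0$. Under (W) the solution exists and is unique. Particle system. For each integer $N\ge1$ let $(W_0^{i,N})_{i\ge1}$ be the points of a Poisson point process on $(0,\infty)$ with intensity $N g(x)\,dx$ and, independently, let $(B^{i,N})_{i\ge1}$ be i.i.d. standard Brownian motions. Put $W_t^{i,N}=W_0^{i,N}+B_t^{i,N}$. The barrier $\Lambda^N$ is the nondecreasing cadlag pure-jump process, with $\Lambda^N_{0^-}=0$, determined by $$\tau_i^N=\inf\{t\ge0:W_t^{i,N}\le\Lambda_t^N\},\qquad \Lambda_t^N=\frac1N\sum_{i\ge1}1_{\{\tau_i^N\le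 t\}},$$ $$\Delta\Lambda_t^N=\frac1N\inf\Big\{k\in\{0,1,2,\dots\}:\rho_{t^-}^N\big([\Lambda_{t^-}^N,\Lambda_{t^-}^N+\tfrac kN]\big)\le\tfrac kN\Big\},\qquad \rho_{t^-}^N=\frac1N\sum_{i\ge1}\delta_{W_t^{i,N}}1_{\{\tau_i^N\ge t\}}.$$ *)

theory Defs
  imports "HOL-Probability.Probability"
begin

section \<open>Paths on the half-line\<close>

text \<open>Time is \<open>[0,\<infinity>)\<close>; values of a path at negative times are never used.\<close>

definition cadlag :: "(real \<Rightarrow> real) \<Rightarrow> bool" where
  "cadlag f \<longleftrightarrow> (\<forall>t\<ge>0. (f \<longlongrightarrow> f t) (at_right t) \<and> (t > 0 \<longrightarrow> (\<exists>l. (f \<longlongrightarrow> l) (at_left t))))"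

text \<open>The left limit \<open>f(t-)\<close>, with the convention \<open>f(0-) = 0\<close>.\<close>

definition left_limit :: "(real \<Rightarrow> real) \<Rightarrow> real \<Rightarrow> real" where
  "left_limit f t = (if t = 0 then 0 else Lim (at_left t) f)"

text \<open>\<open>inf {t \<ge> 0. P t}\<close>, equal to \<open>\<infinity>\<close> if there is no such time.\<close>

definition first_time :: "(real \<Rightarrow> bool) \<Rightarrow> ereal" where
  "first_time P = (INF t \<in> {t. 0 \<le> t \<and> P t}. ereal t)"

section \<open>Brownian motion and the McKean--Vlasov system\<close>

text \<open>Paths are continuous for every outcome, so that the hitting events below are
  measurable without completing the probability space.\<close>

locale standard_brownian_motion = prob_space M for M :: "'a measure" +
  fixes B :: "real \<Rightarrow> 'a \<Rightarrow> real"
  assumes measurable: "\<And>t. 0 \<le> t \<Longrightarrow> B t \<in> borel_measurable M"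
    and starts_at_0: "AE \<omega> in M. B 0 \<omega> = 0"
    and independent_increments:
      "\<And>n s. 0 \<le> s 0 \<Longrightarrow> (\<And>k::nat. k < n \<Longrightarrow> s k \<le> s (Suc k)) \<Longrightarrow>
         indep_vars (\<lambda>_. borel) (\<lambda>k \<omega>. B (s (Suc k)) \<omega> - B (s k) \<omega>) {..<n}"
    and gaussian_increments:
      "\<And>s t. 0 \<le> s \<Longrightarrow> s < t \<Longrightarrow>
         distributed M lborel (\<lambda>\<omega>. B t \<omega> - B s \<omega>) (\<lambda>x. ennreal (normal_density 0 (sqrt (t - s)) x))"
    and continuous_paths: "\<And>\<omega>. \<omega> \<in> space M \<Longrightarrow> continuous_on {0..} (\<lambda>t. B t \<omega>)"

text \<open>The integral is taken in \<open>[0,\<infinity>]\<close>, so the equation includes its finiteness.\<close>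

definition mckean_vlasov_solution ::
  "'a measure \<Rightarrow> (real \<Rightarrow> 'a \<Rightarrow> real) \<Rightarrow> (real \<Rightarrow> real) \<Rightarrow> (real \<Rightarrow> real) \<Rightarrow> bool" where
  "mckean_vlasov_solution M B g \<Lambda> \<longleftrightarrow>
     (\<forall>t\<ge>0. 0 \<le> \<Lambda> t) \<and> mono_on {0..} \<Lambda> \<and> cadlag \<Lambda> \<and>
     (\<forall>t\<ge>0. ennreal (\<Lambda> t) =
        (\<integral>\<^sup>+x\<in>{0<..}. ennreal (measure M {\<omega> \<in> space M.
           first_time (\<lambda>s. x + B s \<omega> - \<Lambda> s \<le> 0) \<le> ereal t} * g x) \<partial>lborel))"

text \<open>Condition (W), with \<open>\<epsilon>\<close> the witness \<open>\<epsilon>\<^sub>g\<close>.\<close>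

definition weak_feedback :: "(real \<Rightarrow> real) \<Rightarrow> real \<Rightarrow> bool" where
  "weak_feedback g \<epsilon> \<longleftrightarrow> (\<forall>x>0. g x \<le> 1) \<and> \<epsilon> > 0 \<and> (SUP x\<in>{0<..\<epsilon>}. g x) < 1"

section \<open>Poisson points\<close>

text \<open>The points of a Poisson process on \<open>(0,\<infinity>)\<close> are listed as a sequence with values in
  \<open>(0,\<infinity>]\<close>. The value \<open>\<infinity>\<close> means that the index carries no point; it is needed because the
  number of points is finite when the intensity has finite mass.\<close>

definition point_count :: "(nat \<Rightarrow> 'a \<Rightarrow> ereal) \<Rightarrow> real set \<Rightarrow> 'a \<Rightarrow> ennreal" where
  "point_count W A \<omega> = (\<Sum>i. of_bool (W i \<omega> \<in> ereal ` A))"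

locale poisson_points = prob_space M for M :: "'a measure" +
  fixes \<nu> :: "real measure" and W :: "nat \<Rightarrow> 'a \<Rightarrow> ereal"
  assumes measurable: "\<And>i. W i \<in> borel_measurable M"
    and positive: "\<And>i \<omega>. \<omega> \<in> space M \<Longrightarrow> 0 < W i \<omega>"
    and poisson_count:
      "\<And>A k. A \<in> sets borel \<Longrightarrow> A \<subseteq> {0<..} \<Longrightarrow> emeasure \<nu> A < \<infinity> \<Longrightarrow>
         prob {\<omega> \<in> space M. point_count W A \<omega> = of_nat k} = pmf (poisson_pmf (measure \<nu> A)) k"
    and infinite_count:
      "\<And>A. A \<in> sets borel \<Longrightarrow> A \<subseteq> {0<..} \<Longrightarrow> emeasure \<nu> A = \<infinity> \<Longrightarrow>
         AE \<omega> in M. point_count W A \<omega> = \<infinity>"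
    and independent_counts:
      "\<And>A :: nat \<Rightarrow> real set. (\<And>j. A j \<in> sets borel \<and> A j \<subseteq> {0<..}) \<Longrightarrow> disjoint_family A \<Longrightarrow>
         indep_vars (\<lambda>_. borel) (\<lambda>j. point_count W (A j)) UNIV"

section \<open>The particle system\<close>

text \<open>In the next three definitions \<open>W i t\<close> is the position of particle \<open>i\<close> at time \<open>t\<close>
  (constantly \<open>\<infinity>\<close> for an index without particle), and \<open>L\<close> is a path of the barrier.\<close>

definition absorption_time :: "(nat \<Rightarrow> real \<Rightarrow> ereal) \<Rightarrow> (real \<Rightarrow> real) \<Rightarrow> nat \<Rightarrow> ereal" where
  "absorption_time W L i = first_time (\<lambda>t. W i t \<le> ereal (L t))"

definition alive_mass ::
  "nat \<Rightarrow> (nat \<Rightarrow> real \<Rightarrow> ereal) \<Rightarrow> (real \<Rightarrow> real) \<Rightarrow> real \<Rightarrow> real set \<Rightarrow> ennreal" where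
  "alive_mass N W L t A =
     (\<Sum>i. of_bool (W i t \<in> ereal ` A \<and> ereal t \<le> absorption_time W L i)) / of_nat N"

text \<open>The last conjunct uses \<open>inf {} = \<infinity>\<close>, so it includes the existence of an admissible \<open>k\<close>.\<close>

definition barrier_path :: "nat \<Rightarrow> (nat \<Rightarrow> real \<Rightarrow> ereal) \<Rightarrow> (real \<Rightarrow> real) \<Rightarrow> bool" where
  "barrier_path N W L \<longleftrightarrow>
     (\<forall>t\<ge>0. ((\<lambda>s. L s - left_limit L s) has_sum L t) {0..t}) \<and>
     (\<forall>t\<ge>0. ennreal (L t) = (\<Sum>i. of_bool (absorption_time W L i \<le> ereal t)) / of_nat N \<and> 0 \<le> L t) \<and>
     (\<forall>t\<ge>0. ereal (L t - left_limit L t) =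
        (INF k \<in> {k::nat. alive_mass N W L t {left_limit L t .. left_limit L t + real k / real N}
                              \<le> ennreal (real k / real N)}. ereal (real k)) / ereal (real N))"

text \<open>As for Brownian motion, the barrier is cadlag and nondecreasing for every outcome, which
  makes suprema over time measurable; the equations are required almost surely.\<close>

locale particle_system = prob_space M for M :: "'a measure" +
  fixes g :: "real \<Rightarrow> real" and N :: nat
    and W0 :: "nat \<Rightarrow> 'a \<Rightarrow> ereal" and B :: "nat \<Rightarrow> real \<Rightarrow> 'a \<Rightarrow> real"
    and \<Lambda> :: "real \<Rightarrow> 'a \<Rightarrow> real"
  assumes initial_points:
      "poisson_points M (density lborel (\<lambda>x. ennreal (real N * g x) * indicator {0<..} x)) W0"
    and brownian: "\<And>i. standard_brownian_motion M (B i)"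
    and brownian_indep:
      "indep_vars (\<lambda>_. PiM {0..} (\<lambda>_. borel)) (\<lambda>i \<omega>. \<lambda>t\<in>{0..}. B i t \<omega>) UNIV"
    and initial_brownian_indep:
      "indep_set
         (sets (vimage_algebra (space M) (\<lambda>\<omega> i. W0 i \<omega>) (PiM UNIV (\<lambda>_. borel))))
         (sets (vimage_algebra (space M) (\<lambda>\<omega> i. \<lambda>t\<in>{0..}. B i t \<omega>)
                  (PiM UNIV (\<lambda>_. PiM {0..} (\<lambda>_. borel)))))"
    and barrier_measurable: "\<And>t. 0 \<le> t \<Longrightarrow> \<Lambda> t \<in> borel_measurable M"
    and barrier_mono: "\<And>\<omega>. \<omega> \<in> space M \<Longrightarrow> mono_on {0..} (\<lambda>t. \<Lambda> t \<omega>)"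
    and barrier_cadlag: "\<And>\<omega>. \<omega> \<in> space M \<Longrightarrow> cadlag (\<lambda>t. \<Lambda> t \<omega>)"
    and barrier_equations:
      "AE \<omega> in M. barrier_path N (\<lambda>i t. W0 i \<omega> + ereal (B i t \<omega>)) (\<lambda>t. \<Lambda> t \<omega>)"

end

(* Fix a level eta, half of y / sqrt N. As long as the barrier of the particle system stays below
   Lambda + eta, every absorbed particle has crossed Lambda + eta, and minimality of the jumps
   carries this over to the time sigma at which the barrier first reaches Lambda + eta: at least
   N (Lambda_sigma + eta) particles have then crossed the deterministic barrier Lambda + eta. The
   number of particles that cross it up to time t is a Poisson process in t (the marking theorem,
   obtained here from Laplace functionals). With p_t(x) the
   probability that Brownian motion from x meets Lambda before t, its mean is N times the integral
   of p_t(x - eta) g(x), which by g <= 1 and the telescoping of p_t(x - eta) - p_t(x) is at most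
   N (Lambda_t + eta). Since g stays away from 1 near 0 and Brownian motion from epsilon / 2
   survives with positive probability, eta can be improved to (1 - kappa) eta. So at some time the
   Poisson process exceeds its mean by kappa N eta, and Ottaviani's inequality reduces this event
   to a Chernoff bound at the final time. *)

theory Submission
  imports Defs
begin

section \<open>Hitting times and the first overshoot\<close>

text \<open>The absorption times depend on each other through the barrier, whereas crossing the
  deterministic curve \<open>\<Lambda> + \<eta>\<close> depends only on a particle's own start and
  path. This is why the event is moved to that curve: there the counts are Poisson and have
  independent increments. Two obstacles remain. The overshoot time \<sigma> is random, so the
  Poisson deviation is bounded on dyadic grids, uniformly in the mesh, and right continuity of
  \<Lambda> moves \<sigma> to a grid time at the cost of half the margin. And \<kappa> must depend
  neither on N nor on y: it is the gap of g below 1 near 0 times the probability of surviving up to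
  T from \<epsilon>/2. A start at \<epsilon> lowered by \<eta> stays above \<epsilon>/2 because of
  the range of y. Survival is obtained by forcing the path to climb, in many short blocks, above the
  final height of the barrier while the barrier is still small. The margin is proportional to N
  \<eta> and the mean is of order N, so a tilt proportional to \<eta> gives an exponent of order N
  \<eta>^2, that is y^2.\<close>

lemma first_time_le_iff:
  assumes "\<And>s. 0 \<le> s \<Longrightarrow> \<not> P s \<Longrightarrow> \<forall>\<^sub>F u in at_right s. \<not> P u"
  shows "first_time P \<le> ereal t \<longleftrightarrow> (\<exists>s. 0 \<le> s \<and> s \<le> t \<and> P s)"
proof
  assume L: "first_time P \<le> ereal t"
  show "\<exists>s. 0 \<le> s \<and> s \<le> t \<and> P s"
  proof (rule ccontr)
    assume N: "\<not> ?thesis"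
    \<comment> \<open>Right-openness of the complement of \<open>P\<close> at \<open>t\<close>
      itself leaves a gap after \<open>t\<close>, so an infimum of at most \<open>t\<close> cannot
      come from later times alone.\<close>
    obtain b where b: "b > t" "\<And>s. 0 \<le> s \<Longrightarrow> P s \<Longrightarrow> b \<le> s"
    proof (cases "t < 0")
      case True
      then show ?thesis by (intro that[of 0]) auto
    next
      case False
      then have "\<forall>\<^sub>F u in at_right t. \<not> P u" using assms N by auto
      then obtain b where b: "b > t" "\<And>u. t < u \<Longrightarrow> u < b \<Longrightarrow> \<not> P u"
        unfolding eventually_at_right_field by auto
      show ?thesis
      proof (rule that[of b])
        fix s assume "0 \<le> s" "P s"
        with N have "t < s" by (meson not_le)
        with b(2)[of s] \<open>P s\<close> show "b \<le> s" by (meson not_le)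
      qed (rule b(1))
    qed
    have "ereal b \<le> first_time P"
      unfolding first_time_def by (rule INF_greatest) (use b in auto)
    with L b(1) show False by (meson ereal_less_eq(3) not_le order_trans)
  qed
next
  assume "\<exists>s. 0 \<le> s \<and> s \<le> t \<and> P s"
  then obtain s where "0 \<le> s" "s \<le> t" "P s" by auto
  then show "first_time P \<le> ereal t"
    unfolding first_time_def by (intro INF_lower2[of s]) auto
qed

lemma cadlag_right: "cadlag f \<Longrightarrow> 0 \<le> t \<Longrightarrow> (f \<longlongrightarrow> f t) (at_right t)"
  by (auto simp: cadlag_def)

lemma continuous_on_at_right:
  fixes b :: "real \<Rightarrow> real"
  assumes "continuous_on {0..} b" "0 \<le> s"
  shows "(b \<longlongrightarrow> b s) (at_right s)"
proof -
  have "(b \<longlongrightarrow> b s) (at s within {0..})" using assms by (simp add: continuous_on_def)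
  then show ?thesis by (rule tendsto_within_subset) (use assms in auto)
qed

text \<open>Right continuity moves a hitting time slightly to the right into \<open>D\<close>, at
  the price of the slack \<open>1 / real (Suc n)\<close>; the terminal time \<open>t\<close> has no
  room on its right and is therefore put into \<open>D\<close>. Conversely, near-hits accumulate at
  some \<open>s\<close> by compactness, and a monotone right-continuous \<open>L\<close> is upper
  semicontinuous, so the inequality survives the limit.\<close>

lemma hit_iff_dense:
  fixes b L :: "real \<Rightarrow> real"
  assumes b: "continuous_on {0..} b" and L: "mono_on {0..} L" "cadlag L"
    and D: "\<And>s u. 0 \<le> s \<Longrightarrow> s < u \<Longrightarrow> \<exists>q\<in>D. s < q \<and> q < u" "t \<in> D"
  shows "(\<exists>s. 0 \<le> s \<and> s \<le> t \<and> b s \<le> L s) \<longleftrightarrow>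
    (\<forall>n. \<exists>q\<in>D. 0 \<le> q \<and> q \<le> t \<and> b q < L q + 1 / real (Suc n))" (is "?A = ?B")
proof
  assume ?A
  then obtain s where s: "0 \<le> s" "s \<le> t" "b s \<le> L s" by auto
  show ?B
  proof
    fix n
    show "\<exists>q\<in>D. 0 \<le> q \<and> q \<le> t \<and> b q < L q + 1 / real (Suc n)"
    proof (cases "s = t")
      case True
      have "0 < 1 / real (Suc n)" by simp
      moreover have "b t \<le> L t" using s True by simp
      ultimately have "b t < L t + 1 / real (Suc n)" by linarith
      then show ?thesis using s True D(2) by (intro bexI[of _ t]) auto
    next
      case False
      have "((\<lambda>u. b u - L u) \<longlongrightarrow> b s - L s) (at_right s)"
        by (intro tendsto_diff continuous_on_at_right b cadlag_right L s)
      moreover have "b s - L s < 1 / real (Suc n)"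
        using s by (smt (verit) of_nat_0_less_iff zero_less_Suc zero_less_divide_1_iff)
      ultimately have "\<forall>\<^sub>F u in at_right s. b u - L u < 1 / real (Suc n)"
        by (rule order_tendstoD)
      then obtain c where c: "c > s" "\<And>u. s < u \<Longrightarrow> u < c \<Longrightarrow> b u - L u < 1 / real (Suc n)"
        unfolding eventually_at_right_field by auto
      obtain q where "q \<in> D" "s < q" "q < min c t" using D(1)[of s "min c t"] c s False by auto
      then show ?thesis using c(2)[of q] s by (intro bexI[of _ q]) auto
    qed
  qed
next
  assume ?B
  then obtain q where q: "\<And>n. 0 \<le> q n" "\<And>n. q n \<le> t" "\<And>n. b (q n) < L (q n) + 1 / real (Suc n)"
    by metis
  have "\<forall>n. q n \<in> {0..t}" using q by auto
  then obtain s r where r: "s \<in> {0..t}" "strict_mono (r :: nat \<Rightarrow> nat)" "(q \<circ> r) \<longlonglongrightarrow> s"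
    using compact_Icc[of 0 t] unfolding compact_def by meson
  have "b s \<le> L s + e" if e: "e > 0" for e
  proof -
    have "\<forall>\<^sub>F u in at_right s. L u < L s + e"
      by (rule order_tendstoD(2)[OF cadlag_right[OF L(2)]]) (use r e in auto)
    then obtain c where c: "c > s" "\<And>u. s < u \<Longrightarrow> u < c \<Longrightarrow> L u < L s + e"
      unfolding eventually_at_right_field by auto
    \<comment> \<open>\<open>L u\<close> bounds \<open>L\<close> at every time below
      \<open>u\<close>, so it does not matter from which side the times \<open>q (r n)\<close>
      approach \<open>s\<close>.\<close>
    define u where "u = (s + c) / 2"
    have u: "s < u" "L u < L s + e" using c by (auto simp: u_def)
    have lb: "(\<lambda>n. b ((q \<circ> r) n)) \<longlonglongrightarrow> b s"
      by (rule continuous_on_tendsto_compose[OF b r(3)]) (use r q in auto)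
    have "(\<lambda>n. 1 / real (Suc (r n))) \<longlonglongrightarrow> 0"
      using LIMSEQ_subseq_LIMSEQ[OF LIMSEQ_inverse_real_of_nat r(2)] by (simp add: o_def divide_inverse)
    then have lu: "(\<lambda>n. L s + e + 1 / real (Suc (r n))) \<longlonglongrightarrow> L s + e + 0"
      by (intro tendsto_add tendsto_const)
    have "\<forall>\<^sub>F n in sequentially. (q \<circ> r) n < u"
      by (rule order_tendstoD(2)[OF r(3) u(1)])
    then have "\<forall>\<^sub>F n in sequentially. b ((q \<circ> r) n) \<le> L s + e + 1 / real (Suc (r n))"
    proof eventually_elim
      case (elim n)
      have "L (q (r n)) \<le> L u"
        using elim q(1)[of "r n"] r(1) u(1) by (intro mono_onD[OF L(1)]) auto
      then show ?case using q(3)[of "r n"] u(2) by simp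
    qed
    from tendsto_le[OF _ lu lb this] show ?thesis by simp
  qed
  then have "b s \<le> L s" by (rule field_le_epsilon)
  then show ?A using r by auto
qed

section \<open>Mean absorbed mass under a shifted barrier\<close>

lemma borel_measurable_antimono:
  fixes f :: "real \<Rightarrow> real"
  assumes "antimono f" shows "f \<in> borel_measurable borel"
proof -
  have "mono (\<lambda>x. - f x)" using assms by (auto simp: mono_def antimono_def)
  then have "(\<lambda>x. - (- f x)) \<in> borel_measurable borel"
    by (intro borel_measurable_uminus borel_measurable_mono)
  then show ?thesis by simp
qed

text \<open>The integral telescopes: translation by \<open>\<eta>\<close> turns
  \<open>q (x - \<eta>)\<close> on \<open>{a<..}\<close> into \<open>q\<close> on
  \<open>{a - \<eta><..}\<close>. What survives the cancellation is the integral of \<open>q\<close>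
  over an interval of length \<open>\<eta>\<close>, where \<open>q\<close> is at most
  \<open>q (a - \<eta>)\<close>.\<close>

lemma nn_integral_antitone_shift_le:
  fixes q :: "real \<Rightarrow> real"
  assumes q: "antimono q" "\<And>x. 0 \<le> q x" and \<eta>: "0 < \<eta>"
  shows "(\<integral>\<^sup>+x\<in>{a<..}. ennreal (q (x - \<eta>) - q x) \<partial>lborel) \<le> ennreal (\<eta> * q (a - \<eta>))"
proof -
  note [measurable] = borel_measurable_antimono[OF q(1)]
  \<comment> \<open>\<open>q\<close> need not be integrable on a half-line; on the bounded sets
    \<open>?A n\<close> its integral is finite and can be cancelled.\<close>
  let ?A = "\<lambda>n::nat. {a<..a + real n * \<eta>}"
  have bnd: "(\<integral>\<^sup>+x\<in>?A n. ennreal (q (x - \<eta>) - q x) \<partial>lborel) \<le> ennreal (\<eta> * q (a - \<eta>))" for n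
  proof -
    let ?I = "\<integral>\<^sup>+x\<in>?A n. ennreal (q x) \<partial>lborel"
    have "?I \<le> (\<integral>\<^sup>+x. ennreal (q a) * indicator (?A n) x \<partial>lborel)"
      by (intro nn_integral_mono) (auto simp: indicator_def intro!: ennreal_leI antimonoD[OF q(1)])
    also have "\<dots> = ennreal (q a) * emeasure lborel (?A n)"
      by (rule nn_integral_cmult_indicator) auto
    also have "\<dots> < \<infinity>" using \<eta> by (simp add: ennreal_mult_less_top)
    finally have fin: "?I < \<infinity>" .
    have "(\<integral>\<^sup>+x\<in>?A n. ennreal (q (x - \<eta>) - q x) \<partial>lborel) + ?I
        = (\<integral>\<^sup>+x. ennreal (q (x - \<eta>) - q x) * indicator (?A n) x + ennreal (q x) * indicator (?A n) x \<partial>lborel)"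
      by (rule nn_integral_add[symmetric]) auto
    also have "\<dots> = (\<integral>\<^sup>+x. ennreal (q (x - \<eta>)) * indicator (?A n) x \<partial>lborel)"
    proof (rule nn_integral_cong)
      fix x
      have "q x \<le> q (x - \<eta>)" by (rule antimonoD[OF q(1)]) (use \<eta> in auto)
      then show "ennreal (q (x - \<eta>) - q x) * indicator (?A n) x + ennreal (q x) * indicator (?A n) x
        = ennreal (q (x - \<eta>)) * indicator (?A n) x"
        using q(2) by (auto simp: indicator_def simp flip: ennreal_plus)
    qed
    also have "\<dots> = (\<integral>\<^sup>+x. ennreal (q x) * indicator (?A n) (x + \<eta>) \<partial>lborel)"
      using nn_integral_real_affine[of "\<lambda>x. ennreal (q (x - \<eta>)) * indicator (?A n) x" 1 \<eta>]
      by (simp add: add.commute)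
    also have "\<dots> \<le> (\<integral>\<^sup>+x. ennreal (q (a - \<eta>)) * indicator {a - \<eta><..a} x + ennreal (q x) * indicator (?A n) x \<partial>lborel)"
    proof (rule nn_integral_mono)
      fix x
      have *: "q x \<le> q (a - \<eta>)" if "a - \<eta> < x"
        by (rule antimonoD[OF q(1)]) (use that in auto)
      show "ennreal (q x) * indicator (?A n) (x + \<eta>)
        \<le> ennreal (q (a - \<eta>)) * indicator {a - \<eta><..a} x + ennreal (q x) * indicator (?A n) x"
        using * q(2) \<eta> by (auto simp: indicator_def intro!: ennreal_leI)
    qed
    also have "\<dots> = ennreal (\<eta> * q (a - \<eta>)) + ?I"
      using \<eta> q(2) by (subst nn_integral_add) (auto simp: nn_integral_cmult_indicator ennreal_mult' mult.commute)
    finally show ?thesis using fin by (auto simp add: ennreal_add_left_cancel_le add.commute)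
  qed
  have "(\<lambda>n. \<integral>\<^sup>+x\<in>?A n. ennreal (q (x - \<eta>) - q x) \<partial>lborel) \<longlonglongrightarrow> (\<integral>\<^sup>+x\<in>{a<..}. ennreal (q (x - \<eta>) - q x) \<partial>lborel)"
  proof (rule nn_integral_LIMSEQ)
    show "incseq (\<lambda>n x. ennreal (q (x - \<eta>) - q x) * indicator (?A n) x)"
    proof (intro incseq_SucI le_funI)
      fix n x
      have "real n * \<eta> \<le> real (Suc n) * \<eta>" using \<eta> by (intro mult_right_mono) auto
      then show "ennreal (q (x - \<eta>) - q x) * indicator (?A n) x \<le> ennreal (q (x - \<eta>) - q x) * indicator (?A (Suc n)) x"
        by (intro mult_left_mono) (auto simp: indicator_def)
    qed
    show "(\<lambda>x. ennreal (q (x - \<eta>) - q x) * indicator (?A n) x) \<in> borel_measurable lborel" for n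
      by measurable
    fix x
    obtain m where m: "(x - a) / \<eta> < real m" using reals_Archimedean2 by blast
    have "\<forall>\<^sub>F n in sequentially. ennreal (q (x - \<eta>) - q x) * indicator (?A n) x = ennreal (q (x - \<eta>) - q x) * indicator {a<..} x"
      using eventually_ge_at_top[of m]
    proof eventually_elim
      case (elim n)
      then have "(x - a) / \<eta> < real n" using m by linarith
      then have "x \<le> a + real n * \<eta>" using \<eta> by (simp add: field_simps)
      then show ?case by (auto simp: indicator_def)
    qed
    then show "(\<lambda>n. ennreal (q (x - \<eta>) - q x) * indicator (?A n) x) \<longlonglongrightarrow> ennreal (q (x - \<eta>) - q x) * indicator {a<..} x"
      by (rule tendsto_eventually)
  qed
  then show ?thesis by (rule LIMSEQ_le_const2) (use bnd in auto)
qed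

text \<open>\<open>g\<close> is at most \<open>1 - c\<close> plus \<open>c\<close> times the
  indicator of \<open>x > \<epsilon>\<close>, so the added mass is at most the corresponding mixture
  of the telescoping bounds started at 0 and at \<open>\<epsilon>\<close>. For a hitting probability
  \<open>q\<close>, the value \<open>q (\<epsilon> - \<eta>)\<close> is below 1, which is the
  saving.\<close>

lemma shifted_absorption_le:
  fixes q g :: "real \<Rightarrow> real"
  assumes q: "antimono q" "\<And>x. 0 \<le> q x" and \<eta>: "0 < \<eta>"
    and g: "(\<lambda>x. g x * indicator {0<..} x) \<in> borel_measurable borel" "\<And>x. 0 < x \<Longrightarrow> 0 \<le> g x" "\<And>x. 0 < x \<Longrightarrow> g x \<le> 1"
    and c: "\<And>x. 0 < x \<Longrightarrow> x \<le> \<epsilon> \<Longrightarrow> g x \<le> 1 - c" "0 \<le> c" "c \<le> 1" "0 < \<epsilon>"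
  shows "(\<integral>\<^sup>+x\<in>{0<..}. ennreal (q (x - \<eta>) * g x) \<partial>lborel)
     \<le> (\<integral>\<^sup>+x\<in>{0<..}. ennreal (q x * g x) \<partial>lborel) + ennreal (\<eta> * ((1 - c) * q (- \<eta>) + c * q (\<epsilon> - \<eta>)))"
proof -
  note [measurable] = borel_measurable_antimono[OF q(1)]
  let ?D = "\<lambda>x. ennreal (q (x - \<eta>) - q x)"
  have eq: "(\<lambda>x. ennreal (q x * g x) * indicator {0<..} x) = (\<lambda>x. ennreal (q x * (g x * indicator {0<..} x)))"
    by (auto simp: indicator_def)
  have [measurable]: "(\<lambda>x. ennreal (q x * g x) * indicator {0<..} x) \<in> borel_measurable borel"
    unfolding eq using g(1) by measurable
  have "(\<integral>\<^sup>+x\<in>{0<..}. ennreal (q (x - \<eta>) * g x) \<partial>lborel)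
    \<le> (\<integral>\<^sup>+x. ennreal (q x * g x) * indicator {0<..} x +
        (ennreal (1 - c) * (?D x * indicator {0<..} x) + ennreal c * (?D x * indicator {\<epsilon><..} x)) \<partial>lborel)"
  proof (rule nn_integral_mono)
    fix x :: real
    have D: "0 \<le> q (x - \<eta>) - q x" using antimonoD[OF q(1), of "x - \<eta>" x] \<eta> by auto
    show "ennreal (q (x - \<eta>) * g x) * indicator {0<..} x \<le> ennreal (q x * g x) * indicator {0<..} x +
        (ennreal (1 - c) * (?D x * indicator {0<..} x) + ennreal c * (?D x * indicator {\<epsilon><..} x))"
    proof (cases "0 < x")
      case True
      have "(q (x - \<eta>) - q x) * g x \<le> (q (x - \<eta>) - q x) * (if x \<le> \<epsilon> then 1 - c else 1)"
        using D True g c by (intro mult_left_mono) auto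
      then have "q (x - \<eta>) * g x \<le> q x * g x + ((1 - c) * (q (x - \<eta>) - q x) + c * (if x \<le> \<epsilon> then 0 else q (x - \<eta>) - q x))"
        by (auto simp: algebra_simps split: if_splits)
      then have "ennreal (q (x - \<eta>) * g x) \<le> ennreal (q x * g x + ((1 - c) * (q (x - \<eta>) - q x) + c * (if x \<le> \<epsilon> then 0 else q (x - \<eta>) - q x)))"
        by (rule ennreal_leI)
      also have "\<dots> = ennreal (q x * g x) + (ennreal (1 - c) * ?D x + ennreal c * (if x \<le> \<epsilon> then 0 else ?D x))"
        using D True g(2) q(2) c by (auto simp: ennreal_plus ennreal_mult)
      finally show ?thesis using True c by (auto simp: indicator_def)
    next
      case False
      then show ?thesis by (simp add: indicator_def)
    qed
  qed
  also have "\<dots> = (\<integral>\<^sup>+x\<in>{0<..}. ennreal (q x * g x) \<partial>lborel) +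
      (ennreal (1 - c) * (\<integral>\<^sup>+x\<in>{0<..}. ?D x \<partial>lborel) + ennreal c * (\<integral>\<^sup>+x\<in>{\<epsilon><..}. ?D x \<partial>lborel))"
    by (subst nn_integral_add; (subst nn_integral_add)?; (subst nn_integral_cmult)?; (subst nn_integral_cmult)?) measurable
  also have "\<dots> \<le> (\<integral>\<^sup>+x\<in>{0<..}. ennreal (q x * g x) \<partial>lborel) +
      (ennreal (1 - c) * ennreal (\<eta> * q (0 - \<eta>)) + ennreal c * ennreal (\<eta> * q (\<epsilon> - \<eta>)))"
    by (intro add_left_mono add_mono mult_left_mono nn_integral_antitone_shift_le q \<eta>) auto
  also have "ennreal (1 - c) * ennreal (\<eta> * q (0 - \<eta>)) + ennreal c * ennreal (\<eta> * q (\<epsilon> - \<eta>))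
      = ennreal (\<eta> * ((1 - c) * q (- \<eta>) + c * q (\<epsilon> - \<eta>)))"
    using \<eta> q(2) c by (simp add: distrib_left mult.left_commute flip: ennreal_mult ennreal_plus)
  finally show ?thesis .
qed

text \<open>The hypothesis \<open>eq\<close> is the McKean-Vlasov equation at time 0, where exactly
  the starting points \<open>x \<le> l\<close> are absorbed. A positive \<open>l\<close> would need
  mass \<open>l\<close> on an interval of length \<open>l\<close>, but \<open>g\<close> is bounded
  away from 1 near 0. This excludes a jump of \<open>\<Lambda>\<close> at time 0.\<close>

lemma feedback_fixed_point_zero:
  fixes g :: "real \<Rightarrow> real"
  assumes eq: "ennreal l = (\<integral>\<^sup>+x\<in>{0<..}. ennreal (of_bool (x \<le> l) * g x) \<partial>lborel)" and l: "0 \<le> l"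
    and g: "\<And>x. 0 < x \<Longrightarrow> 0 \<le> g x" "\<And>x. 0 < x \<Longrightarrow> g x \<le> 1"
    and c: "\<And>x. 0 < x \<Longrightarrow> x \<le> \<epsilon> \<Longrightarrow> g x \<le> 1 - c" "0 < c" "c \<le> 1" "0 < \<epsilon>"
  shows "l = 0"
proof (rule ccontr)
  assume "l \<noteq> 0"
  then have l: "0 < l" using l by simp
  define m where "m = min \<epsilon> l"
  have m: "0 < m" "m \<le> l" "m \<le> \<epsilon>" using l c by (auto simp: m_def)
  have "(\<integral>\<^sup>+x\<in>{0<..}. ennreal (of_bool (x \<le> l) * g x) \<partial>lborel)
    \<le> (\<integral>\<^sup>+x. ennreal (1 - c) * indicator {0<..m} x + 1 * indicator {m<..l} x \<partial>lborel)"
  proof (rule nn_integral_mono)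
    fix x
    show "ennreal (of_bool (x \<le> l) * g x) * indicator {0<..} x \<le> ennreal (1 - c) * indicator {0<..m} x + 1 * indicator {m<..l} x"
    proof (cases "0 < x \<and> x \<le> l")
      case True
      show ?thesis
      proof (cases "x \<le> m")
        case True2: True
        then show ?thesis using True c(1)[of x] m(3) by (auto simp: indicator_def intro!: ennreal_leI)
      next
        case False
        then show ?thesis using True g(2)[of x] by (auto simp: indicator_def)
      qed
    qed (auto simp: indicator_def)
  qed
  also have "\<dots> = ennreal (1 - c) * ennreal m + ennreal (l - m)"
    using m by (subst nn_integral_add) (auto simp: nn_integral_cmult_indicator)
  also have "\<dots> = ennreal ((1 - c) * m + (l - m))"
    using m c by (simp add: ennreal_mult ennreal_plus)
  finally have "ennreal l \<le> ennreal ((1 - c) * m + (l - m))" using eq by simp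
  moreover have "0 \<le> (1 - c) * m + (l - m)" using m c by simp
  ultimately have "l \<le> (1 - c) * m + (l - m)" using ennreal_le_iff by blast
  moreover have "0 < c * m" using c m by simp
  ultimately show False by (simp add: algebra_simps)
qed

section \<open>Particle counts at the first overshoot\<close>

lemma suminf_of_bool_cases:
  fixes P :: "nat \<Rightarrow> bool"
  obtains "(\<Sum>i. of_bool (P i) :: ennreal) = \<infinity>" | n where "(\<Sum>i. of_bool (P i) :: ennreal) = of_nat n"
proof (cases "finite {i. P i}")
  case True
  have "(\<Sum>i. of_bool (P i) :: ennreal) = (\<Sum>i\<in>{i. P i}. of_bool (P i))"
    by (rule suminf_finite) (use True in auto)
  also have "\<dots> = of_nat (card {i. P i})" by (simp add: of_bool_def)
  finally show ?thesis using that by blast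
next
  case False
  have "(\<Sum>i. of_bool (P i) :: ennreal) = (\<integral>\<^sup>+i. indicator {i. P i} i \<partial>count_space UNIV)"
    by (simp add: nn_integral_count_space_nat indicator_def of_bool_def)
  also have "\<dots> = \<infinity>" using False by simp
  finally show ?thesis using that by blast
qed


lemma of_bool_mono_ennreal: "(A \<Longrightarrow> B) \<Longrightarrow> of_bool A \<le> (of_bool B :: ennreal)"
  by (auto simp: of_bool_def)

lemma suminf_of_bool_disjoint_le:
  fixes P Q R :: "nat \<Rightarrow> bool"
  assumes "\<And>i. P i \<Longrightarrow> \<not> Q i" "\<And>i. P i \<Longrightarrow> R i" "\<And>i. Q i \<Longrightarrow> R i"
  shows "(\<Sum>i. of_bool (P i)) + (\<Sum>i. of_bool (Q i)) \<le> (\<Sum>i. of_bool (R i) :: ennreal)"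
proof -
  have "(\<Sum>i. of_bool (P i)) + (\<Sum>i. of_bool (Q i)) = (\<Sum>i. of_bool (P i) + of_bool (Q i) :: ennreal)"
    by (rule suminf_add) auto
  also have "\<dots> \<le> (\<Sum>i. of_bool (R i))"
    by (intro suminf_le) (use assms in auto)
  finally show ?thesis .
qed

text \<open>At the first time \<open>\<sigma>\<close> at which the barrier reaches \<open>L + \<eta>\<close>, minimality of the jump size
  rules out that the jump passes \<open>L \<sigma> + \<eta>\<close> unless enough particles lie below that level.\<close>

lemma barrier_overshoot:
  fixes W :: "nat \<Rightarrow> real \<Rightarrow> ereal"
  assumes bp: "barrier_path N W Z" and N: "1 \<le> N" and Z: "mono_on {0..} Z" "cadlag Z"
    and L: "mono_on {0..} L" "cadlag L" "\<And>t. 0 \<le> t \<Longrightarrow> 0 \<le> L t"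
    and \<eta>: "0 < \<eta>" and t: "0 \<le> t" "L t + \<eta> < Z t"
  obtains \<sigma> where "0 \<le> \<sigma>" "\<sigma> \<le> t"
    "ennreal (real N * (L \<sigma> + \<eta>)) \<le> (\<Sum>i. of_bool (\<exists>s. 0 \<le> s \<and> s \<le> \<sigma> \<and> W i s \<le> ereal (L s + \<eta>)))"
proof -
  define S where "S = {s. 0 \<le> s \<and> s \<le> t \<and> L s + \<eta> < Z s}"
  define \<sigma> where "\<sigma> = Inf S"
  have tS: "t \<in> S" using t by (simp add: S_def)
  have bdd: "bdd_below S" unfolding S_def by (rule bdd_belowI[of _ 0]) auto
  have \<sigma>: "0 \<le> \<sigma>" "\<sigma> \<le> t"
    unfolding \<sigma>_def using tS bdd by (auto intro!: cInf_greatest cInf_lower simp: S_def)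
  have before: "Z s \<le> L s + \<eta>" if "0 \<le> s" "s < \<sigma>" for s
  proof (rule ccontr)
    assume "\<not> ?thesis"
    then have "s \<in> S" using that \<sigma> by (auto simp: S_def)
    then have "\<sigma> \<le> s" unfolding \<sigma>_def using bdd by (rule cInf_lower)
    then show False using that by simp
  qed
  define b where "b = L \<sigma> + \<eta>"
  \<comment> \<open>If \<open>Z \<sigma>\<close> were below \<open>b\<close>, right continuity would
    keep \<open>Z\<close> below \<open>L + \<eta>\<close> for a while after \<open>\<sigma>\<close>,
    against the choice of \<open>\<sigma>\<close> as an infimum.\<close>
  have reach: "b \<le> Z \<sigma>"
  proof (rule ccontr)
    assume "\<not> ?thesis"
    then have neg: "Z \<sigma> - L \<sigma> < \<eta>" by (simp add: b_def)
    have "((\<lambda>u. Z u - L u) \<longlongrightarrow> Z \<sigma> - L \<sigma>) (at_right \<sigma>)"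
      by (intro tendsto_diff cadlag_right Z L \<sigma>)
    then have "\<forall>\<^sub>F u in at_right \<sigma>. Z u - L u < \<eta>" using neg by (rule order_tendstoD)
    then obtain c where c: "c > \<sigma>" "\<And>u. \<sigma> < u \<Longrightarrow> u < c \<Longrightarrow> Z u - L u < \<eta>"
      unfolding eventually_at_right_field by auto
    obtain s where s: "s \<in> S" "s < c"
      using cInf_lessD[of S c] c(1) tS unfolding \<sigma>_def by auto
    have "\<sigma> \<le> s" unfolding \<sigma>_def by (rule cInf_lower[OF s(1) bdd])
    then show False using c(2)[of s] s neg by (cases "s = \<sigma>") (auto simp: S_def)
  qed
  define l where "l = left_limit Z \<sigma>"
  have lim: "(Z \<longlongrightarrow> l) (at_left \<sigma>)" if "0 < \<sigma>"
  proof -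
    have "\<exists>l'. (Z \<longlongrightarrow> l') (at_left \<sigma>)" using Z(2) that \<sigma>(1) by (simp add: cadlag_def)
    then obtain l' where "(Z \<longlongrightarrow> l') (at_left \<sigma>)" ..
    then show ?thesis using that tendsto_Lim[of "at_left \<sigma>" Z l'] by (simp add: l_def left_limit_def)
  qed
  have evb: "\<forall>\<^sub>F s in at_left \<sigma>. 0 \<le> s \<and> s < \<sigma>" if "0 < \<sigma>"
    using eventually_at_left_real[OF that] by eventually_elim auto
  have lb: "l \<le> b"
  proof (cases "\<sigma> = 0")
    case True
    then show ?thesis using L(3)[of 0] \<eta> by (simp add: l_def left_limit_def b_def)
  next
    case False
    then have pos: "0 < \<sigma>" using \<sigma> by simp
    show ?thesis
    proof (rule tendsto_upperbound[OF lim[OF pos]])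
      show "\<forall>\<^sub>F s in at_left \<sigma>. Z s \<le> b"
        using evb[OF pos]
      proof eventually_elim
        case (elim s)
        then show ?case using before[of s] mono_onD[OF L(1), of s \<sigma>] by (auto simp: b_def)
      qed
    qed (use trivial_limit_at_left_real in auto)
  qed
  let ?\<tau> = "absorption_time W Z"
  define hit where "hit = (\<Sum>i. of_bool (\<exists>s. 0 \<le> s \<and> s \<le> \<sigma> \<and> W i s \<le> ereal (L s + \<eta>)) :: ennreal)"
  define past where "past s = (\<Sum>i. of_bool (?\<tau> i \<le> ereal s) :: ennreal)" for s
  define al where "al k = (\<Sum>i. of_bool (W i \<sigma> \<in> ereal ` {l..l + real k / real N} \<and> ereal \<sigma> \<le> ?\<tau> i) :: ennreal)" for k :: nat
  have past: "past s = ennreal (real N * Z s)" if "0 \<le> s" for s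
  proof -
    have eq: "ennreal (Z s) = past s / of_nat N" and nn: "0 \<le> Z s"
      using bp that unfolding barrier_path_def past_def by auto
    have "past s = past s / of_nat N * of_nat N"
      using N by (subst ennreal_divide_times) (simp add: ennreal_of_nat_eq_real_of_nat divide_ennreal)
    also have "\<dots> = ennreal (real N * Z s)"
      unfolding eq[symmetric] using nn by (simp add: ennreal_of_nat_eq_real_of_nat ennreal_mult' mult.commute)
    finally show ?thesis .
  qed
  have hit_past: "\<exists>s'. 0 \<le> s' \<and> s' < \<sigma> \<and> W i s' \<le> ereal (L s' + \<eta>)" if "?\<tau> i \<le> ereal s" "s < \<sigma>" for i s
  proof -
    have "?\<tau> i < ereal \<sigma>" by (rule le_less_trans[OF that(1)]) (use that in simp)
    then obtain s' where s': "0 \<le> s'" "W i s' \<le> ereal (Z s')" "s' < \<sigma>"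
      unfolding absorption_time_def first_time_def INF_less_iff by auto
    then have "ereal (Z s') \<le> ereal (L s' + \<eta>)" using before[of s'] by simp
    then show ?thesis using s' by (intro exI[of _ s']) (auto intro: order_trans)
  qed
  have hit_al: "\<exists>s. 0 \<le> s \<and> s \<le> \<sigma> \<and> W i s \<le> ereal (L s + \<eta>)"
    if "W i \<sigma> \<in> ereal ` {l..l + real k / real N}" "l + real k / real N \<le> b" for i k
    using that \<sigma> by (intro exI[of _ \<sigma>]) (auto simp: b_def)
  \<comment> \<open>The particles absorbed before \<open>\<sigma>\<close> and those still alive at
    \<open>\<sigma>\<close> in a window below \<open>b\<close> are disjoint groups, and all of them
    have crossed \<open>L + \<eta>\<close>.\<close>
  have key: "past s + al k \<le> hit" if "s < \<sigma>" "l + real k / real N \<le> b" for s k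
    unfolding past_def al_def hit_def
  proof (rule suminf_of_bool_disjoint_le)
    fix i
    show "\<not> (W i \<sigma> \<in> ereal ` {l..l + real k / real N} \<and> ereal \<sigma> \<le> ?\<tau> i)" if "?\<tau> i \<le> ereal s"
    proof
      assume "W i \<sigma> \<in> ereal ` {l..l + real k / real N} \<and> ereal \<sigma> \<le> ?\<tau> i"
      then have "ereal \<sigma> \<le> ereal s" using that order_trans[of "ereal \<sigma>" "?\<tau> i" "ereal s"] by simp
      then show False using \<open>s < \<sigma>\<close> by simp
    qed
    show "\<exists>s. 0 \<le> s \<and> s \<le> \<sigma> \<and> W i s \<le> ereal (L s + \<eta>)" if "?\<tau> i \<le> ereal s"
      using hit_past[OF that \<open>s < \<sigma>\<close>] by (auto intro: less_imp_le)
    show "\<exists>s. 0 \<le> s \<and> s \<le> \<sigma> \<and> W i s \<le> ereal (L s + \<eta>)"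
      if "W i \<sigma> \<in> ereal ` {l..l + real k / real N} \<and> ereal \<sigma> \<le> ?\<tau> i"
      using that hit_al \<open>l + real k / real N \<le> b\<close> by blast
  qed
  define K where "K = {k::nat. alive_mass N W Z \<sigma> {l .. l + real k / real N} \<le> ennreal (real k / real N)}"
  have jump: "ereal (Z \<sigma> - l) = (INF k \<in> K. ereal (real k)) / ereal (real N)"
    using bp \<sigma>(1) unfolding barrier_path_def K_def l_def by blast
  \<comment> \<open>Counts are integers: if \<open>k / N\<close> is not admissible as a jump, the
    window of width \<open>k / N\<close> holds more than \<open>k\<close> living particles, hence at
    least \<open>Suc k\<close>.\<close>
  have notK: "of_nat (Suc k) \<le> al k" if "k \<notin> K" for k
  proof -
    have "ennreal (real k / real N) < al k / of_nat N"
      using that by (simp add: K_def al_def alive_mass_def)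
    then have "al k > of_nat k"
    proof (rule contrapos_pp)
      assume "\<not> al k > of_nat k"
      then have "al k / of_nat N \<le> of_nat k / of_nat N"
        by (intro divide_right_mono_ennreal) simp
      also have "\<dots> = ennreal (real k / real N)"
        using N by (simp add: ennreal_of_nat_eq_real_of_nat divide_ennreal)
      finally show "\<not> ennreal (real k / real N) < al k / of_nat N" by simp
    qed
    then have gt: "of_nat k < al k" .
    show ?thesis
    proof (rule suminf_of_bool_cases[of "\<lambda>i. W i \<sigma> \<in> ereal ` {l..l + real k / real N} \<and> ereal \<sigma> \<le> ?\<tau> i"])
      fix n
      assume "(\<Sum>i. of_bool (W i \<sigma> \<in> ereal ` {l..l + real k / real N} \<and> ereal \<sigma> \<le> ?\<tau> i)) = (of_nat n :: ennreal)"
      then have n: "al k = of_nat n" by (simp only: al_def)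
      then have "k < n" using gt by simp
      then have "Suc k \<le> n" by simp
      then show ?thesis unfolding n of_nat_le_iff .
    qed (simp add: al_def)
  qed
  \<comment> \<open>The off-by-one matters: rejecting \<open>n - 1\<close> supplies \<open>n\<close>
    particles in a window that still lies below \<open>b\<close>. They are added to the absorbed
    ones, whose number tends to \<open>N * l\<close> as the time increases to
    \<open>\<sigma>\<close>. At \<open>\<sigma> = 0\<close> nothing was absorbed earlier, and
    \<open>l = 0\<close> by the convention in \<open>left_limit\<close>.\<close>
  have step: "ennreal (real N * l + real n) \<le> hit" if "n = 0 \<or> (n - 1 \<notin> K \<and> l + real (n - 1) / real N \<le> b)" for n
  proof (cases "hit = \<infinity>")
    case fin: False
    then obtain h where h: "hit = ennreal h" "0 \<le> h" by (cases hit) auto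
    have al_n: "of_nat n \<le> al (n - 1) \<or> n = 0" using that notK[of "n - 1"] by (cases n) auto
    show ?thesis
    proof (cases "\<sigma> = 0")
      case True
      then have l0: "l = 0" by (simp add: l_def left_limit_def)
      have "al (n - 1) \<le> hit" if "n \<noteq> 0"
        unfolding al_def hit_def
      proof (rule suminf_le)
        have "l + real (n - 1) / real N \<le> b" using \<open>n = 0 \<or> _\<close> that by blast
        then show "of_bool (W i \<sigma> \<in> ereal ` {l..l + real (n - 1) / real N} \<and> ereal \<sigma> \<le> ?\<tau> i)
          \<le> (of_bool (\<exists>s. 0 \<le> s \<and> s \<le> \<sigma> \<and> W i s \<le> ereal (L s + \<eta>)) :: ennreal)" for i
          using hit_al[of i "n - 1"] by (intro of_bool_mono_ennreal) blast
      qed auto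
      then show ?thesis
        using al_n by (cases "n = 0") (auto simp: l0 ennreal_of_nat_eq_real_of_nat)
    next
      case False
      then have pos: "0 < \<sigma>" using \<sigma> by simp
      have "real N * Z s + real n \<le> h" if s: "0 \<le> s" "s < \<sigma>" for s
      proof -
        have Z0: "0 \<le> Z s" using bp s unfolding barrier_path_def by blast
        have "past s + of_nat n \<le> hit"
        proof (cases "n = 0")
          case True
          have "past s \<le> hit"
            unfolding past_def hit_def
          proof (intro suminf_le of_bool_mono_ennreal)
            show "\<exists>s. 0 \<le> s \<and> s \<le> \<sigma> \<and> W i s \<le> ereal (L s + \<eta>)" if "?\<tau> i \<le> ereal s" for i
              using hit_past[OF that s(2)] by (auto intro: less_imp_le)
          qed auto
          then show ?thesis using True by simp
        next
          case False
          then have "past s + al (n - 1) \<le> hit" using key[OF s(2)] that \<open>n = 0 \<or> _\<close> by blast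
          then show ?thesis using al_n False by (auto intro: order_trans[OF add_left_mono])
        qed
        then show ?thesis using s Z0 h
          by (simp add: past ennreal_of_nat_eq_real_of_nat flip: ennreal_plus)
      qed
      then have "\<forall>\<^sub>F s in at_left \<sigma>. real N * Z s + real n \<le> h"
        using evb[OF pos] by (auto elim: eventually_mono)
      moreover have "((\<lambda>s. real N * Z s + real n) \<longlongrightarrow> real N * l + real n) (at_left \<sigma>)"
        by (intro tendsto_intros lim pos)
      ultimately have "real N * l + real n \<le> h"
        by (intro tendsto_upperbound[where F="at_left \<sigma>"]) (use trivial_limit_at_left_real in auto)
      then show ?thesis using h by (simp add: ennreal_leI)
    qed
  qed simp
  have Kmin: "Z \<sigma> - l \<le> real k / real N" if "k \<in> K" for k
  proof -
    have "ereal (Z \<sigma> - l) \<le> ereal (real k) / ereal (real N)"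
      unfolding jump using N that by (intro ereal_divide_right_mono INF_lower) auto
    then show ?thesis using N by simp
  qed
  \<comment> \<open>\<open>k0\<close> is the largest \<open>k\<close> whose window stays below
    \<open>b\<close>. If it is rejected, the \<open>Suc k0\<close> particles it supplies exceed
    \<open>N * (b - l)\<close>. If it is admissible, the jump is at most \<open>k0 / N\<close>, so
    the barrier lands exactly on \<open>b\<close>, and for \<open>k0 > 0\<close> minimality shows
    that \<open>k0 - 1\<close> was rejected.\<close>
  define k0 where "k0 = nat \<lfloor>real N * (b - l)\<rfloor>"
  have k0: "real k0 \<le> real N * (b - l)" "real N * (b - l) < real k0 + 1"
    using lb N by (auto simp: k0_def)
  have k0b: "l + real k0 / real N \<le> b" using k0(1) N by (simp add: field_simps)
  have "ennreal (real N * b) \<le> hit"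
  proof (cases "k0 \<in> K")
    case False
    have "ennreal (real N * b) \<le> ennreal (real N * l + real (Suc k0))"
      using k0 by (intro ennreal_leI) (auto simp: algebra_simps)
    also have "\<dots> \<le> hit" using False k0b by (intro step) auto
    finally show ?thesis .
  next
    case True
    have eq: "b = l + real k0 / real N" "Z \<sigma> = b" using Kmin[OF True] reach k0b by auto
    have "k0 = 0 \<or> (k0 - 1 \<notin> K \<and> l + real (k0 - 1) / real N \<le> b)"
    proof (cases "k0 = 0")
      case False
      then have lt: "real (k0 - 1) / real N < real k0 / real N"
        using N by (intro divide_strict_right_mono) auto
      then show ?thesis using Kmin[of "k0 - 1"] eq by auto
    qed simp
    then have "ennreal (real N * l + real k0) \<le> hit" by (rule step)
    also have "real N * l + real k0 = real N * b" using eq N by (simp add: field_simps)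
    finally show ?thesis .
  qed
  then show ?thesis using that[OF \<sigma>] by (simp add: hit_def b_def)
qed

section \<open>Maximal inequalities\<close>

text \<open>The library says nothing about \<open>poisson_pmf 0\<close>.\<close>

definition poisson_law :: "real \<Rightarrow> nat pmf" where
  "poisson_law r = (if r = 0 then return_pmf 0 else poisson_pmf r)"

lemma pmf_poisson_law: "0 \<le> r \<Longrightarrow> pmf (poisson_law r) k = r ^ k / fact k * exp (- r)"
  by (auto simp: poisson_law_def power_0_left)

lemma nn_integral_poisson_power:
  assumes "0 \<le> r" "0 \<le> z"
  shows "(\<integral>\<^sup>+k. ennreal (z ^ k) \<partial>measure_pmf (poisson_law r)) = ennreal (exp (r * (z - 1)))"
proof -
  have s: "(\<lambda>k. exp (- r) * ((r * z) ^ k /\<^sub>R fact k)) sums (exp (- r) * exp (r * z))"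
    by (intro sums_mult exp_converges)
  have "(\<integral>\<^sup>+k. ennreal (z ^ k) \<partial>measure_pmf (poisson_law r))
      = (\<Sum>k. ennreal (pmf (poisson_law r) k) * ennreal (z ^ k))"
    by (simp add: nn_integral_measure_pmf nn_integral_count_space_nat)
  also have "\<dots> = (\<Sum>k. ennreal (exp (- r) * ((r * z) ^ k /\<^sub>R fact k)))"
    using assms by (intro suminf_cong) (simp add: pmf_poisson_law power_mult_distrib field_simps flip: ennreal_mult')
  also have "\<dots> = ennreal (exp (- r) * exp (r * z))"
    using assms by (intro suminf_ennreal_eq s) auto
  finally show ?thesis by (simp add: algebra_simps flip: exp_add)
qed

text \<open>Split by the first index at which the partial sum reaches \<open>x + y\<close>. The
  later increments are independent of that event and sum to at least \<open>- x\<close> with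
  probability at least 1/2, so at least half of the event leads to a final sum of at least
  \<open>y\<close>. It serves for compensated Poisson counts and for Brownian increments on a
  grid.\<close>

lemma (in prob_space) ottaviani:
  fixes X :: "nat \<Rightarrow> 'a \<Rightarrow> real"
  assumes ind: "indep_vars (\<lambda>_. borel) X {..<n}"
    and tail: "\<And>k. k < n \<Longrightarrow> 1 / 2 \<le> prob {\<omega> \<in> space M. - x \<le> (\<Sum>i\<in>{k<..<n}. X i \<omega>)}"
  shows "prob {\<omega> \<in> space M. \<exists>k<n. x + y \<le> (\<Sum>i\<le>k. X i \<omega>)} \<le> 2 * prob {\<omega> \<in> space M. y \<le> (\<Sum>i<n. X i \<omega>)}"
proof -
  have X[measurable]: "X i \<in> borel_measurable M" if "i < n" for i
    using ind that by (auto simp: indep_vars_def)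
  define S where "S k \<omega> = (\<Sum>i\<le>k. X i \<omega>)" for k \<omega>
  define A where "A k = {\<omega> \<in> space M. x + y \<le> S k \<omega> \<and> (\<forall>j<k. S j \<omega> < x + y)}" for k
  define R where "R k = {\<omega> \<in> space M. - x \<le> (\<Sum>i\<in>{k<..<n}. X i \<omega>)}" for k
  have Sm[measurable]: "S k \<in> borel_measurable M" if "k < n" for k
    unfolding S_def using that by (intro borel_measurable_sum) auto
  have A: "A k \<in> events" if "k < n" for k
  proof -
    have [measurable]: "S j \<in> borel_measurable M" if "j \<le> k" for j
      using that \<open>k < n\<close> by (intro Sm) auto
    have "A k = {\<omega> \<in> space M. x + y \<le> S k \<omega> \<and> (\<forall>j\<in>{..<k}. S j \<omega> < x + y)}"
      by (auto simp: A_def)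
    also have "\<dots> \<in> events" by measurable
    finally show ?thesis .
  qed
  have R: "R k \<in> events" for k
    unfolding R_def by measurable
  have dis: "disjoint_family_on A {..<n}"
    unfolding disjoint_family_on_def
  proof (intro ballI impI)
    fix i j :: nat assume "i \<noteq> j"
    have *: "A i \<inter> A j = {}" if "i < j" for i j
    proof -
      have "x + y \<le> S i \<omega>" if "\<omega> \<in> A i" for \<omega> using that by (simp add: A_def)
      moreover have "S i \<omega> < x + y" if "\<omega> \<in> A j" for \<omega> using that \<open>i < j\<close> by (simp add: A_def)
      ultimately show ?thesis by (meson disjoint_iff not_le)
    qed
    show "A i \<inter> A j = {}" using *[of i j] *[of j i] \<open>i \<noteq> j\<close> by (cases i j rule: linorder_cases) auto
  qed
  have ex: "{\<omega> \<in> space M. \<exists>k<n. x + y \<le> (\<Sum>i\<le>k. X i \<omega>)} = (\<Union>k<n. A k)"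
  proof (intro set_eqI iffI)
    fix \<omega> assume "\<omega> \<in> {\<omega> \<in> space M. \<exists>k<n. x + y \<le> (\<Sum>i\<le>k. X i \<omega>)}"
    then obtain k where k: "\<omega> \<in> space M" "k < n" "x + y \<le> S k \<omega>" by (auto simp: S_def)
    define m where "m = (LEAST k. x + y \<le> S k \<omega>)"
    have "x + y \<le> S m \<omega>" unfolding m_def by (rule LeastI[of "\<lambda>k. x + y \<le> S k \<omega>", OF k(3)])
    moreover have "m \<le> k" unfolding m_def by (rule Least_le[of "\<lambda>k. x + y \<le> S k \<omega>", OF k(3)])
    moreover have "S j \<omega> < x + y" if "j < m" for j
      using not_less_Least[of j "\<lambda>k. x + y \<le> S k \<omega>"] that by (simp add: m_def not_le)
    ultimately have "\<omega> \<in> A m" "m < n" using k by (simp_all add: A_def)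
    then show "\<omega> \<in> (\<Union>k<n. A k)" by blast
  qed (auto simp: A_def S_def)
  \<comment> \<open>\<open>A k\<close> is determined by the variables up to index \<open>k\<close>,
    and \<open>R k\<close> by those after it.\<close>
  have indep: "prob (A k \<inter> R k) = prob (A k) * prob (R k)" if k: "k < n" for k
  proof -
    let ?PA = "PiM {..k} (\<lambda>_. borel :: real measure)" and ?PB = "PiM {k<..<n} (\<lambda>_. borel :: real measure)"
    let ?XA = "{f \<in> space ?PA. x + y \<le> (\<Sum>i\<le>k. f i) \<and> (\<forall>j\<in>{..<k}. (\<Sum>i\<le>j. f i) < x + y)}"
    let ?XB = "{f \<in> space ?PB. - x \<le> (\<Sum>i\<in>{k<..<n}. f i)}"
    have ms: "(\<lambda>f. \<Sum>i\<le>j. f i) \<in> borel_measurable ?PA" if "j \<le> k" for j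
      using that by (intro borel_measurable_sum measurable_component_singleton) auto
    have iv: "indep_var ?PA (\<lambda>\<omega>. restrict (\<lambda>i. X i \<omega>) {..k}) ?PB (\<lambda>\<omega>. restrict (\<lambda>i. X i \<omega>) {k<..<n})"
      by (rule indep_var_restrict[OF ind]) (use k in auto)
    have "?XA \<in> sets ?PA"
    proof -
      have [measurable]: "(\<lambda>f. \<Sum>i\<le>j. f i) \<in> borel_measurable ?PA" if "j \<le> k" for j
        using that by (rule ms)
      show ?thesis by measurable
    qed
    moreover have "?XB \<in> sets ?PB" by measurable
    ultimately have "prob ((\<lambda>\<omega>. (restrict (\<lambda>i. X i \<omega>) {..k}, restrict (\<lambda>i. X i \<omega>) {k<..<n})) -` (?XA \<times> ?XB) \<inter> space M)
      = prob ((\<lambda>\<omega>. restrict (\<lambda>i. X i \<omega>) {..k}) -` ?XA \<inter> space M) * prob ((\<lambda>\<omega>. restrict (\<lambda>i. X i \<omega>) {k<..<n}) -` ?XB \<inter> space M)"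
      by (rule indep_varD[OF iv])
    moreover have "restrict (\<lambda>i. X i \<omega>) {..k} \<in> ?XA \<longleftrightarrow> x + y \<le> S k \<omega> \<and> (\<forall>j<k. S j \<omega> < x + y)" for \<omega>
    proof -
      have "(\<Sum>i\<le>j. restrict (\<lambda>i. X i \<omega>) {..k} i) = S j \<omega>" if "j \<le> k" for j
        unfolding S_def using that by (intro sum.cong) auto
      then show ?thesis by (simp add: space_PiM Ball_def)
    qed
    then have "(\<lambda>\<omega>. restrict (\<lambda>i. X i \<omega>) {..k}) -` ?XA \<inter> space M = A k"
      by (simp add: A_def vimage_def Int_def conj_commute)
    moreover have "restrict (\<lambda>i. X i \<omega>) {k<..<n} \<in> ?XB \<longleftrightarrow> - x \<le> (\<Sum>i\<in>{k<..<n}. X i \<omega>)" for \<omega>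
      by (simp add: space_PiM)
    then have "(\<lambda>\<omega>. restrict (\<lambda>i. X i \<omega>) {k<..<n}) -` ?XB \<inter> space M = R k"
      by (simp add: R_def vimage_def Int_def conj_commute)
    moreover have "(\<lambda>\<omega>. (restrict (\<lambda>i. X i \<omega>) {..k}, restrict (\<lambda>i. X i \<omega>) {k<..<n})) -` (?XA \<times> ?XB) \<inter> space M
      = ((\<lambda>\<omega>. restrict (\<lambda>i. X i \<omega>) {..k}) -` ?XA \<inter> space M) \<inter> ((\<lambda>\<omega>. restrict (\<lambda>i. X i \<omega>) {k<..<n}) -` ?XB \<inter> space M)"
      by blast
    ultimately show ?thesis by (simp only:)
  qed
  have "prob (\<Union>k<n. A k) = (\<Sum>k<n. prob (A k))"
    by (rule finite_measure_finite_Union) (simp_all add: A dis image_subset_iff)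
  also have "\<dots> \<le> (\<Sum>k<n. 2 * prob (A k \<inter> R k))"
  proof (rule sum_mono)
    fix k assume "k \<in> {..<n}"
    then have k: "k < n" by simp
    have "prob (A k) * (1 / 2) \<le> prob (A k) * prob (R k)"
      using tail[OF k] by (intro mult_left_mono) (auto simp: R_def)
    then show "prob (A k) \<le> 2 * prob (A k \<inter> R k)" by (simp add: indep[OF k])
  qed
  also have "\<dots> = 2 * prob (\<Union>k<n. A k \<inter> R k)"
  proof -
    have "disjoint_family_on (\<lambda>k. A k \<inter> R k) {..<n}"
      by (rule disjoint_family_on_bisimulation[OF dis]) blast
    moreover have "(\<lambda>k. A k \<inter> R k) ` {..<n} \<subseteq> events"
      using A R by (simp add: image_subset_iff sets.Int)
    ultimately have "prob (\<Union>k<n. A k \<inter> R k) = (\<Sum>k<n. prob (A k \<inter> R k))"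
      using finite_measure_finite_Union[OF finite_lessThan] by blast
    then show ?thesis by (simp only: sum_distrib_left)
  qed
  also have "\<dots> \<le> 2 * prob {\<omega> \<in> space M. y \<le> (\<Sum>i<n. X i \<omega>)}"
  proof (intro mult_left_mono finite_measure_mono subsetI)
    fix \<omega> assume "\<omega> \<in> (\<Union>k<n. A k \<inter> R k)"
    then obtain k where k: "k < n" "\<omega> \<in> space M" "x + y \<le> (\<Sum>i\<le>k. X i \<omega>)" "- x \<le> (\<Sum>i\<in>{k<..<n}. X i \<omega>)"
      by (auto simp: A_def R_def S_def)
    have eq: "{..<n} = {..k} \<union> {k<..<n}" using k by auto
    have "(\<Sum>i<n. X i \<omega>) = (\<Sum>i\<le>k. X i \<omega>) + (\<Sum>i\<in>{k<..<n}. X i \<omega>)"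
      unfolding eq by (rule sum.union_disjoint) auto
    then show "\<omega> \<in> {\<omega> \<in> space M. y \<le> (\<Sum>i<n. X i \<omega>)}" using k by simp
  next
    have "(\<lambda>\<omega>. \<Sum>i<n. X i \<omega>) \<in> borel_measurable M" by (intro borel_measurable_sum X) simp
    then show "{\<omega> \<in> space M. y \<le> (\<Sum>i<n. X i \<omega>)} \<in> events" by measurable
  qed simp
  finally show ?thesis unfolding ex .
qed

text \<open>For negative \<open>t\<close>, the quadratic Taylor lower bound of \<open>exp u\<close>
  at \<open>u = - t\<close> times \<open>1 - u + u^2\<close> is at least 1. Both signs of
  \<open>t\<close> occur, because one Chernoff bound has to give upper and lower tails.\<close>

lemma exp_quadratic_bound:
  fixes t :: real
  assumes "\<bar>t\<bar> \<le> 1"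
  shows "exp t \<le> 1 + t + t\<^sup>2"
proof (cases "0 \<le> t")
  case True
  then show ?thesis using exp_bound assms by simp
next
  case False
  define u where "u = - t"
  have u: "0 < u" "u \<le> 1" using False assms by (auto simp: u_def)
  have "(1 + u + u\<^sup>2 / 2) * (1 - u + u\<^sup>2) = 1 + u\<^sup>2 / 2 * (1 + u + u\<^sup>2)"
    by (simp add: power2_eq_square field_simps)
  then have "1 \<le> (1 + u + u\<^sup>2 / 2) * (1 - u + u\<^sup>2)" using u by simp
  also have "\<dots> \<le> exp u * (1 - u + u\<^sup>2)"
    using exp_lower_Taylor_quadratic[of u] u by (intro mult_right_mono) auto
  finally have "exp (- u) \<le> 1 - u + u\<^sup>2"
    by (simp add: exp_minus field_simps)
  then show ?thesis by (simp add: u_def)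
qed

lemma (in prob_space) poisson_sum_chernoff:
  fixes C :: "nat \<Rightarrow> 'a \<Rightarrow> nat"
  assumes I: "finite I" and ind: "indep_vars (\<lambda>_. count_space UNIV) C I"
    and distr: "\<And>i. i \<in> I \<Longrightarrow> distr M (count_space UNIV) (C i) = measure_pmf (poisson_law (r i))"
    and r: "\<And>i. i \<in> I \<Longrightarrow> 0 \<le> r i" "(\<Sum>i\<in>I. r i) \<le> v" and s: "\<bar>s\<bar> \<le> 1"
  shows "prob {\<omega> \<in> space M. x \<le> s * (\<Sum>i\<in>I. real (C i \<omega>) - r i)} \<le> exp (s\<^sup>2 * v - x)"
proof -
  have C[measurable]: "C i \<in> measurable M (count_space UNIV)" if "i \<in> I" for i
    using ind that by (auto simp: indep_vars_def)
  let ?Y = "\<lambda>i \<omega>. ennreal (exp (s * (real (C i \<omega>) - r i)))"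
  have Ym: "(\<lambda>\<omega>. exp (s * (\<Sum>i\<in>I. real (C i \<omega>) - r i))) \<in> borel_measurable M"
    by measurable
  have E: "(\<integral>\<^sup>+\<omega>. ennreal (exp (s * (\<Sum>i\<in>I. real (C i \<omega>) - r i))) \<partial>M) \<le> ennreal (exp (s\<^sup>2 * v))"
  proof -
    have "(\<integral>\<^sup>+\<omega>. ennreal (exp (s * (\<Sum>i\<in>I. real (C i \<omega>) - r i))) \<partial>M) = (\<integral>\<^sup>+\<omega>. (\<Prod>i\<in>I. ?Y i \<omega>) \<partial>M)"
      using I by (intro nn_integral_cong) (simp add: sum_distrib_left exp_sum prod_ennreal)
    also have "\<dots> = (\<Prod>i\<in>I. \<integral>\<^sup>+\<omega>. ?Y i \<omega> \<partial>M)"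
    proof (rule indep_vars_nn_integral[OF I])
      show "indep_vars (\<lambda>_. borel) ?Y I"
        by (rule indep_vars_compose2[OF ind]) auto
    qed auto
    also have "\<dots> \<le> (\<Prod>i\<in>I. ennreal (exp (s\<^sup>2 * r i)))"
    proof (rule prod_mono_ennreal)
      fix i assume i: "i \<in> I"
      have "(\<integral>\<^sup>+\<omega>. ?Y i \<omega> \<partial>M) = (\<integral>\<^sup>+k. ennreal (exp (s * (real k - r i))) \<partial>distr M (count_space UNIV) (C i))"
        using i by (subst nn_integral_distr) auto
      also have "\<dots> = (\<integral>\<^sup>+k. ennreal (exp (- s * r i)) * ennreal (exp s ^ k) \<partial>measure_pmf (poisson_law (r i)))"
        unfolding distr[OF i]
        by (intro nn_integral_cong) (simp add: algebra_simps exp_diff exp_minus field_simps flip: ennreal_mult' exp_of_nat_mult)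
      also have "\<dots> = ennreal (exp (- s * r i)) * ennreal (exp (r i * (exp s - 1)))"
        using r(1)[OF i] by (subst nn_integral_cmult) (auto simp: nn_integral_poisson_power)
      also have "\<dots> = ennreal (exp (r i * (exp s - 1 - s)))"
        by (simp add: algebra_simps flip: ennreal_mult' exp_add)
      also have "\<dots> \<le> ennreal (exp (s\<^sup>2 * r i))"
      proof (intro ennreal_leI, subst exp_le_cancel_iff)
        have "exp s - 1 - s \<le> s\<^sup>2" using exp_quadratic_bound[OF s] by simp
        then show "r i * (exp s - 1 - s) \<le> s\<^sup>2 * r i" using r(1)[OF i]
          using mult_left_mono[of "exp s - 1 - s" "s\<^sup>2" "r i"] by (simp add: mult.commute)
      qed
      finally show "(\<integral>\<^sup>+\<omega>. ?Y i \<omega> \<partial>M) \<le> ennreal (exp (s\<^sup>2 * r i))" .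
    qed
    also have "\<dots> = ennreal (exp (s\<^sup>2 * (\<Sum>i\<in>I. r i)))"
      using I by (simp add: prod_ennreal exp_sum sum_distrib_left)
    also have "\<dots> \<le> ennreal (exp (s\<^sup>2 * v))"
      using r(2) by (intro ennreal_leI) (simp add: mult_left_mono)
    finally show ?thesis .
  qed
  have int: "integrable M (\<lambda>\<omega>. exp (s * (\<Sum>i\<in>I. real (C i \<omega>) - r i)))"
    using E by (intro integrableI_nonneg Ym) (auto simp: le_less_trans top.not_eq_extremum)
  have "{\<omega> \<in> space M. x \<le> s * (\<Sum>i\<in>I. real (C i \<omega>) - r i)} = {\<omega> \<in> space M. exp x \<le> exp (s * (\<Sum>i\<in>I. real (C i \<omega>) - r i))}"
    by simp
  also have "prob \<dots> \<le> expectation (\<lambda>\<omega>. exp (s * (\<Sum>i\<in>I. real (C i \<omega>) - r i))) / exp x"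
    by (rule integral_Markov_inequality_measure[OF int, of "space M"]) auto
  also have "\<dots> \<le> exp (s\<^sup>2 * v) / exp x"
  proof (intro divide_right_mono)
    show "expectation (\<lambda>\<omega>. exp (s * (\<Sum>i\<in>I. real (C i \<omega>) - r i))) \<le> exp (s\<^sup>2 * v)"
      using E by (subst (asm) nn_integral_eq_integral[OF int]) auto
  qed simp
  finally show ?thesis by (simp add: exp_diff)
qed

text \<open>The bound \<open>exp (s\<^sup>2 v - s x)\<close> serves twice: as Chernoff bound for the final sum and,
  being at most \<open>1/2\<close>, as the tail hypothesis of Ottaviani's inequality.\<close>

lemma (in prob_space) poisson_maximal_inequality:
  fixes C :: "nat \<Rightarrow> 'a \<Rightarrow> nat"
  assumes ind: "indep_vars (\<lambda>_. count_space UNIV) C {..<n}"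
    and distr: "\<And>i. i < n \<Longrightarrow> distr M (count_space UNIV) (C i) = measure_pmf (poisson_law (r i))"
    and r: "\<And>i. i < n \<Longrightarrow> 0 \<le> r i" "(\<Sum>i<n. r i) \<le> v" and s: "0 \<le> s" "s \<le> 1"
  shows "prob {\<omega> \<in> space M. \<exists>k<n. 2 * x \<le> (\<Sum>i\<le>k. real (C i \<omega>) - r i)} \<le> 2 * exp (s\<^sup>2 * v - s * x)"
proof (cases "exp (s\<^sup>2 * v - s * x) \<le> 1 / 2")
  case True
  have "s \<noteq> 0" using True by auto
  then have s': "0 < s" using s by simp
  have C[measurable]: "C i \<in> measurable M (count_space UNIV)" if "i < n" for i
    using ind that by (auto simp: indep_vars_def)
  have ind': "indep_vars (\<lambda>_. borel) (\<lambda>i \<omega>. real (C i \<omega>) - r i) {..<n}"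
    by (rule indep_vars_compose2[OF ind]) auto
  have ind'm: "(\<lambda>\<omega>. real (C i \<omega>) - r i) \<in> borel_measurable M" if "i \<in> {..<n}" for i
    using ind' that by (auto simp: indep_vars_def)
  have "prob {\<omega> \<in> space M. \<exists>k<n. x + x \<le> (\<Sum>i\<le>k. real (C i \<omega>) - r i)}
    \<le> 2 * prob {\<omega> \<in> space M. x \<le> (\<Sum>i<n. real (C i \<omega>) - r i)}"
  proof (rule ottaviani[OF ind'])
    fix k assume k: "k < n"
    have "(\<Sum>i\<in>{k<..<n}. r i) \<le> (\<Sum>i<n. r i)"
      by (rule sum_mono2) (use r in auto)
    then have v: "(\<Sum>i\<in>{k<..<n}. r i) \<le> v" using r by simp
    have sub: "{k<..<n} \<subseteq> {..<n}" by auto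
    \<comment> \<open>The lower tail is the Chernoff bound with tilt \<open>- s\<close>; by the case
      assumption it is at most 1/2.\<close>
    have "prob {\<omega> \<in> space M. s * x \<le> (- s) * (\<Sum>i\<in>{k<..<n}. real (C i \<omega>) - r i)} \<le> exp ((- s)\<^sup>2 * v - s * x)"
      by (rule poisson_sum_chernoff[OF _ indep_vars_subset[OF ind sub]]) (use distr r v s in auto)
    then have *: "prob {\<omega> \<in> space M. s * x \<le> (- s) * (\<Sum>i\<in>{k<..<n}. real (C i \<omega>) - r i)} \<le> 1 / 2"
      using True by simp
    let ?E = "{\<omega> \<in> space M. - x \<le> (\<Sum>i\<in>{k<..<n}. real (C i \<omega>) - r i)}"
    have [measurable]: "(\<lambda>\<omega>. \<Sum>i\<in>{k<..<n}. real (C i \<omega>) - r i) \<in> borel_measurable M"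
      using sub by (intro borel_measurable_sum ind'm) auto
    have [measurable]: "?E \<in> events" by measurable
    have "1 - prob ?E = prob (space M - ?E)" by (simp add: prob_compl)
    also have "\<dots> \<le> prob {\<omega> \<in> space M. s * x \<le> (- s) * (\<Sum>i\<in>{k<..<n}. real (C i \<omega>) - r i)}"
    proof (rule finite_measure_mono)
      show "space M - ?E \<subseteq> {\<omega> \<in> space M. s * x \<le> (- s) * (\<Sum>i\<in>{k<..<n}. real (C i \<omega>) - r i)}"
      proof
        fix \<omega> assume "\<omega> \<in> space M - ?E"
        then have "\<omega> \<in> space M" "x \<le> - (\<Sum>i\<in>{k<..<n}. real (C i \<omega>) - r i)" by auto
        moreover from this(2) have "s * x \<le> s * (- (\<Sum>i\<in>{k<..<n}. real (C i \<omega>) - r i))"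
          using s by (rule_tac mult_left_mono) auto
        ultimately show "\<omega> \<in> {\<omega> \<in> space M. s * x \<le> (- s) * (\<Sum>i\<in>{k<..<n}. real (C i \<omega>) - r i)}" by simp
      qed
    qed measurable
    finally show "1 / 2 \<le> prob ?E" using * by simp
  qed
  also have "{\<omega> \<in> space M. x \<le> (\<Sum>i<n. real (C i \<omega>) - r i)} = {\<omega> \<in> space M. s * x \<le> s * (\<Sum>i<n. real (C i \<omega>) - r i)}"
    using s' by simp
  also have "prob \<dots> \<le> exp (s\<^sup>2 * v - s * x)"
    by (rule poisson_sum_chernoff[OF _ ind]) (use distr r s in auto)
  finally show ?thesis by simp
next
  case False
  then have "1 \<le> 2 * exp (s\<^sup>2 * v - s * x)" by simp
  then show ?thesis using prob_le_1 order_trans by blast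
qed

section \<open>The Laplace functional of a Poisson process\<close>

text \<open>The map \<open>exp (- c)\<close> extended to \<open>c = \<infinity>\<close> by 0, so
  that infinite counts and infinite intensities keep a meaning in the Laplace functional.\<close>

definition nexp :: "ennreal \<Rightarrow> real" where
  "nexp c = (if c = \<top> then 0 else exp (- enn2real c))"

lemma nexp_simps[simp]: "nexp 0 = 1" "nexp \<top> = 0"
  by (simp_all add: nexp_def)

lemma nexp_ennreal: "0 \<le> a \<Longrightarrow> nexp (ennreal a) = exp (- a)"
  by (simp add: nexp_def)

lemma nexp_nonneg[simp]: "0 \<le> nexp c" and nexp_le_1[simp]: "nexp c \<le> 1"
  by (simp_all add: nexp_def)

lemma nexp_add: "nexp (a + b) = nexp a * nexp b"
  by (cases a; cases b) (auto simp: nexp_def simp flip: ennreal_plus exp_add)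

lemma nexp_sum: "finite A \<Longrightarrow> nexp (sum f A) = (\<Prod>x\<in>A. nexp (f x))"
  by (induction A rule: finite_induct) (auto simp: nexp_add)

lemma nexp_antimono: "a \<le> b \<Longrightarrow> nexp b \<le> nexp a"
  by (cases a; cases b) (auto simp: nexp_def top_unique)

lemma measurable_nexp[measurable]: "nexp \<in> borel_measurable borel"
  unfolding nexp_def[abs_def] by measurable

lemma tendsto_nexp:
  assumes "(c \<longlongrightarrow> l) F"
  shows "((\<lambda>x. nexp (c x)) \<longlongrightarrow> nexp l) F"
proof (cases "l = \<top>")
  case False
  then have "\<forall>\<^sub>F x in F. c x < \<top>"
    using order_tendstoD(2)[OF assms, of \<top>] by (simp add: top.not_eq_extremum)
  then have "\<forall>\<^sub>F x in F. exp (- enn2real (c x)) = nexp (c x)"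
    by eventually_elim (auto simp: nexp_def)
  moreover have "((\<lambda>x. exp (- enn2real (c x))) \<longlongrightarrow> exp (- enn2real l)) F"
    using False assms by (intro tendsto_intros tendsto_enn2real) (auto simp: top.not_eq_extremum)
  ultimately show ?thesis
    using False by (simp add: nexp_def tendsto_cong)
next
  case True
  show ?thesis
  proof (rule order_tendstoI)
    fix a assume "nexp l < a"
    then have a: "0 < a" by (simp add: True)
    have "\<forall>\<^sub>F x in F. ennreal (\<bar>ln a\<bar> + 1) < c x"
      by (rule order_tendstoD(1)[OF assms]) (simp add: True)
    then show "\<forall>\<^sub>F x in F. nexp (c x) < a"
    proof eventually_elim
      case (elim x)
      then have "nexp (c x) \<le> exp (- (\<bar>ln a\<bar> + 1))"
        using nexp_antimono[OF less_imp_le] nexp_ennreal[of "\<bar>ln a\<bar> + 1"] by (metis abs_ge_zero add_nonneg_nonneg zero_le_one)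
      also have "\<dots> < exp (ln a)" by (subst exp_less_cancel_iff) auto
      finally show ?case using a by simp
    qed
  next
    fix a assume "a < nexp l"
    then have "a < nexp (c x)" for x using nexp_nonneg[of "c x"] by (simp add: True del: nexp_nonneg)
    then show "\<forall>\<^sub>F x in F. a < nexp (c x)" by simp
  qed
qed

text \<open>At each point at most one summand is nonzero, so the nonlinear map
  \<open>1 - nexp\<close> may be applied summand by summand.\<close>

lemma one_minus_nexp_disjoint_sum:
  fixes A :: "nat \<Rightarrow> 'b set" and a :: "nat \<Rightarrow> real"
  assumes dis: "disjoint_family_on A {..<n}" and a: "\<And>j. j < n \<Longrightarrow> 0 < a j"
  shows "ennreal (1 - nexp (\<Sum>j<n. ennreal (a j) * indicator (A j) p)) = (\<Sum>j<n. ennreal (1 - exp (- a j)) * indicator (A j) p)"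
proof (cases "\<exists>j<n. p \<in> A j")
  case True
  then obtain j where j: "j < n" "p \<in> A j" by auto
  have *: "indicator (A k) p = (if k = j then 1 else 0 :: ennreal)" if "k < n" for k
    using j that dis by (auto simp: disjoint_family_on_def indicator_def)
  have "(\<Sum>k<n. c k * indicator (A k) p) = c j" for c :: "nat \<Rightarrow> ennreal"
  proof -
    have "(\<Sum>k<n. c k * indicator (A k) p) = (\<Sum>k<n. if k = j then c k else 0)"
      by (rule sum.cong) (auto simp: *)
    also have "\<dots> = c j" using j by simp
    finally show ?thesis .
  qed
  then show ?thesis using a[OF j(1)] by (simp add: nexp_ennreal)
next
  case False
  then have z: "(\<Sum>k<n. c k * indicator (A k) p) = 0" for c :: "nat \<Rightarrow> ennreal"
    by (intro sum.neutral) auto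
  show ?thesis unfolding z by simp
qed

lemma nexp_of_nat_mult: "0 \<le> a \<Longrightarrow> nexp (ennreal a * of_nat k) = exp (- a) ^ k"
  by (simp add: ennreal_of_nat_eq_real_of_nat nexp_ennreal mult.commute flip: ennreal_mult' exp_of_nat_mult)

lemma (in prob_space) integrable_unit_interval:
  fixes f :: "'a \<Rightarrow> real"
  assumes "f \<in> borel_measurable M" "\<And>\<omega>. 0 \<le> f \<omega>" "\<And>\<omega>. f \<omega> \<le> 1"
  shows "integrable M f"
  by (rule integrable_const_bound[where B=1]) (use assms in auto)

lemma (in prob_space) expectation_LIMSEQ_unit_interval:
  fixes f :: "nat \<Rightarrow> 'a \<Rightarrow> real"
  assumes "\<And>n. f n \<in> borel_measurable M" "\<And>n \<omega>. 0 \<le> f n \<omega>" "\<And>n \<omega>. f n \<omega> \<le> 1"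
    and lim: "\<And>\<omega>. (\<lambda>n. f n \<omega>) \<longlonglongrightarrow> g \<omega>"
  shows "(\<lambda>n. expectation (f n)) \<longlonglongrightarrow> expectation g"
proof (rule integral_dominated_convergence[where w="\<lambda>_. 1"])
  show "g \<in> borel_measurable M"
    by (rule borel_measurable_LIMSEQ_real[OF lim assms(1)])
qed (use assms in auto)

text \<open>Evaluation at an entry of the point list; an index without a point (value
  \<open>\<infinity>\<close>) contributes 0 to every sum over points.\<close>

definition at_point :: "(real \<Rightarrow> ennreal) \<Rightarrow> ereal \<Rightarrow> ennreal" where
  "at_point f w = (if \<bar>w\<bar> = \<infinity> then 0 else f (real_of_ereal w))"

lemma at_point_simps[simp]: "at_point f (ereal x) = f x" "at_point f \<infinity> = 0" "at_point f (- \<infinity>) = 0"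
  by (simp_all add: at_point_def)

lemma measurable_at_point[measurable]:
  assumes [measurable]: "f \<in> borel_measurable borel"
  shows "at_point f \<in> borel_measurable borel"
  unfolding at_point_def[abs_def] by measurable

lemma of_bool_eq_at_point: "of_bool (w \<in> ereal ` A) = at_point (indicator A) w"
  by (cases w) (auto simp: indicator_def)

lemma (in poisson_points) measurable_point_count[measurable]:
  assumes [measurable]: "A \<in> sets borel"
  shows "point_count W A \<in> borel_measurable M"
proof -
  note [measurable] = measurable
  show ?thesis unfolding point_count_def[abs_def] of_bool_eq_at_point by measurable
qed

lemma (in poisson_points) poisson_count_law:
  assumes "A \<in> sets borel" "A \<subseteq> {0<..}" "emeasure \<nu> A < \<infinity>"
  shows "prob {\<omega> \<in> space M. point_count W A \<omega> = of_nat k} = pmf (poisson_law (measure \<nu> A)) k"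
proof (cases "measure \<nu> A = 0")
  case True
  \<comment> \<open>The count of the empty set is 0, so the Poisson axiom for that set identifies
    \<open>poisson_pmf 0\<close> as the point mass at 0.\<close>
  have "pmf (poisson_pmf 0) j = pmf (return_pmf 0) j" for j
    using poisson_count[of "{}" j]
    by (cases "j = 0") (auto simp: point_count_def prob_space)
  then show ?thesis using poisson_count[OF assms] True by (simp add: poisson_law_def)
next
  case False
  then show ?thesis using poisson_count[OF assms] by (simp add: poisson_law_def)
qed

text \<open>This is the Poisson generating function at \<open>exp (- a)\<close>. If \<open>A\<close>
  has infinite mass, the count is almost surely infinite and both sides are 0.\<close>

lemma (in poisson_points) expectation_nexp_point_count:
  assumes A: "A \<in> sets borel" "A \<subseteq> {0<..}" and a: "0 < a"
  shows "expectation (\<lambda>\<omega>. nexp (ennreal a * point_count W A \<omega>)) = nexp (ennreal (1 - exp (- a)) * emeasure \<nu> A)"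
proof (cases "emeasure \<nu> A = \<infinity>")
  case True
  have "AE \<omega> in M. point_count W A \<omega> = \<infinity>" by (rule infinite_count[OF A True])
  then have "expectation (\<lambda>\<omega>. nexp (ennreal a * point_count W A \<omega>)) = expectation (\<lambda>_. 0)"
    using A a by (intro integral_cong_AE) (auto simp: ennreal_mult_eq_top_iff)
  then show ?thesis using a True by (simp add: ennreal_mult_top)
next
  case False
  then have fin: "emeasure \<nu> A < \<infinity>" by (simp add: top.not_eq_extremum)
  note [measurable] = A(1)
  have pt: "ennreal (nexp (ennreal a * point_count W A \<omega>))
      = (\<Sum>k. ennreal (exp (- a) ^ k) * indicator {\<omega> \<in> space M. point_count W A \<omega> = of_nat k} \<omega>)"
    if "\<omega> \<in> space M" for \<omega>
  proof (rule suminf_of_bool_cases[of "\<lambda>i. W i \<omega> \<in> ereal ` A"])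
    assume "(\<Sum>i. of_bool (W i \<omega> \<in> ereal ` A)) = (\<infinity>::ennreal)"
    then have "point_count W A \<omega> = \<top>" by (simp add: point_count_def)
    then show ?thesis using a by (simp add: ennreal_mult_top)
  next
    fix n assume "(\<Sum>i. of_bool (W i \<omega> \<in> ereal ` A)) = (of_nat n::ennreal)"
    then have n: "point_count W A \<omega> = of_nat n" by (simp add: point_count_def)
    have "(\<Sum>k. ennreal (exp (- a) ^ k) * indicator {\<omega> \<in> space M. point_count W A \<omega> = of_nat k} \<omega>)
      = (\<Sum>k\<in>{n}. ennreal (exp (- a) ^ k) * indicator {\<omega> \<in> space M. point_count W A \<omega> = of_nat k} \<omega>)"
      by (rule suminf_finite) (auto simp: n indicator_def)
    then show ?thesis using that a by (simp add: n nexp_of_nat_mult)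
  qed
  have "ennreal (expectation (\<lambda>\<omega>. nexp (ennreal a * point_count W A \<omega>)))
      = (\<integral>\<^sup>+\<omega>. ennreal (nexp (ennreal a * point_count W A \<omega>)) \<partial>M)"
    by (rule nn_integral_eq_integral[symmetric]) (auto intro!: integrable_unit_interval)
  also have "\<dots> = (\<integral>\<^sup>+\<omega>. (\<Sum>k. ennreal (exp (- a) ^ k) * indicator {\<omega> \<in> space M. point_count W A \<omega> = of_nat k} \<omega>) \<partial>M)"
    by (rule nn_integral_cong) (rule pt)
  also have "\<dots> = (\<Sum>k. \<integral>\<^sup>+\<omega>. ennreal (exp (- a) ^ k) * indicator {\<omega> \<in> space M. point_count W A \<omega> = of_nat k} \<omega> \<partial>M)"
    by (rule nn_integral_suminf) measurable
  also have "\<dots> = (\<Sum>k. ennreal (pmf (poisson_law (measure \<nu> A)) k) * ennreal (exp (- a) ^ k))"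
    by (intro suminf_cong, subst nn_integral_cmult_indicator)
       (auto simp: emeasure_eq_measure poisson_count_law[OF A fin] mult.commute)
  also have "\<dots> = (\<integral>\<^sup>+k. ennreal (exp (- a) ^ k) \<partial>measure_pmf (poisson_law (measure \<nu> A)))"
    by (simp add: nn_integral_measure_pmf nn_integral_count_space_nat)
  also have "\<dots> = ennreal (exp (measure \<nu> A * (exp (- a) - 1)))"
    by (rule nn_integral_poisson_power) auto
  finally have "expectation (\<lambda>\<omega>. nexp (ennreal a * point_count W A \<omega>)) = exp (measure \<nu> A * (exp (- a) - 1))"
    by (subst (asm) ennreal_inj) (auto intro!: integral_nonneg_AE)
  also have "\<dots> = nexp (ennreal ((1 - exp (- a)) * measure \<nu> A))"
  proof -
    have "0 \<le> (1 - exp (- a)) * measure \<nu> A" using a by simp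
    from nexp_ennreal[OF this] show ?thesis by (simp add: algebra_simps)
  qed
  also have "\<dots> = nexp (ennreal (1 - exp (- a)) * emeasure \<nu> A)"
    using a fin by (subst emeasure_eq_ennreal_measure) (auto simp: ennreal_mult)
  finally show ?thesis .
qed

lemma (in poisson_points) laplace_functional_disjoint:
  fixes A :: "nat \<Rightarrow> real set" and a :: "nat \<Rightarrow> real"
  assumes \<nu>: "sets \<nu> = sets borel"
    and A: "\<And>k. k < m \<Longrightarrow> A k \<in> sets borel" "\<And>k. k < m \<Longrightarrow> A k \<subseteq> {0<..}" "disjoint_family_on A {..<m}"
    and a: "\<And>k. k < m \<Longrightarrow> 0 < a k"
    and f: "\<And>x. f x = (\<Sum>k<m. ennreal (a k) * indicator (A k) x)"
  shows "expectation (\<lambda>\<omega>. nexp (\<Sum>i. at_point f (W i \<omega>))) = nexp (\<integral>\<^sup>+x. ennreal (1 - nexp (f x)) \<partial>\<nu>)"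
proof -
  \<comment> \<open>Padding with empty sets, since \<open>independent_counts\<close> speaks of
    families indexed by all natural numbers.\<close>
  define A' where "A' k = (if k < m then A k else {})" for k
  have A': "A' k \<in> sets borel \<and> A' k \<subseteq> {0<..}" "disjoint_family A'" for k
    using A by (auto simp: A'_def disjoint_family_on_def)
  have ind: "indep_vars (\<lambda>_. borel) (\<lambda>k. point_count W (A' k)) UNIV"
    by (rule independent_counts) (use A' in auto)
  have "at_point f w = (\<Sum>k<m. ennreal (a k) * of_bool (w \<in> ereal ` A' k))" for w
    by (cases w) (auto simp: f A'_def indicator_def of_bool_def image_iff intro!: sum.cong)
  then have "(\<Sum>i. at_point f (W i \<omega>)) = (\<Sum>k<m. ennreal (a k) * point_count W (A' k) \<omega>)" for \<omega>
    by (simp only: point_count_def ennreal_suminf_cmult[symmetric]) (rule suminf_sum, auto)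
  then have "expectation (\<lambda>\<omega>. nexp (\<Sum>i. at_point f (W i \<omega>)))
      = expectation (\<lambda>\<omega>. \<Prod>k<m. nexp (ennreal (a k) * point_count W (A' k) \<omega>))"
    by (simp add: nexp_sum)
  also have "\<dots> = (\<Prod>k<m. expectation (\<lambda>\<omega>. nexp (ennreal (a k) * point_count W (A' k) \<omega>)))"
  proof (rule indep_vars_lebesgue_integral)
    show "indep_vars (\<lambda>_. borel) (\<lambda>k \<omega>. nexp (ennreal (a k) * point_count W (A' k) \<omega>)) {..<m}"
      by (rule indep_vars_compose2[OF indep_vars_subset[OF ind]]) auto
    show "integrable M (\<lambda>\<omega>. nexp (ennreal (a k) * point_count W (A' k) \<omega>))" for k
      using A'(1)[of k] by (intro integrable_unit_interval) auto
  qed simp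
  also have "\<dots> = (\<Prod>k<m. nexp (ennreal (1 - exp (- a k)) * emeasure \<nu> (A k)))"
    using A a by (intro prod.cong refl) (auto simp: expectation_nexp_point_count A'_def)
  also have "\<dots> = nexp (\<Sum>k<m. ennreal (1 - exp (- a k)) * emeasure \<nu> (A k))"
    by (simp add: nexp_sum)
  also have "(\<Sum>k<m. ennreal (1 - exp (- a k)) * emeasure \<nu> (A k))
      = (\<integral>\<^sup>+x. (\<Sum>k<m. ennreal (1 - exp (- a k)) * indicator (A k) x) \<partial>\<nu>)"
    using A \<nu> by (subst nn_integral_sum) (auto intro!: sum.cong simp: nn_integral_cmult_indicator)
  also have "\<dots> = (\<integral>\<^sup>+x. ennreal (1 - nexp (f x)) \<partial>\<nu>)"
    unfolding f using a by (intro nn_integral_cong one_minus_nexp_disjoint_sum[symmetric] A(3)) simp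
  finally show ?thesis .
qed

text \<open>For a simple function the functional factors over the level sets, whose counts are
  independent. Increasing approximation gives the general case, by dominated convergence on the left
  and monotone convergence on the right. The condition \<open>f0\<close> places the level sets of
  nonzero values inside \<open>{0<..}\<close>, where the counts are described.\<close>

lemma (in poisson_points) laplace_functional:
  fixes f :: "real \<Rightarrow> ennreal"
  assumes \<nu>: "sets \<nu> = sets borel" and fm[measurable]: "f \<in> borel_measurable borel" and f0: "\<And>x. x \<le> 0 \<Longrightarrow> f x = 0"
  shows "expectation (\<lambda>\<omega>. nexp (\<Sum>i. at_point f (W i \<omega>))) = nexp (\<integral>\<^sup>+x. ennreal (1 - nexp (f x)) \<partial>\<nu>)"
proof -
  note [measurable] = measurable
  note [measurable_cong] = \<nu>
  obtain F where F: "\<And>n. simple_function borel (F n)" "incseq F" "\<And>n x. F n x < \<top>" "\<And>x. (SUP n. F n x) = f x"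
    using borel_measurable_implies_simple_function_sequence'[OF fm] by blast
  have Fm[measurable]: "F n \<in> borel_measurable borel" for n
    using F(1) by (rule borel_measurable_simple_function)
  have Fle: "F n x \<le> f x" for n x unfolding F(4)[symmetric] by (rule SUP_upper) simp
  have simple: "expectation (\<lambda>\<omega>. nexp (\<Sum>i. at_point (F n) (W i \<omega>))) = nexp (\<integral>\<^sup>+x. ennreal (1 - nexp (F n x)) \<partial>\<nu>)" for n
  proof -
    have fin: "finite (range (F n) - {0})" using F(1)[of n] by (simp add: simple_function_def)
    obtain v where v: "bij_betw v {..<card (range (F n) - {0})} (range (F n) - {0})"
      using ex_bij_betw_nat_finite[OF fin] atLeast0LessThan by metis
    let ?m = "card (range (F n) - {0})"
    have vin: "v k \<in> range (F n) - {0}" if "k < ?m" for k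
      using v that by (auto simp: bij_betw_def)
    show ?thesis
    proof (rule laplace_functional_disjoint[OF \<nu>, where m = ?m and a = "\<lambda>k. enn2real (v k)" and A = "\<lambda>k. F n -` {v k}"])
      fix k assume k: "k < ?m"
      show "F n -` {v k} \<in> sets borel" using measurable_sets[OF Fm, of "{v k}" n] by simp
      show "F n -` {v k} \<subseteq> {0<..}"
      proof
        fix x assume "x \<in> F n -` {v k}"
        then have "F n x \<noteq> 0" using vin[OF k] by auto
        then have "f x \<noteq> 0" using Fle[of n x] by auto
        then show "x \<in> {0<..}" using f0[of x] by (cases "x \<le> 0") auto
      qed
      have "v k \<noteq> 0" "v k < \<top>" using vin[OF k] F(3) by auto
      then show "0 < enn2real (v k)" by (simp add: enn2real_positive_iff zero_less_iff_neq_zero)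
    next
      show "disjoint_family_on (\<lambda>k. F n -` {v k}) {..<?m}"
        using v by (auto simp: disjoint_family_on_def bij_betw_def inj_on_def)
      fix x
      have "(\<Sum>k<?m. ennreal (enn2real (v k)) * indicator (F n -` {v k}) x)
        = (\<Sum>y\<in>range (F n) - {0}. ennreal (enn2real y) * indicator (F n -` {y}) x)"
        by (rule sum.reindex_bij_betw[OF v, of "\<lambda>y. ennreal (enn2real y) * indicator (F n -` {y}) x"])
      also have "\<dots> = (\<Sum>y\<in>range (F n) - {0}. if y = F n x then y else 0)"
        using F(3) by (intro sum.cong) (auto simp: indicator_def less_top[symmetric])
      also have "\<dots> = F n x" using fin by (auto simp: sum.delta)
      finally show "F n x = (\<Sum>k<?m. ennreal (enn2real (v k)) * indicator (F n -` {v k}) x)" by simp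
    qed
  qed
  have inc: "at_point (F n) w \<le> at_point (F (Suc n)) w" for n w
    using F(2) by (cases w) (auto simp: incseq_Suc_iff le_fun_def)
  have "(SUP n. at_point (F n) w) = at_point f w" for w
    by (cases w) (auto simp: F(4))
  then have "(\<Sum>i. at_point f (W i \<omega>)) = (SUP n. \<Sum>i. at_point (F n) (W i \<omega>))" for \<omega>
    using ennreal_suminf_SUP_eq[of "\<lambda>n i. at_point (F n) (W i \<omega>)"] inc by (simp add: incseq_Suc_iff)
  moreover have "(\<lambda>n. \<Sum>i. at_point (F n) (W i \<omega>)) \<longlonglongrightarrow> (SUP n. \<Sum>i. at_point (F n) (W i \<omega>))" for \<omega>
    by (intro LIMSEQ_SUP incseq_SucI suminf_le inc) auto
  ultimately have lim: "(\<lambda>n. \<Sum>i. at_point (F n) (W i \<omega>)) \<longlonglongrightarrow> (\<Sum>i. at_point f (W i \<omega>))" for \<omega>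
    by simp
  have "(\<lambda>n. expectation (\<lambda>\<omega>. nexp (\<Sum>i. at_point (F n) (W i \<omega>)))) \<longlonglongrightarrow> expectation (\<lambda>\<omega>. nexp (\<Sum>i. at_point f (W i \<omega>)))"
    by (rule expectation_LIMSEQ_unit_interval) (auto intro!: tendsto_nexp lim)
  moreover have "(\<lambda>n. nexp (\<integral>\<^sup>+x. ennreal (1 - nexp (F n x)) \<partial>\<nu>)) \<longlonglongrightarrow> nexp (\<integral>\<^sup>+x. ennreal (1 - nexp (f x)) \<partial>\<nu>)"
  proof (intro tendsto_nexp nn_integral_LIMSEQ)
    show "incseq (\<lambda>n x. ennreal (1 - nexp (F n x)))"
      using F(2) by (auto simp: incseq_Suc_iff le_fun_def intro!: ennreal_leI nexp_antimono)
    fix x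
    have "(\<lambda>n. F n x) \<longlonglongrightarrow> f x"
      unfolding F(4)[symmetric] using F(2) by (intro LIMSEQ_SUP) (auto simp: incseq_def le_fun_def)
    then show "(\<lambda>n. ennreal (1 - nexp (F n x))) \<longlonglongrightarrow> ennreal (1 - nexp (f x))"
      by (intro tendsto_intros tendsto_ennrealI tendsto_nexp)
  qed measurable
  ultimately show ?thesis unfolding simple by (rule LIMSEQ_unique)
qed

section \<open>Marked Poisson points\<close>

definition nln :: "real \<Rightarrow> ennreal" where
  "nln q = (if q \<le> 0 then \<top> else ennreal (- ln q))"

lemma nexp_nln: "0 \<le> q \<Longrightarrow> q \<le> 1 \<Longrightarrow> nexp (nln q) = q"
  by (auto simp: nln_def nexp_ennreal)

lemma measurable_nln[measurable]: "nln \<in> borel_measurable borel"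
  unfolding nln_def[abs_def] by measurable

lemma (in prob_space) distr_pair_of_indep_set:
  assumes X[measurable]: "X \<in> measurable M A" and Y[measurable]: "Y \<in> measurable M B"
    and ind: "indep_set (sets (vimage_algebra (space M) X A)) (sets (vimage_algebra (space M) Y B))"
  shows "distr M (A \<Otimes>\<^sub>M B) (\<lambda>\<omega>. (X \<omega>, Y \<omega>)) = distr M A X \<Otimes>\<^sub>M distr M B Y"
proof (rule pair_measure_eqI[symmetric])
  interpret X: prob_space "distr M A X" by (rule prob_space_distr) fact
  interpret Y: prob_space "distr M B Y" by (rule prob_space_distr) fact
  show "sigma_finite_measure (distr M A X)" "sigma_finite_measure (distr M B Y)" by unfold_locales
  show "sets (distr M A X \<Otimes>\<^sub>M distr M B Y) = sets (distr M (A \<Otimes>\<^sub>M B) (\<lambda>\<omega>. (X \<omega>, Y \<omega>)))"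
    by (simp cong: sets_pair_measure_cong)
  fix a b assume "a \<in> sets (distr M A X)" "b \<in> sets (distr M B Y)"
  then have ab[measurable]: "a \<in> sets A" "b \<in> sets B" by auto
  have "prob ((X -` a \<inter> space M) \<inter> (Y -` b \<inter> space M)) = prob (X -` a \<inter> space M) * prob (Y -` b \<inter> space M)"
    by (rule indep_setD[OF ind]) (auto intro: in_vimage_algebra ab)
  moreover have "(X -` a \<inter> space M) \<inter> (Y -` b \<inter> space M) = (\<lambda>\<omega>. (X \<omega>, Y \<omega>)) -` (a \<times> b) \<inter> space M" by auto
  ultimately show "emeasure (distr M A X) a * emeasure (distr M B Y) b = emeasure (distr M (A \<Otimes>\<^sub>M B) (\<lambda>\<omega>. (X \<omega>, Y \<omega>))) (a \<times> b)"
    by (simp add: emeasure_distr emeasure_eq_measure ennreal_mult')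
qed

text \<open>In the application the mark of a particle is its whole Brownian path. Indices without a
  point carry a mark as well, so that the marks are independent of the points including their
  number.\<close>

locale marked_poisson_points = poisson_points M \<nu> W
  for M :: "'a measure" and \<nu> :: "real measure" and W :: "nat \<Rightarrow> 'a \<Rightarrow> ereal" +
  fixes S :: "'s measure" and X :: "nat \<Rightarrow> 'a \<Rightarrow> 's" and Q :: "'s measure"
  assumes sets_intensity: "sets \<nu> = sets borel"
    and marks_indep: "indep_vars (\<lambda>_. S) X UNIV"
    and marks_distr: "\<And>i. distr M S (X i) = Q"
    and points_marks_indep:
      "indep_set (sets (vimage_algebra (space M) (\<lambda>\<omega> i. W i \<omega>) (PiM UNIV (\<lambda>_. borel))))
         (sets (vimage_algebra (space M) (\<lambda>\<omega> i. X i \<omega>) (PiM UNIV (\<lambda>_. S))))"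
begin

lemma measurable_mark[measurable]: "X i \<in> measurable M S"
  using marks_indep by (auto simp: indep_vars_def)

lemma sets_marks[measurable_cong]: "sets Q = sets S"
  using marks_distr[of 0] by (metis sets_distr)

lemma prob_space_marks: "prob_space Q"
  using prob_space_distr[OF measurable_mark, of 0] by (simp add: marks_distr)

lemma measurable_at_point_pair:
  fixes f :: "real \<times> 's \<Rightarrow> ennreal"
  assumes f[measurable]: "f \<in> borel_measurable (borel \<Otimes>\<^sub>M S)"
  shows "(\<lambda>p. at_point (\<lambda>x. f (x, snd p)) (fst p)) \<in> borel_measurable (borel \<Otimes>\<^sub>M S)"
  unfolding at_point_def by measurable

lemma measurable_at_point_mark:
  fixes f :: "real \<times> 's \<Rightarrow> ennreal"
  assumes f: "f \<in> borel_measurable (borel \<Otimes>\<^sub>M S)"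
  shows "(\<lambda>\<omega>. at_point (\<lambda>x. f (x, X i \<omega>)) (W i \<omega>)) \<in> borel_measurable M"
proof -
  note [measurable] = measurable
  have "(\<lambda>\<omega>. (W i \<omega>, X i \<omega>)) \<in> measurable M (borel \<Otimes>\<^sub>M S)" by measurable
  from measurable_compose[OF this measurable_at_point_pair[OF f]] show ?thesis by simp
qed

text \<open>The function \<open>F\<close> of the position for which \<open>exp (- F x)\<close> is
  the average of \<open>exp (- f (x, b))\<close> over the mark \<open>b\<close>. Replacing
  \<open>f\<close> by \<open>F\<close> removes the marks from a Laplace functional.\<close>

definition mark_log_laplace :: "(real \<times> 's \<Rightarrow> ennreal) \<Rightarrow> real \<Rightarrow> ennreal" where
  "mark_log_laplace f x = nln (\<integral>b. nexp (f (x, b)) \<partial>Q)"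

lemma measurable_mark_log_laplace:
  fixes f :: "real \<times> 's \<Rightarrow> ennreal"
  assumes f: "f \<in> borel_measurable (borel \<Otimes>\<^sub>M S)"
  shows "mark_log_laplace f \<in> borel_measurable borel"
proof -
  interpret Q: prob_space Q by (rule prob_space_marks)
  have [measurable]: "f \<in> borel_measurable (borel \<Otimes>\<^sub>M Q)"
    using f by (simp cong: measurable_cong_sets add: sets_marks)
  show ?thesis unfolding mark_log_laplace_def[abs_def] by measurable
qed

lemma nexp_mark_log_laplace:
  fixes f :: "real \<times> 's \<Rightarrow> ennreal"
  assumes f[measurable]: "f \<in> borel_measurable (borel \<Otimes>\<^sub>M S)"
  shows "integrable Q (\<lambda>b. nexp (f (x, b)))" "nexp (mark_log_laplace f x) = (\<integral>b. nexp (f (x, b)) \<partial>Q)"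
proof -
  interpret Q: prob_space Q by (rule prob_space_marks)
  have "(\<lambda>b. nexp (f (x, b))) \<in> borel_measurable Q" by measurable
  then show int: "integrable Q (\<lambda>b. nexp (f (x, b)))"
    by (intro Q.integrable_unit_interval) auto
  have "(\<integral>b. nexp (f (x, b)) \<partial>Q) \<le> (\<integral>b. 1 \<partial>Q)"
    by (rule integral_mono[OF int]) auto
  then show "nexp (mark_log_laplace f x) = (\<integral>b. nexp (f (x, b)) \<partial>Q)"
    unfolding mark_log_laplace_def by (intro nexp_nln) (auto simp: Q.prob_space)
qed

text \<open>The joint law of points and marks is a product, so by Fubini the points can be frozen.
  The independent marks then contribute one factor each, and this factor is \<open>nexp\<close> of
  \<open>mark_log_laplace f\<close> at the point. Partial sums keep the product finite.\<close>

lemma expectation_partial_sum: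
  fixes f :: "real \<times> 's \<Rightarrow> ennreal"
  assumes f[measurable]: "f \<in> borel_measurable (borel \<Otimes>\<^sub>M S)"
  shows "expectation (\<lambda>\<omega>. nexp (\<Sum>i<n. at_point (\<lambda>x. f (x, X i \<omega>)) (W i \<omega>)))
    = expectation (\<lambda>\<omega>. nexp (\<Sum>i<n. at_point (mark_log_laplace f) (W i \<omega>)))"
proof -
  interpret Q: prob_space Q by (rule prob_space_marks)
  note [measurable] = measurable
  let ?PW = "PiM UNIV (\<lambda>_::nat. borel :: ereal measure)" and ?PX = "PiM UNIV (\<lambda>_::nat. S)"
  let ?W = "\<lambda>\<omega> i. W i \<omega>" and ?X = "\<lambda>\<omega> i. X i \<omega>"
  let ?h = "\<lambda>w b. at_point (\<lambda>x. f (x, b)) w"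
  let ?F = "mark_log_laplace f"
  note Fm[measurable] = measurable_mark_log_laplace[OF f]
  have hm[measurable]: "(\<lambda>p. ?h (fst p) (snd p)) \<in> borel_measurable (borel \<Otimes>\<^sub>M S)"
    by (rule measurable_at_point_pair[OF f])
  have Wm[measurable]: "?W \<in> measurable M ?PW" by (rule measurable_PiM_single') auto
  have Xm[measurable]: "?X \<in> measurable M ?PX" by (rule measurable_PiM_single') (auto intro: measurable_space[OF measurable_mark])
  have h1[measurable]: "(\<lambda>b. ?h w b) \<in> borel_measurable S" for w
  proof -
    have "(\<lambda>b. (w, b)) \<in> measurable S (borel \<Otimes>\<^sub>M S)" by measurable
    from measurable_compose[OF this hm] show ?thesis by simp
  qed
  have Fh: "(\<integral>\<^sup>+\<omega>. ennreal (nexp (?h w (X i \<omega>))) \<partial>M) = ennreal (nexp (at_point ?F w))" for w i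
  proof -
    have "(\<integral>\<^sup>+\<omega>. ennreal (nexp (?h w (X i \<omega>))) \<partial>M) = (\<integral>\<^sup>+b. ennreal (nexp (?h w b)) \<partial>distr M S (X i))"
      by (rule nn_integral_distr[symmetric]) measurable
    also have "\<dots> = (\<integral>\<^sup>+b. ennreal (nexp (?h w b)) \<partial>Q)" by (simp only: marks_distr)
    also have "\<dots> = ennreal (nexp (at_point ?F w))"
    proof (cases w)
      case (real x)
      then show ?thesis using nexp_mark_log_laplace[OF f, of x] by (simp add: nn_integral_eq_integral)
    qed (simp_all add: Q.emeasure_space_1)
    finally show ?thesis .
  qed
  let ?G = "\<lambda>p. \<Prod>i<n. ennreal (nexp (?h (fst p i) (snd p i)))"
  have hi: "(\<lambda>p. ?h (fst p i) (snd p i)) \<in> borel_measurable (?PW \<Otimes>\<^sub>M ?PX)" for i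
  proof -
    have "(\<lambda>p. (fst p i, snd p i)) \<in> measurable (?PW \<Otimes>\<^sub>M ?PX) (borel \<Otimes>\<^sub>M S)" by measurable
    from measurable_compose[OF this hm] show ?thesis by simp
  qed
  have Gm: "?G \<in> borel_measurable (?PW \<Otimes>\<^sub>M ?PX)"
    by (intro borel_measurable_prod_ennreal measurable_compose[OF measurable_compose[OF hi measurable_nexp] measurable_ennreal])
  have joint: "distr M (?PW \<Otimes>\<^sub>M ?PX) (\<lambda>\<omega>. (?W \<omega>, ?X \<omega>)) = distr M ?PW ?W \<Otimes>\<^sub>M distr M ?PX ?X"
    by (rule distr_pair_of_indep_set[OF Wm Xm points_marks_indep])
  interpret DX: prob_space "distr M ?PX ?X" by (rule prob_space_distr) measurable
  have inner: "(\<integral>\<^sup>+x. ?G (w, x) \<partial>distr M ?PX ?X) = (\<Prod>i<n. ennreal (nexp (at_point ?F (w i))))" for w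
  proof -
    have gm: "(\<lambda>x. ?G (w, x)) \<in> borel_measurable ?PX"
    proof -
      have "(\<lambda>x. (w, x)) \<in> measurable ?PX (?PW \<Otimes>\<^sub>M ?PX)"
        by (rule measurable_Pair1') (simp add: space_PiM)
      from measurable_compose[OF this Gm] show ?thesis .
    qed
    have "(\<integral>\<^sup>+x. ?G (w, x) \<partial>distr M ?PX ?X) = (\<integral>\<^sup>+\<omega>. ?G (w, ?X \<omega>) \<partial>M)"
      using gm by (intro nn_integral_distr[OF Xm]) simp
    also have "\<dots> = (\<integral>\<^sup>+\<omega>. (\<Prod>i<n. ennreal (nexp (?h (w i) (X i \<omega>)))) \<partial>M)" by simp
    also have "\<dots> = (\<Prod>i<n. \<integral>\<^sup>+\<omega>. ennreal (nexp (?h (w i) (X i \<omega>))) \<partial>M)"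
    proof (rule indep_vars_nn_integral)
      show "indep_vars (\<lambda>_. borel) (\<lambda>i \<omega>. ennreal (nexp (?h (w i) (X i \<omega>)))) {..<n}"
        by (rule indep_vars_compose2[OF indep_vars_subset[OF marks_indep]]) auto
    qed auto
    finally show ?thesis by (simp add: Fh)
  qed
  have "(\<integral>\<^sup>+\<omega>. ?G (?W \<omega>, ?X \<omega>) \<partial>M) = (\<integral>\<^sup>+p. ?G p \<partial>distr M (?PW \<Otimes>\<^sub>M ?PX) (\<lambda>\<omega>. (?W \<omega>, ?X \<omega>)))"
  proof (rule nn_integral_distr[symmetric])
    show "?G \<in> borel_measurable (distr M (?PW \<Otimes>\<^sub>M ?PX) (\<lambda>\<omega>. (?W \<omega>, ?X \<omega>)))"
      using Gm by (simp only: measurable_distr_eq1)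
  qed measurable
  also have "\<dots> = (\<integral>\<^sup>+w. \<integral>\<^sup>+x. ?G (w, x) \<partial>distr M ?PX ?X \<partial>distr M ?PW ?W)"
    unfolding joint by (rule DX.nn_integral_fst[symmetric]) (use Gm in \<open>simp cong: measurable_cong_sets\<close>)
  also have "\<dots> = (\<integral>\<^sup>+w. (\<Prod>i<n. ennreal (nexp (at_point ?F (w i)))) \<partial>distr M ?PW ?W)"
    by (simp only: inner)
  also have "\<dots> = (\<integral>\<^sup>+\<omega>. (\<Prod>i<n. ennreal (nexp (at_point ?F (W i \<omega>)))) \<partial>M)"
    by (rule nn_integral_distr[OF Wm]) measurable
  finally have eq: "(\<integral>\<^sup>+\<omega>. ennreal (nexp (\<Sum>i<n. ?h (W i \<omega>) (X i \<omega>))) \<partial>M)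
      = (\<integral>\<^sup>+\<omega>. ennreal (nexp (\<Sum>i<n. at_point ?F (W i \<omega>))) \<partial>M)"
    by (simp add: nexp_sum prod_ennreal)
  note [measurable] = measurable_at_point_mark[OF f]
  show ?thesis
    using eq by (simp add: integral_eq_nn_integral)
qed

text \<open>The right-hand side is the Laplace functional of a Poisson process with the product
  intensity of \<open>\<nu>\<close> and \<open>Q\<close>, so this is the marking theorem. It follows
  from the unmarked functional at \<open>F = mark_log_laplace f\<close>, because
  \<open>1 - nexp (F x)\<close> is the average of \<open>1 - nexp (f (x, b))\<close> over the
  mark.\<close>

lemma laplace_marked:
  fixes f :: "real \<times> 's \<Rightarrow> ennreal"
  assumes f[measurable]: "f \<in> borel_measurable (borel \<Otimes>\<^sub>M S)" and f0: "\<And>x b. x \<le> 0 \<Longrightarrow> f (x, b) = 0"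
  shows "expectation (\<lambda>\<omega>. nexp (\<Sum>i. at_point (\<lambda>x. f (x, X i \<omega>)) (W i \<omega>)))
    = nexp (\<integral>\<^sup>+x. \<integral>\<^sup>+b. ennreal (1 - nexp (f (x, b))) \<partial>Q \<partial>\<nu>)"
proof -
  interpret Q: prob_space Q by (rule prob_space_marks)
  note [measurable] = measurable
  let ?F = "mark_log_laplace f"
  note Fm[measurable] = measurable_mark_log_laplace[OF f]
  note [measurable] = measurable_at_point_mark[OF f]
  have "(\<lambda>n. expectation (\<lambda>\<omega>. nexp (\<Sum>i<n. at_point (\<lambda>x. f (x, X i \<omega>)) (W i \<omega>))))
      \<longlonglongrightarrow> expectation (\<lambda>\<omega>. nexp (\<Sum>i. at_point (\<lambda>x. f (x, X i \<omega>)) (W i \<omega>)))"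
    by (rule expectation_LIMSEQ_unit_interval) (auto intro!: tendsto_nexp summable_LIMSEQ)
  moreover have "(\<lambda>n. expectation (\<lambda>\<omega>. nexp (\<Sum>i<n. at_point ?F (W i \<omega>))))
      \<longlonglongrightarrow> expectation (\<lambda>\<omega>. nexp (\<Sum>i. at_point ?F (W i \<omega>)))"
    by (rule expectation_LIMSEQ_unit_interval) (auto intro!: tendsto_nexp summable_LIMSEQ)
  ultimately have "expectation (\<lambda>\<omega>. nexp (\<Sum>i. at_point (\<lambda>x. f (x, X i \<omega>)) (W i \<omega>)))
      = expectation (\<lambda>\<omega>. nexp (\<Sum>i. at_point ?F (W i \<omega>)))"
    unfolding expectation_partial_sum[OF f] by (rule LIMSEQ_unique)
  also have "\<dots> = nexp (\<integral>\<^sup>+x. ennreal (1 - nexp (?F x)) \<partial>\<nu>)"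
  proof (rule laplace_functional[OF sets_intensity Fm])
    fix x :: real assume "x \<le> 0"
    then show "?F x = 0" by (simp add: mark_log_laplace_def f0 Q.prob_space nln_def)
  qed
  also have "(\<integral>\<^sup>+x. ennreal (1 - nexp (?F x)) \<partial>\<nu>) = (\<integral>\<^sup>+x. \<integral>\<^sup>+b. ennreal (1 - nexp (f (x, b))) \<partial>Q \<partial>\<nu>)"
  proof (rule nn_integral_cong)
    fix x
    have "1 - nexp (?F x) = (\<integral>b. 1 - nexp (f (x, b)) \<partial>Q)"
      using nexp_mark_log_laplace[OF f, of x] by (simp add: Q.prob_space)
    then show "ennreal (1 - nexp (?F x)) = (\<integral>\<^sup>+b. ennreal (1 - nexp (f (x, b))) \<partial>Q)"
      using nexp_mark_log_laplace(1)[OF f, of x] by (subst nn_integral_eq_integral) auto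
  qed
  finally show ?thesis .
qed

end

section \<open>Joint law of the counts\<close>

text \<open>Strong induction: once the earlier coefficients vanish, the series divided by
  \<open>z ^ k\<close> still vanishes on \<open>(0, 1)\<close>, and its limit as \<open>z\<close>
  decreases to 0 is \<open>d k\<close>.\<close>

lemma powser_coeffs_zero:
  fixes d :: "nat \<Rightarrow> real"
  assumes "\<And>z. 0 < z \<Longrightarrow> z < 1 \<Longrightarrow> (\<lambda>n. d n * z ^ n) sums 0"
  shows "d k = 0"
proof (induction k rule: less_induct)
  case (less k)
  have s: "(\<lambda>n. d (n + k) * z ^ n) sums 0" if z: "0 < z" "z < 1" for z
  proof -
    have "(\<lambda>n. d (n + k) * z ^ (n + k)) sums (0 - (\<Sum>i<k. d i * z ^ i))"
      by (rule sums_split_initial_segment[OF assms[OF z]])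
    then have "(\<lambda>n. inverse (z ^ k) * (d (n + k) * z ^ (n + k))) sums (inverse (z ^ k) * (0 - (\<Sum>i<k. d i * z ^ i)))"
      by (rule sums_mult)
    then show ?thesis using z less by (simp add: power_add field_simps)
  qed
  define f where "f x = (\<Sum>n. d (n + k) * x ^ n)" for x
  have "(f \<longlongrightarrow> d (0 + k)) (at 0)"
  proof (rule powser_limit_0)
    fix x :: real assume x: "norm x < 1 / 2"
    have "summable (\<lambda>n. d (n + k) * (1 / 2) ^ n)" using s[of "1/2"] by (auto simp: sums_iff)
    then have "summable (\<lambda>n. d (n + k) * x ^ n)" by (rule powser_inside) (use x in simp)
    then show "(\<lambda>n. d (n + k) * x ^ n) sums f x" unfolding f_def by (rule summable_sums)
  qed simp
  then have "(f \<longlongrightarrow> d k) (at_right 0)" by (simp add: filterlim_at_split)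
  moreover have "\<forall>\<^sub>F x in at_right 0. f x = 0"
    unfolding eventually_at_right_field f_def using s by (intro exI[of _ 1]) (auto simp: sums_iff)
  then have "(f \<longlongrightarrow> 0) (at_right 0)" by (rule tendsto_eventually)
  ultimately show ?case by (rule tendsto_unique[OF trivial_limit_at_right_real])
qed

text \<open>With \<open>z = exp (- a)\<close> the hypothesis \<open>L\<close> equates two power
  series on \<open>(0, 1)\<close>: the coefficients of one are the \<open>G\<close>-weighted
  probabilities of \<open>D = k\<close>, those of the other are \<open>g\<close> times the Poisson
  weights. The weight \<open>G\<close> carries the other coordinates of a joint law through the
  argument.\<close>

lemma (in prob_space) weighted_count_law:
  fixes D :: "'a \<Rightarrow> ennreal" and G :: "'a \<Rightarrow> real"
  assumes D[measurable]: "D \<in> borel_measurable M" and Dv: "\<And>\<omega>. D \<omega> = \<infinity> \<or> (\<exists>n::nat. D \<omega> = of_nat n)"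
    and G[measurable]: "G \<in> borel_measurable M" and G01: "\<And>\<omega>. 0 \<le> G \<omega>" "\<And>\<omega>. G \<omega> \<le> 1"
    and r: "0 \<le> r"
    and L: "\<And>a. 0 < a \<Longrightarrow> expectation (\<lambda>\<omega>. G \<omega> * nexp (ennreal a * D \<omega>)) = g * exp (- ((1 - exp (- a)) * r))"
  shows "expectation (\<lambda>\<omega>. G \<omega> * indicator (of_nat ` U) (D \<omega>)) = g * measure (measure_pmf (poisson_law r)) U"
proof -
  have int: "integrable M (\<lambda>\<omega>. G \<omega> * h \<omega>)" if "h \<in> borel_measurable M" "\<And>\<omega>. 0 \<le> h \<omega>" "\<And>\<omega>. h \<omega> \<le> 1" for h
    using that G01 by (intro integrable_unit_interval) (auto intro: mult_le_one)
  have cs[measurable]: "of_nat ` U \<in> sets (borel :: ennreal measure)" for U :: "nat set"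
    by (rule sets.countable) auto
  define c where "c k = expectation (\<lambda>\<omega>. G \<omega> * indicator {of_nat k} (D \<omega>))" for k :: nat
  have ck: "integrable M (\<lambda>\<omega>. G \<omega> * indicator {of_nat k} (D \<omega>))" for k :: nat
    by (intro int) (auto simp: indicator_def)
  \<comment> \<open>Only finite values of \<open>D\<close> enter; the value
    \<open>\<infinity>\<close> contributes 0, in agreement with
    \<open>nexp \<top> = 0\<close>.\<close>
  have sum_c: "(\<lambda>k. c k * w k) sums expectation (\<lambda>\<omega>. G \<omega> * (if D \<omega> = \<infinity> then 0 else w (nat \<lfloor>enn2real (D \<omega>)\<rfloor>)))"
    if w: "\<And>k. 0 \<le> w k" "\<And>k. w k \<le> 1" for w :: "nat \<Rightarrow> real"
  proof -
    let ?w = "\<lambda>d. if d = \<infinity> then 0 else w (nat \<lfloor>enn2real d\<rfloor>)"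
    have part: "(\<Sum>k<n. G \<omega> * indicator {of_nat k} (D \<omega>) * w k)
      = (if \<exists>k<n. D \<omega> = of_nat k then G \<omega> * ?w (D \<omega>) else 0)" for n \<omega>
    proof (cases "\<exists>k<n. D \<omega> = of_nat k")
      case True
      then obtain k where k: "k < n" "D \<omega> = of_nat k" by auto
      have "(\<Sum>j<n. G \<omega> * indicator {of_nat j} (D \<omega>) * w j) = (\<Sum>j<n. if j = k then G \<omega> * w k else 0)"
        by (rule sum.cong) (auto simp: k)
      then show ?thesis using k by auto
    qed (auto intro!: sum.neutral simp: indicator_def)
    have "(\<lambda>n. expectation (\<lambda>\<omega>. \<Sum>k<n. G \<omega> * indicator {of_nat k} (D \<omega>) * w k))
        \<longlonglongrightarrow> expectation (\<lambda>\<omega>. G \<omega> * ?w (D \<omega>))"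
    proof (rule expectation_LIMSEQ_unit_interval)
      fix n \<omega>
      show "0 \<le> (\<Sum>k<n. G \<omega> * indicator {of_nat k} (D \<omega>) * w k)" "(\<Sum>k<n. G \<omega> * indicator {of_nat k} (D \<omega>) * w k) \<le> 1"
        unfolding part using G01 w by (auto intro: mult_le_one)
    next
      fix \<omega>
      show "(\<lambda>n. \<Sum>k<n. G \<omega> * indicator {of_nat k} (D \<omega>) * w k) \<longlonglongrightarrow> G \<omega> * ?w (D \<omega>)"
      proof (cases "D \<omega> = \<infinity>")
        case True
        then have "(\<Sum>k<n. G \<omega> * indicator {of_nat k} (D \<omega>) * w k) = G \<omega> * ?w (D \<omega>)" for n
          unfolding part by simp
        then show ?thesis by simp
      next
        case False
        then obtain m where m: "D \<omega> = of_nat m" using Dv by auto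
        have "\<forall>\<^sub>F n in sequentially. (\<Sum>k<n. G \<omega> * indicator {of_nat k} (D \<omega>) * w k) = G \<omega> * ?w (D \<omega>)"
          using eventually_gt_at_top[of m]
        proof eventually_elim
          case (elim n)
          then show ?case unfolding part using m by auto
        qed
        then show ?thesis by (rule tendsto_eventually)
      qed
    qed measurable
    moreover have "expectation (\<lambda>\<omega>. \<Sum>k<n. G \<omega> * indicator {of_nat k} (D \<omega>) * w k) = (\<Sum>k<n. c k * w k)" for n
      using ck by (simp add: c_def)
    ultimately show ?thesis by (simp add: sums_def)
  qed
  have pgf: "(\<lambda>k. pmf (poisson_law r) k * z ^ k) sums exp (r * (z - 1))" for z
  proof -
    have "(\<lambda>k. exp (- r) * ((r * z) ^ k /\<^sub>R fact k)) sums (exp (- r) * exp (r * z))"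
      by (intro sums_mult exp_converges)
    then show ?thesis using r
      by (simp add: pmf_poisson_law power_mult_distrib field_simps flip: exp_add)
  qed
  have "c k - g * pmf (poisson_law r) k = 0" for k
  proof (rule powser_coeffs_zero)
    fix z :: real assume z: "0 < z" "z < 1"
    define a where "a = - ln z"
    have a: "0 < a" "exp (- a) = z" using z by (auto simp: a_def)
    have pt: "(if d = \<infinity> then 0 else z ^ nat \<lfloor>enn2real d\<rfloor>) = nexp (ennreal a * d)"
      if "d = \<infinity> \<or> (\<exists>n::nat. d = of_nat n)" for d
      using that a by (auto simp: nexp_of_nat_mult ennreal_mult_top)
    have "(\<lambda>k. c k * z ^ k) sums expectation (\<lambda>\<omega>. G \<omega> * nexp (ennreal a * D \<omega>))"
      using sum_c[of "\<lambda>k. z ^ k"] z by (simp add: pt[OF Dv] power_le_one del: infinity_ennreal_def)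
    also have "expectation (\<lambda>\<omega>. G \<omega> * nexp (ennreal a * D \<omega>)) = g * exp (r * (z - 1))"
      using L[OF a(1)] by (simp add: a(2) algebra_simps)
    finally have "(\<lambda>k. c k * z ^ k - g * (pmf (poisson_law r) k * z ^ k)) sums (g * exp (r * (z - 1)) - g * exp (r * (z - 1)))"
      by (intro sums_diff sums_mult pgf)
    then show "(\<lambda>k. (c k - g * pmf (poisson_law r) k) * z ^ k) sums 0"
      by (simp add: algebra_simps)
  qed
  then have c: "c k = g * pmf (poisson_law r) k" for k by simp
  have "(\<lambda>k. c k * indicator U k) sums expectation (\<lambda>\<omega>. G \<omega> * (if D \<omega> = \<infinity> then 0 else indicator U (nat \<lfloor>enn2real (D \<omega>)\<rfloor>)))"
    using sum_c[of "indicator U"] by (simp add: indicator_def)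
  moreover have "(if d = \<infinity> then 0 else indicator U (nat \<lfloor>enn2real d\<rfloor>)) = (indicator (of_nat ` U) d :: real)"
    if "d = \<infinity> \<or> (\<exists>n::nat. d = of_nat n)" for d
    using that by (auto simp: indicator_def)
  ultimately have "(\<lambda>k. c k * indicator U k) sums expectation (\<lambda>\<omega>. G \<omega> * indicator (of_nat ` U) (D \<omega>))"
    using Dv by simp
  moreover have "(\<lambda>k. c k * indicator U k) sums (g * measure (measure_pmf (poisson_law r)) U)"
  proof -
    have "(\<lambda>k. measure (measure_pmf (poisson_law r)) (if k \<in> U then {k} else {})) sums
      measure (measure_pmf (poisson_law r)) (\<Union>k. if k \<in> U then {k} else {})"
      by (rule measure_pmf.finite_measure_UNION) (auto simp: disjoint_family_on_def)
    moreover have "(\<Union>k. if k \<in> U then {k} else {}) = U" by (auto split: if_splits)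
    moreover have "measure (measure_pmf (poisson_law r)) (if k \<in> U then {k} else {}) = pmf (poisson_law r) k * indicator U k" for k
      by (simp add: measure_pmf_single)
    ultimately have "(\<lambda>k. pmf (poisson_law r) k * indicator U k) sums measure (measure_pmf (poisson_law r)) U" by simp
    from sums_mult[OF this, of g] show ?thesis by (simp add: c mult.assoc)
  qed
  ultimately show ?thesis by (rule sums_unique2)
qed

text \<open>Laplace factors are exchanged for indicators one coordinate at a time. In each exchange,
  the weight in \<open>weighted_count_law\<close> is the product of the indicators already obtained
  and the factors still to come.\<close>

lemma (in prob_space) joint_count_law:
  fixes D :: "nat \<Rightarrow> 'a \<Rightarrow> ennreal"
  assumes D[measurable]: "\<And>j. j < n \<Longrightarrow> D j \<in> borel_measurable M"
    and Dv: "\<And>j \<omega>. j < n \<Longrightarrow> D j \<omega> = \<infinity> \<or> (\<exists>n::nat. D j \<omega> = of_nat n)"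
    and r: "\<And>j. j < n \<Longrightarrow> 0 \<le> r j"
    and L: "\<And>a. (\<And>j. j < n \<Longrightarrow> 0 < a j) \<Longrightarrow>
      expectation (\<lambda>\<omega>. \<Prod>j<n. nexp (ennreal (a j) * D j \<omega>)) = (\<Prod>j<n. exp (- ((1 - exp (- a j)) * r j)))"
  shows "prob {\<omega> \<in> space M. \<forall>j<n. D j \<omega> \<in> of_nat ` U j} = (\<Prod>j<n. measure (measure_pmf (poisson_law (r j))) (U j))"
proof -
  have cs[measurable]: "of_nat ` U \<in> sets (borel :: ennreal measure)" for U :: "nat set"
    by (rule sets.countable) auto
  let ?I = "\<lambda>j \<omega>. indicator (of_nat ` U j) (D j \<omega>) :: real"
  have step: "expectation (\<lambda>\<omega>. (\<Prod>j<m. ?I j \<omega>) * (\<Prod>j\<in>{m..<n}. nexp (ennreal (a j) * D j \<omega>)))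
     = (\<Prod>j<m. measure (measure_pmf (poisson_law (r j))) (U j)) * (\<Prod>j\<in>{m..<n}. exp (- ((1 - exp (- a j)) * r j)))"
    if "m \<le> n" "\<And>j. j < n \<Longrightarrow> 0 < a j" for m a
    using that
  \<comment> \<open>The parameters are kept general because the coordinate being exchanged needs its
    transform at every \<open>b > 0\<close>, that is, the induction hypothesis at
    \<open>a(m := b)\<close>.\<close>
  proof (induction m arbitrary: a)
    case 0
    then show ?case using L[of a] by (simp add: atLeast0LessThan)
  next
    case (Suc m)
    then have m: "m < n" by simp
    let ?G = "\<lambda>\<omega>. (\<Prod>j<m. ?I j \<omega>) * (\<Prod>j\<in>{Suc m..<n}. nexp (ennreal (a j) * D j \<omega>))"
    let ?g = "(\<Prod>j<m. measure (measure_pmf (poisson_law (r j))) (U j)) * (\<Prod>j\<in>{Suc m..<n}. exp (- ((1 - exp (- a j)) * r j)))"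
    have split: "prod h {m..<n} = h m * prod h {Suc m..<n}" for h :: "nat \<Rightarrow> real"
      using m by (simp add: prod.atLeast_Suc_lessThan)
    have Gm: "?G \<in> borel_measurable M"
      using m by (intro borel_measurable_times borel_measurable_prod measurable_compose[OF D borel_measurable_indicator[OF cs]]
        measurable_compose[OF _ measurable_nexp] borel_measurable_times_ennreal D) auto
    have "expectation (\<lambda>\<omega>. ?G \<omega> * ?I m \<omega>) = ?g * measure (measure_pmf (poisson_law (r m))) (U m)"
    proof (rule weighted_count_law[OF D[OF m] Dv[OF m] Gm _ _ r[OF m]])
      show "0 \<le> ?G \<omega>" for \<omega> by (intro mult_nonneg_nonneg prod_nonneg) auto
      show "?G \<omega> \<le> 1" for \<omega> by (intro mult_le_one prod_le_1 prod_nonneg) (auto simp: indicator_def)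
      fix b :: real assume b: "0 < b"
      have eq: "(\<Prod>j\<in>{Suc m..<n}. h ((a(m := b)) j) j) = (\<Prod>j\<in>{Suc m..<n}. h (a j) j)" for h :: "real \<Rightarrow> nat \<Rightarrow> real"
        by (rule prod.cong) auto
      show "expectation (\<lambda>\<omega>. ?G \<omega> * nexp (ennreal b * D m \<omega>)) = ?g * exp (- ((1 - exp (- b)) * r m))"
        using Suc.IH[of "a(m := b)"] m b Suc.prems(2)
          eq[of "\<lambda>x j. exp (- ((1 - exp (- x)) * r j))"] eq[of "\<lambda>x j. nexp (ennreal x * D j _)"]
        by (simp add: split mult_ac)
    qed
    then show ?case by (simp add: mult_ac)
  qed
  have "expectation (\<lambda>\<omega>. \<Prod>j<n. ?I j \<omega>) = (\<Prod>j<n. measure (measure_pmf (poisson_law (r j))) (U j))"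
    using step[of n "\<lambda>_. 1"] by simp
  moreover have "expectation (\<lambda>\<omega>. \<Prod>j<n. ?I j \<omega>) = prob {\<omega> \<in> space M. \<forall>j<n. D j \<omega> \<in> of_nat ` U j}"
  proof -
    have "expectation (\<lambda>\<omega>. \<Prod>j<n. ?I j \<omega>) = expectation (indicator {\<omega> \<in> space M. \<forall>j<n. D j \<omega> \<in> of_nat ` U j})"
      by (rule Bochner_Integration.integral_cong) (auto simp: indicator_def)
    moreover have "{\<omega> \<in> space M. \<forall>j<n. D j \<omega> \<in> of_nat ` U j} \<inter> space M = {\<omega> \<in> space M. \<forall>j<n. D j \<omega> \<in> of_nat ` U j}"
      by auto
    ultimately show ?thesis by simp
  qed
  ultimately show ?thesis by simp
qed

text \<open>Putting \<open>UNIV\<close> in all coordinates but one yields the marginals, and then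
  \<open>law\<close> is the product formula.\<close>

lemma (in prob_space) indep_counts:
  fixes C :: "nat \<Rightarrow> 'a \<Rightarrow> nat"
  assumes n: "0 < n" and C[measurable]: "\<And>j. j < n \<Longrightarrow> C j \<in> measurable M (count_space UNIV)"
    and law: "\<And>U. prob {\<omega> \<in> space M. \<forall>j<n. C j \<omega> \<in> U j} = (\<Prod>j<n. measure (measure_pmf (p j)) (U j))"
  shows "indep_vars (\<lambda>_. count_space UNIV) C {..<n}"
    and "\<And>j. j < n \<Longrightarrow> distr M (count_space UNIV) (C j) = measure_pmf (p j)"
proof -
  have marg: "prob {\<omega> \<in> space M. C j \<omega> \<in> V} = measure (measure_pmf (p j)) V" if j: "j < n" for j V
  proof -
    have "{\<omega> \<in> space M. C j \<omega> \<in> V} = {\<omega> \<in> space M. \<forall>i<n. C i \<omega> \<in> (if i = j then V else UNIV)}"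
      using j by auto
    also have "prob \<dots> = (\<Prod>i<n. measure (measure_pmf (p i)) (if i = j then V else UNIV))"
      by (rule law)
    also have "\<dots> = (\<Prod>i<n. if i = j then measure (measure_pmf (p j)) V else 1)"
      by (rule prod.cong) (auto simp: measure_pmf.prob_space[simplified])
    also have "\<dots> = measure (measure_pmf (p j)) V" using j by simp
    finally show ?thesis .
  qed
  show "distr M (count_space UNIV) (C j) = measure_pmf (p j)" if j: "j < n" for j
  proof (rule measure_eqI)
    fix V
    have "emeasure (distr M (count_space UNIV) (C j)) V = emeasure M (C j -` V \<inter> space M)"
      using j by (intro emeasure_distr) auto
    also have "C j -` V \<inter> space M = {\<omega> \<in> space M. C j \<omega> \<in> V}" by auto
    also have "emeasure M \<dots> = emeasure (measure_pmf (p j)) V"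
      by (simp add: emeasure_eq_measure marg[OF j] measure_pmf.emeasure_eq_measure)
    finally show "emeasure (distr M (count_space UNIV) (C j)) V = emeasure (measure_pmf (p j)) V" .
  qed simp
  have "indep_vars (\<lambda>_. count_space UNIV) C {..<n} \<longleftrightarrow>
    (\<forall>A\<in>(\<Pi> i\<in>{..<n}. UNIV). prob (\<Inter>j\<in>{..<n}. C j -` A j \<inter> space M) = (\<Prod>j\<in>{..<n}. prob (C j -` A j \<inter> space M)))"
  proof (rule indep_vars_finite)
    show "sets (count_space UNIV) = sigma_sets (space (count_space UNIV)) (UNIV :: nat set set)"
      using sets.sigma_sets_eq[of "count_space (UNIV :: nat set)"] by simp
  qed (use n in \<open>auto simp: Int_stable_def\<close>)
  also have "\<dots>"
  proof
    fix A :: "nat \<Rightarrow> nat set"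
    have "(\<Inter>j\<in>{..<n}. C j -` A j \<inter> space M) = {\<omega> \<in> space M. \<forall>j<n. C j \<omega> \<in> A j}"
      using n by auto
    moreover have "C j -` A j \<inter> space M = {\<omega> \<in> space M. C j \<omega> \<in> A j}" for j by auto
    ultimately show "prob (\<Inter>j\<in>{..<n}. C j -` A j \<inter> space M) = (\<Prod>j\<in>{..<n}. prob (C j -` A j \<inter> space M))"
      by (simp add: law marg)
  qed
  finally show "indep_vars (\<lambda>_. count_space UNIV) C {..<n}" .
qed

section \<open>Counts of marked points in sets of pairs\<close>

context marked_poisson_points
begin

definition mark_count :: "(real \<times> 's) set \<Rightarrow> 'a \<Rightarrow> ennreal" where
  "mark_count E \<omega> = (\<Sum>i. of_bool (\<exists>x. W i \<omega> = ereal x \<and> (x, X i \<omega>) \<in> E))"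

lemma mark_count_eq: "mark_count E \<omega> = (\<Sum>i. at_point (\<lambda>x. indicator E (x, X i \<omega>)) (W i \<omega>))"
proof -
  have "of_bool (\<exists>x. w = ereal x \<and> (x, b) \<in> E) = at_point (\<lambda>x. indicator E (x, b)) w" for w b
    by (cases w) (auto simp: indicator_def)
  then show ?thesis by (simp add: mark_count_def)
qed

lemma mark_count_cases: "mark_count E \<omega> = \<infinity> \<or> (\<exists>n::nat. mark_count E \<omega> = of_nat n)"
  unfolding mark_count_def
  by (rule suminf_of_bool_cases[of "\<lambda>i. \<exists>x. W i \<omega> = ereal x \<and> (x, X i \<omega>) \<in> E"]) blast+

lemma measurable_mark_count[measurable]:
  assumes E: "E \<in> sets (borel \<Otimes>\<^sub>M S)"
  shows "mark_count E \<in> borel_measurable M"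
proof -
  note [measurable] = measurable_at_point_mark[OF borel_measurable_indicator[OF E]]
  show ?thesis unfolding mark_count_eq[abs_def] by measurable
qed

text \<open>The marking theorem for the step function with value \<open>a j\<close> on
  \<open>A j\<close>. By disjointness the exponent is a sum over \<open>j\<close>, which is
  independence of the counts in transform form.\<close>

lemma laplace_mark_counts:
  fixes A :: "nat \<Rightarrow> (real \<times> 's) set"
  assumes A: "\<And>j. j < n \<Longrightarrow> A j \<in> sets (borel \<Otimes>\<^sub>M S)" "\<And>j. j < n \<Longrightarrow> A j \<subseteq> {0<..} \<times> UNIV"
    and dis: "disjoint_family_on A {..<n}"
    and fin: "\<And>j. j < n \<Longrightarrow> emeasure (\<nu> \<Otimes>\<^sub>M Q) (A j) < \<infinity>"
    and a: "\<And>j. j < n \<Longrightarrow> 0 < a j"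
  shows "expectation (\<lambda>\<omega>. \<Prod>j<n. nexp (ennreal (a j) * mark_count (A j) \<omega>))
    = (\<Prod>j<n. exp (- ((1 - exp (- a j)) * measure (\<nu> \<Otimes>\<^sub>M Q) (A j))))"
proof -
  interpret Q: prob_space Q by (rule prob_space_marks)
  define f where "f p = (\<Sum>j<n. ennreal (a j) * indicator (A j) p)" for p
  have fm: "f \<in> borel_measurable (borel \<Otimes>\<^sub>M S)"
    unfolding f_def using A(1) by (intro borel_measurable_sum borel_measurable_times_ennreal borel_measurable_indicator) auto
  have sets_eq: "sets (borel \<Otimes>\<^sub>M S) = sets (\<nu> \<Otimes>\<^sub>M Q)"
    by (rule sets_pair_measure_cong) (simp_all add: sets_intensity sets_marks)
  have f0: "f (x, b) = 0" if "x \<le> 0" for x b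
    unfolding f_def using A(2) that by (intro sum.neutral) (force simp: indicator_def)
  have at: "at_point (\<lambda>x. f (x, b)) w = (\<Sum>j<n. ennreal (a j) * at_point (\<lambda>x. indicator (A j) (x, b)) w)" for b w
    by (cases w) (auto simp: f_def)
  have sum: "(\<Sum>i. at_point (\<lambda>x. f (x, X i \<omega>)) (W i \<omega>)) = (\<Sum>j<n. ennreal (a j) * mark_count (A j) \<omega>)" for \<omega>
    unfolding at mark_count_eq ennreal_suminf_cmult[symmetric] by (rule suminf_sum) auto
  have one: "ennreal (1 - nexp (f p)) = (\<Sum>j<n. ennreal (1 - exp (- a j)) * indicator (A j) p)" for p
    unfolding f_def by (rule one_minus_nexp_disjoint_sum[OF dis a])
  have "(\<integral>\<^sup>+x. \<integral>\<^sup>+b. ennreal (1 - nexp (f (x, b))) \<partial>Q \<partial>\<nu>) = (\<integral>\<^sup>+p. ennreal (1 - nexp (f p)) \<partial>(\<nu> \<Otimes>\<^sub>M Q))"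
  proof (rule Q.nn_integral_fst)
    have "(\<lambda>p. ennreal (1 - nexp (f p))) \<in> borel_measurable (borel \<Otimes>\<^sub>M S)" using fm by measurable
    then show "(\<lambda>p. ennreal (1 - nexp (f p))) \<in> borel_measurable (\<nu> \<Otimes>\<^sub>M Q)"
      by (simp add: measurable_cong_sets[OF sets_eq refl])
  qed
  also have "\<dots> = (\<Sum>j<n. ennreal (1 - exp (- a j)) * emeasure (\<nu> \<Otimes>\<^sub>M Q) (A j))"
    unfolding one using A(1) by (subst nn_integral_sum) (auto simp: nn_integral_cmult_indicator sets_eq intro!: sum.cong)
  also have "\<dots> = (\<Sum>j<n. ennreal ((1 - exp (- a j)) * measure (\<nu> \<Otimes>\<^sub>M Q) (A j)))"
  proof (rule sum.cong)
    fix j assume "j \<in> {..<n}"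
    then have j: "j < n" by simp
    have "emeasure (\<nu> \<Otimes>\<^sub>M Q) (A j) = ennreal (measure (\<nu> \<Otimes>\<^sub>M Q) (A j))"
      using fin[OF j] by (intro emeasure_eq_ennreal_measure) auto
    then show "ennreal (1 - exp (- a j)) * emeasure (\<nu> \<Otimes>\<^sub>M Q) (A j) = ennreal ((1 - exp (- a j)) * measure (\<nu> \<Otimes>\<^sub>M Q) (A j))"
      using a[OF j] by (simp add: ennreal_mult)
  qed simp
  finally have int: "(\<integral>\<^sup>+x. \<integral>\<^sup>+b. ennreal (1 - nexp (f (x, b))) \<partial>Q \<partial>\<nu>)
      = (\<Sum>j<n. ennreal ((1 - exp (- a j)) * measure (\<nu> \<Otimes>\<^sub>M Q) (A j)))" .
  have "expectation (\<lambda>\<omega>. \<Prod>j<n. nexp (ennreal (a j) * mark_count (A j) \<omega>))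
      = expectation (\<lambda>\<omega>. nexp (\<Sum>i. at_point (\<lambda>x. f (x, X i \<omega>)) (W i \<omega>)))"
    by (simp add: sum nexp_sum)
  also have "\<dots> = nexp (\<Sum>j<n. ennreal ((1 - exp (- a j)) * measure (\<nu> \<Otimes>\<^sub>M Q) (A j)))"
    by (rule trans[OF laplace_marked[OF fm f0]]) (simp_all only: int)
  also have "\<dots> = (\<Prod>j<n. exp (- ((1 - exp (- a j)) * measure (\<nu> \<Otimes>\<^sub>M Q) (A j))))"
    unfolding nexp_sum[OF finite_lessThan]
  proof (rule prod.cong)
    fix j assume "j \<in> {..<n}"
    then have "0 \<le> (1 - exp (- a j)) * measure (\<nu> \<Otimes>\<^sub>M Q) (A j)" using a by (simp add: less_imp_le)
    then show "nexp (ennreal ((1 - exp (- a j)) * measure (\<nu> \<Otimes>\<^sub>M Q) (A j))) = exp (- ((1 - exp (- a j)) * measure (\<nu> \<Otimes>\<^sub>M Q) (A j)))"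
      by (rule nexp_ennreal)
  qed simp
  finally show ?thesis .
qed

text \<open>The counts of the successive differences of the sets are independent Poisson variables,
  and the count of \<open>E k\<close> is their partial sum. With \<open>E k\<close> the pairs of
  start and path that cross by the \<open>k\<close>-th grid time, this controls the crossing process
  on a grid.\<close>

lemma mark_count_maximal_inequality:
  fixes E :: "nat \<Rightarrow> (real \<times> 's) set"
  assumes E: "\<And>k. k < n \<Longrightarrow> E k \<in> sets (borel \<Otimes>\<^sub>M S)" "\<And>k. k < n \<Longrightarrow> E k \<subseteq> {0<..} \<times> UNIV"
    and inc: "\<And>j k. j \<le> k \<Longrightarrow> k < n \<Longrightarrow> E j \<subseteq> E k"
    and v: "\<And>k. k < n \<Longrightarrow> emeasure (\<nu> \<Otimes>\<^sub>M Q) (E k) \<le> ennreal v" "0 \<le> v" and s: "0 \<le> s" "s \<le> 1"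
  shows "prob {\<omega> \<in> space M. \<exists>k<n. ennreal (measure (\<nu> \<Otimes>\<^sub>M Q) (E k) + 2 * x) \<le> mark_count (E k) \<omega>}
    \<le> 2 * exp (s\<^sup>2 * v - s * x)"
proof (cases "n = 0")
  case False
  then have n: "0 < n" by simp
  define A where "A k = E k - (\<Union>j<k. E j)" for k
  have sets_eq: "sets (borel \<Otimes>\<^sub>M S) = sets (\<nu> \<Otimes>\<^sub>M Q)"
    by (rule sets_pair_measure_cong) (simp_all add: sets_intensity sets_marks)
  have A: "A k \<in> sets (borel \<Otimes>\<^sub>M S)" "A k \<subseteq> {0<..} \<times> UNIV" if "k < n" for k
  proof -
    have "E j \<in> sets (borel \<Otimes>\<^sub>M S)" if "j \<le> k" for j using E(1) that \<open>k < n\<close> by simp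
    then show "A k \<in> sets (borel \<Otimes>\<^sub>M S)" unfolding A_def by (intro sets.Diff sets.finite_UN) auto
    show "A k \<subseteq> {0<..} \<times> UNIV" using E(2)[OF that] unfolding A_def by blast
  qed
  have dis: "disjoint_family A" unfolding A_def
    using disjoint_family_disjointed[of E] by (simp add: disjointed_def[abs_def] atLeast0LessThan)
  have E_UN: "E k = (\<Union>j\<le>k. A j)" if "k < n" for k
  proof -
    have "(\<Union>j\<le>k. A j) = (\<Union>j\<le>k. E j)"
      using UN_disjointed_eq[of E] finite_UN_disjointed_eq[of E "Suc k"]
      by (simp add: A_def[abs_def] disjointed_def[abs_def] atLeast0LessThan lessThan_Suc_atMost)
    also have "\<dots> = E k" using inc that by auto
    finally show ?thesis ..
  qed
  have fin: "emeasure (\<nu> \<Otimes>\<^sub>M Q) (A k) < \<infinity>" if "k < n" for k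
  proof -
    have "emeasure (\<nu> \<Otimes>\<^sub>M Q) (A k) \<le> emeasure (\<nu> \<Otimes>\<^sub>M Q) (E k)"
      by (rule emeasure_mono) (use E(1)[OF that] sets_eq in \<open>auto simp: A_def\<close>)
    also have "\<dots> \<le> ennreal v" by (rule v(1)[OF that])
    finally show ?thesis by (simp add: le_less_trans)
  qed
  define r where "r k = measure (\<nu> \<Otimes>\<^sub>M Q) (A k)" for k
  have mE: "measure (\<nu> \<Otimes>\<^sub>M Q) (E k) = (\<Sum>j\<le>k. r j)" if "k < n" for k
  proof -
    have "measure (\<nu> \<Otimes>\<^sub>M Q) (\<Union>j\<in>{..k}. A j) = (\<Sum>j\<in>{..k}. measure (\<nu> \<Otimes>\<^sub>M Q) (A j))"
    proof (rule measure_finite_Union)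
      show "emeasure (\<nu> \<Otimes>\<^sub>M Q) (A j) \<noteq> \<infinity>" if "j \<in> {..k}" for j
        using fin[of j] that \<open>k < n\<close> by simp
      show "A ` {..k} \<subseteq> sets (\<nu> \<Otimes>\<^sub>M Q)" using A(1) that unfolding sets_eq by auto
      show "disjoint_family_on A {..k}" by (rule disjoint_family_on_mono[OF subset_UNIV dis])
    qed simp
    then show ?thesis unfolding E_UN[OF that] r_def .
  qed
  let ?D = "\<lambda>j. mark_count (A j)"
  \<comment> \<open>The counts as natural numbers. An infinite count is sent to the default value 0;
    this is a null event, by \<open>law\<close> with every \<open>U j\<close> equal to
    \<open>UNIV\<close>.\<close>
  define C where "C j \<omega> = nat \<lfloor>enn2real (?D j \<omega>)\<rfloor>" for j \<omega>
  have Dm[measurable]: "?D j \<in> borel_measurable M" if "j < n" for j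
    using A(1)[OF that] by measurable
  have Cm: "C j \<in> measurable M (count_space UNIV)" if "j < n" for j
    unfolding C_def using Dm[OF that] by measurable
  have law: "prob {\<omega> \<in> space M. \<forall>j<n. ?D j \<omega> \<in> of_nat ` U j} = (\<Prod>j<n. measure (measure_pmf (poisson_law (r j))) (U j))" for U
  proof (rule joint_count_law)
    show "expectation (\<lambda>\<omega>. \<Prod>j<n. nexp (ennreal (a j) * ?D j \<omega>)) = (\<Prod>j<n. exp (- ((1 - exp (- a j)) * r j)))"
      if "\<And>j. j < n \<Longrightarrow> 0 < a j" for a
      unfolding r_def by (rule laplace_mark_counts) (use A fin that dis in \<open>auto simp: disjoint_family_on_def\<close>)
  qed (auto simp: r_def Dm mark_count_cases[simplified])
  have "prob {\<omega> \<in> space M. \<forall>j<n. ?D j \<omega> \<in> of_nat ` UNIV} = 1"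
    unfolding law by (simp add: measure_pmf.prob_space[simplified])
  moreover have Dn_sets: "{\<omega> \<in> space M. \<forall>j<n. ?D j \<omega> \<in> of_nat ` U j} \<in> events" for U :: "nat \<Rightarrow> nat set"
  proof -
    have [measurable]: "of_nat ` U \<in> sets (borel :: ennreal measure)" for U :: "nat set"
      by (rule sets.countable) auto
    have [measurable]: "?D j \<in> borel_measurable M" if "j \<in> {..<n}" for j using Dm that by simp
    have "{\<omega> \<in> space M. \<forall>j<n. ?D j \<omega> \<in> of_nat ` U j} = {\<omega> \<in> space M. \<forall>j\<in>{..<n}. ?D j \<omega> \<in> of_nat ` U j}" by auto
    also have "\<dots> \<in> events" by measurable
    finally show ?thesis .
  qed
  ultimately have "AE \<omega> in M. \<omega> \<in> {\<omega> \<in> space M. \<forall>j<n. ?D j \<omega> \<in> of_nat ` UNIV}"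
    using prob_eq_1[OF Dn_sets[of "\<lambda>_. UNIV"]] by (simp only:)
  then have AE: "AE \<omega> in M. \<forall>j<n. ?D j \<omega> \<in> of_nat ` UNIV" by (simp only: mem_Collect_eq) (elim eventually_mono, blast)
  have CD: "?D j \<omega> = of_nat (C j \<omega>)" if "?D j \<omega> \<in> of_nat ` UNIV" for j \<omega>
    using that by (auto simp: C_def)
  have lawC: "prob {\<omega> \<in> space M. \<forall>j<n. C j \<omega> \<in> U j} = (\<Prod>j<n. measure (measure_pmf (poisson_law (r j))) (U j))" for U
  proof -
    have [measurable]: "C j \<in> measurable M (count_space UNIV)" if "j \<in> {..<n}" for j using Cm that by simp
    have "{\<omega> \<in> space M. \<forall>j<n. C j \<omega> \<in> U j} = {\<omega> \<in> space M. \<forall>j\<in>{..<n}. C j \<omega> \<in> U j}" by auto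
    also have "\<dots> \<in> events" by measurable
    finally have m1: "{\<omega> \<in> space M. \<forall>j<n. C j \<omega> \<in> U j} \<in> events" .
    have "prob {\<omega> \<in> space M. \<forall>j<n. C j \<omega> \<in> U j} = prob {\<omega> \<in> space M. \<forall>j<n. ?D j \<omega> \<in> of_nat ` U j}"
    proof (rule finite_measure_eq_AE[OF _ m1 Dn_sets])
      show "AE \<omega> in M. \<omega> \<in> {\<omega> \<in> space M. \<forall>j<n. C j \<omega> \<in> U j} \<longleftrightarrow> \<omega> \<in> {\<omega> \<in> space M. \<forall>j<n. ?D j \<omega> \<in> of_nat ` U j}"
        using AE
      proof eventually_elim
        case (elim \<omega>)
        have "?D j \<omega> \<in> of_nat ` U j \<longleftrightarrow> C j \<omega> \<in> U j" if "j < n" for j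
        proof -
          have e: "?D j \<omega> = of_nat (C j \<omega>)" by (rule CD) (use elim that in blast)
          show ?thesis unfolding e by (auto simp: image_iff)
        qed
        then show ?case by auto
      qed
    qed
    then show ?thesis by (simp add: law)
  qed
  have "prob {\<omega> \<in> space M. \<exists>k<n. ennreal (measure (\<nu> \<Otimes>\<^sub>M Q) (E k) + 2 * x) \<le> mark_count (E k) \<omega>}
    \<le> prob {\<omega> \<in> space M. \<exists>k<n. 2 * x \<le> (\<Sum>i\<le>k. real (C i \<omega>) - r i)}"
  proof (rule finite_measure_mono_AE)
    show "AE \<omega> in M. \<omega> \<in> {\<omega> \<in> space M. \<exists>k<n. ennreal (measure (\<nu> \<Otimes>\<^sub>M Q) (E k) + 2 * x) \<le> mark_count (E k) \<omega>}
      \<longrightarrow> \<omega> \<in> {\<omega> \<in> space M. \<exists>k<n. 2 * x \<le> (\<Sum>i\<le>k. real (C i \<omega>) - r i)}"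
      using AE
    proof eventually_elim
      case (elim \<omega>)
      have "2 * x \<le> (\<Sum>i\<le>k. real (C i \<omega>) - r i)" if k: "k < n" "ennreal (measure (\<nu> \<Otimes>\<^sub>M Q) (E k) + 2 * x) \<le> mark_count (E k) \<omega>" for k
      proof -
        have "indicator (E k) p = (\<Sum>j\<le>k. indicator (A j) p :: ennreal)" for p
          unfolding E_UN[OF k(1)] using dis by (intro indicator_UN_disjoint) (auto simp: disjoint_family_on_def)
        then have "at_point (\<lambda>x. indicator (E k) (x, b)) w = (\<Sum>j\<le>k. at_point (\<lambda>x. indicator (A j) (x, b)) w)" for b w
          by (cases w) auto
        then have "mark_count (E k) \<omega> = (\<Sum>j\<le>k. ?D j \<omega>)"
          unfolding mark_count_eq by (simp add: suminf_sum)
        also have "\<dots> = (\<Sum>j\<le>k. of_nat (C j \<omega>))"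
          using elim k(1) by (intro sum.cong CD) auto
        also have "\<dots> = ennreal (\<Sum>j\<le>k. real (C j \<omega>))"
          by (simp add: ennreal_of_nat_eq_real_of_nat sum_ennreal)
        finally have "measure (\<nu> \<Otimes>\<^sub>M Q) (E k) + 2 * x \<le> (\<Sum>j\<le>k. real (C j \<omega>))"
          using k(2) by (simp add: sum_nonneg)
        then show ?thesis by (simp add: mE[OF k(1)] sum_subtractf)
      qed
      then show ?case by auto
    qed
    have "{\<omega> \<in> space M. \<exists>k<n. 2 * x \<le> (\<Sum>i\<le>k. real (C i \<omega>) - r i)} = {\<omega> \<in> space M. \<exists>k\<in>{..<n}. 2 * x \<le> (\<Sum>i\<le>k. real (C i \<omega>) - r i)}"
      by auto
    also have "\<dots> \<in> events"
    proof -
      have [measurable]: "(\<lambda>\<omega>. \<Sum>i\<le>k. real (C i \<omega>) - r i) \<in> borel_measurable M" if "k \<in> {..<n}" for k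
        using that by (intro borel_measurable_sum borel_measurable_diff measurable_compose[OF Cm]) auto
      show ?thesis by measurable
    qed
    finally show "{\<omega> \<in> space M. \<exists>k<n. 2 * x \<le> (\<Sum>i\<le>k. real (C i \<omega>) - r i)} \<in> events" .
  qed
  also have "\<dots> \<le> 2 * exp (s\<^sup>2 * v - s * x)"
  proof (rule poisson_maximal_inequality)
    show "indep_vars (\<lambda>_. count_space UNIV) C {..<n}"
      by (rule indep_counts(1)[OF n Cm lawC])
    show "distr M (count_space UNIV) (C i) = measure_pmf (poisson_law (r i))" if "i < n" for i
      by (rule indep_counts(2)[OF n Cm lawC that])
    have "ennreal (measure (\<nu> \<Otimes>\<^sub>M Q) (E (n - 1))) = emeasure (\<nu> \<Otimes>\<^sub>M Q) (E (n - 1))"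
      using v(1)[of "n - 1"] n by (intro emeasure_eq_ennreal_measure[symmetric]) (auto simp: top_unique)
    then have "ennreal (measure (\<nu> \<Otimes>\<^sub>M Q) (E (n - 1))) \<le> ennreal v"
      using v(1)[of "n - 1"] n by simp
    then have "measure (\<nu> \<Otimes>\<^sub>M Q) (E (n - 1)) \<le> v" using v(2) by (simp only: ennreal_le_iff)
    moreover have "{..<n} = {..n - 1}" using n by auto
    ultimately show "(\<Sum>i<n. r i) \<le> v" using mE[of "n - 1"] n by simp
  qed (use s in \<open>auto simp: r_def\<close>)
  finally show ?thesis .
qed simp

end

section \<open>Brownian motion\<close>

text \<open>The parameter is the variance, so that \<open>gauss h\<close> is the law of a Brownian
  increment over a time of length \<open>h\<close>.\<close>

definition gauss :: "real \<Rightarrow> real measure" where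
  "gauss h = density lborel (\<lambda>x. ennreal (normal_density 0 (sqrt h) x))"

lemma sets_gauss[simp, measurable_cong]: "sets (gauss h) = sets borel"
  by (simp add: gauss_def)

lemma space_gauss[simp]: "space (gauss h) = UNIV"
  by (simp add: gauss_def)

lemma emeasure_gauss:
  "A \<in> sets borel \<Longrightarrow> emeasure (gauss h) A = (\<integral>\<^sup>+x. ennreal (normal_density 0 (sqrt h) x) * indicator A x \<partial>lborel)"
  by (simp add: gauss_def emeasure_density)

lemma prob_space_gauss: "0 < h \<Longrightarrow> prob_space (gauss h)"
  unfolding gauss_def by (rule prob_space_normal_density) simp

lemma measure_gauss_neg:
  assumes h: "0 < h" shows "measure (gauss h) {..- a} = measure (gauss h) {a..}"
proof -
  have "emeasure (gauss h) {..- a} = (\<integral>\<^sup>+x. ennreal (normal_density 0 (sqrt h) (0 + (- 1) * x)) * indicator {..- a} (0 + (- 1) * x) \<partial>lborel)"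
    using nn_integral_real_affine[of "\<lambda>x. ennreal (normal_density 0 (sqrt h) x) * indicator {..- a} x" "- 1" 0]
    by (simp add: emeasure_gauss)
  also have "\<dots> = emeasure (gauss h) {a..}"
    unfolding emeasure_gauss[of "{a..}" h, simplified]
    by (intro nn_integral_cong) (auto simp: normal_density_def indicator_def)
  finally show ?thesis by (simp add: measure_def)
qed

lemma measure_gauss_half:
  assumes h: "0 < h" shows "1 / 2 \<le> measure (gauss h) {..0}" "1 / 2 \<le> measure (gauss h) {0..}"
proof -
  interpret prob_space "gauss h" by (rule prob_space_gauss[OF h])
  have "{..0} \<union> {0..} = (UNIV :: real set)" by auto
  then have "1 = prob ({..0} \<union> {0..})" using prob_space by simp
  also have "\<dots> \<le> prob {..0} + prob {0..}" by (rule measure_Un_le) auto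
  finally show "1 / 2 \<le> prob {..0}" "1 / 2 \<le> prob {0..}"
    using measure_gauss_neg[OF h, of 0] by simp_all
qed

text \<open>Shifting the Gaussian density by \<open>a\<close> decreases it on \<open>{a..}\<close> by the factor
  \<open>exp (- 3 a\<^sup>2 / (2 h))\<close>.\<close>

lemma measure_gauss_double_tail:
  assumes h: "0 < h" "h \<le> a\<^sup>2 / 2" and a: "0 < a"
  shows "2 * measure (gauss h) {2 * a..} < measure (gauss h) {a..}"
proof -
  interpret prob_space "gauss h" by (rule prob_space_gauss[OF h(1)])
  let ?\<phi> = "normal_density 0 (sqrt h)"
  \<comment> \<open>For \<open>x \<ge> a\<close> the shift raises the square by at least
    \<open>3 * a^2\<close>, and \<open>h \<le> a^2 / 2\<close> turns this into a factor
    \<open>exp (- 3)\<close>, which is below 1/2.\<close>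
  have dens: "?\<phi> (a + x) \<le> exp (- 3) * ?\<phi> x" if "a \<le> x" for x
  proof -
    have "x\<^sup>2 + 3 * a\<^sup>2 \<le> (a + x)\<^sup>2"
    proof -
      have "a * a \<le> a * x" using a that by (intro mult_left_mono) auto
      then show ?thesis by (simp add: power2_eq_square algebra_simps)
    qed
    moreover have "6 * h \<le> 3 * a\<^sup>2" using h(2) by simp
    ultimately have "x\<^sup>2 + 6 * h \<le> (a + x)\<^sup>2" by linarith
    then have "- ((a + x)\<^sup>2) / (2 * h) \<le> - (x\<^sup>2 + 6 * h) / (2 * h)"
      using h(1) by (intro divide_right_mono) auto
    also have "\<dots> = - 3 + - (x\<^sup>2) / (2 * h)" using h(1) by (simp add: field_simps)
    finally have "exp (- ((a + x)\<^sup>2) / (2 * h)) \<le> exp (- 3) * exp (- (x\<^sup>2) / (2 * h))"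
      by (simp flip: exp_add)
    then have "1 / sqrt (2 * pi * h) * exp (- ((a + x)\<^sup>2) / (2 * h)) \<le> 1 / sqrt (2 * pi * h) * (exp (- 3) * exp (- (x\<^sup>2) / (2 * h)))"
      using h by (intro mult_left_mono) auto
    then show ?thesis using h by (simp add: normal_density_def mult_ac)
  qed
  have "emeasure (gauss h) {2 * a..} = (\<integral>\<^sup>+x. ennreal (?\<phi> (a + x)) * indicator {2 * a..} (a + x) \<partial>lborel)"
    using nn_integral_real_affine[of "\<lambda>x. ennreal (?\<phi> x) * indicator {2 * a..} x" 1 a]
    by (simp add: emeasure_gauss)
  also have "\<dots> \<le> (\<integral>\<^sup>+x. ennreal (exp (- 3)) * (ennreal (?\<phi> x) * indicator {a..} x) \<partial>lborel)"
    using dens by (intro nn_integral_mono) (auto simp: indicator_def ennreal_leI simp flip: ennreal_mult')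
  also have "\<dots> = ennreal (exp (- 3)) * emeasure (gauss h) {a..}"
    by (subst nn_integral_cmult) (auto simp: emeasure_gauss)
  finally have le: "prob {2 * a..} \<le> exp (- 3) * prob {a..}"
    by (simp add: emeasure_eq_measure flip: ennreal_mult')
  have "0 < prob {a..}"
  proof -
    have "prob {a..} \<noteq> 0"
    proof
      assume "prob {a..} = 0"
      then have "(\<integral>\<^sup>+x. ennreal (?\<phi> x) * indicator {a..} x \<partial>lborel) = 0"
        using emeasure_gauss[of "{a..}" h] by (simp add: emeasure_eq_measure)
      then have "AE x in lborel. ennreal (?\<phi> x) * indicator {a..} x = 0"
        by (subst (asm) nn_integral_0_iff_AE) auto
      then have "AE x in lborel. x \<notin> {a..}"
      proof eventually_elim
        case (elim x)
        then show ?case using h normal_density_pos[of "sqrt h" 0 x] by (auto simp: indicator_def ennreal_eq_0_iff split: if_splits)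
      qed
      then have "emeasure lborel {a..} = 0"
        by (subst (asm) AE_iff_measurable[of "{a..}"]) auto
      moreover have "emeasure lborel {a..a + 1} \<le> emeasure lborel {a..}" by (intro emeasure_mono) auto
      ultimately show False by simp
    qed
    then show ?thesis using measure_nonneg[of "gauss h" "{a..}"] by linarith
  qed
  moreover have "exp (- 3) < (1 / 2 :: real)"
  proof -
    have "1 + 3 \<le> exp (3::real)" by (rule exp_ge_add_one_self)
    then show ?thesis by (simp add: exp_minus field_simps)
  qed
  ultimately have "exp (- 3) * prob {a..} < 1 / 2 * prob {a..}"
    by (intro mult_strict_right_mono)
  with le show ?thesis by linarith
qed

section \<open>Survival of a Brownian path above a barrier\<close>

context standard_brownian_motion
begin

lemma measurable_increment:
  "0 \<le> s \<Longrightarrow> 0 \<le> t \<Longrightarrow> (\<lambda>\<omega>. B t \<omega> - B s \<omega>) \<in> borel_measurable M"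
  by (intro borel_measurable_diff measurable)

lemma distr_increment:
  assumes "0 \<le> s" "s < t"
  shows "distr M borel (\<lambda>\<omega>. B t \<omega> - B s \<omega>) = gauss (t - s)"
  using distributed_distr_eq_density[OF gaussian_increments[OF assms]]
  by (simp add: gauss_def cong: distr_cong)

lemma prob_increment:
  assumes "0 \<le> s" "s < t" "A \<in> sets borel"
  shows "prob {\<omega> \<in> space M. B t \<omega> - B s \<omega> \<in> A} = measure (gauss (t - s)) A"
proof -
  have "measure (distr M borel (\<lambda>\<omega>. B t \<omega> - B s \<omega>)) A = prob ((\<lambda>\<omega>. B t \<omega> - B s \<omega>) -` A \<inter> space M)"
    using assms by (intro measure_distr measurable_increment) auto
  then show ?thesis using assms by (simp add: distr_increment vimage_def Int_def conj_commute)
qed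

text \<open>The event of a final rise by \<open>a\<close>, minus the event of a dip to
  \<open>- 2 * a\<close> on the grid. Ottaviani's inequality with \<open>x = 0\<close>, whose tail
  condition is the symmetry of the Gaussian, bounds the dip by twice the probability of a final drop
  by \<open>2 * a\<close>. The bound does not involve the number \<open>n\<close> of grid
  steps.\<close>

lemma block_event_lower_bound:
  assumes u: "0 \<le> u" and h: "0 < h" and n: "0 < n" and a: "0 < a"
  defines "t \<equiv> \<lambda>k. u + real k * h / real n"
  shows "measure (gauss h) {a..} - 2 * measure (gauss h) {2 * a..}
    \<le> prob {\<omega> \<in> space M. (\<forall>k<n. - (2 * a) < B (t (Suc k)) \<omega> - B u \<omega>) \<and> a \<le> B (u + h) \<omega> - B u \<omega>}"
proof -
  have t0: "t 0 = u" and tn: "t n = u + h" using n by (auto simp: t_def)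
  have tmono: "t i \<le> t j" if "i \<le> j" for i j
    using that h by (auto simp: t_def intro!: divide_right_mono mult_right_mono)
  have tstrict: "t i < t j" if "i < j" for i j
    using that h n by (auto simp: t_def intro!: divide_strict_right_mono mult_strict_right_mono)
  have tpos: "0 \<le> t k" for k using u h by (auto simp: t_def)
  \<comment> \<open>The sign is reversed so that a dip of the path becomes an upcrossing of the
    partial sums.\<close>
  define X where "X k \<omega> = - (B (t (Suc k)) \<omega> - B (t k) \<omega>)" for k \<omega>
  have tele: "(\<Sum>i<k. X i \<omega>) = - (B (t k) \<omega> - B u \<omega>)" for k \<omega>
    unfolding X_def sum_negf using sum_lessThan_telescope[of "\<lambda>i. B (t i) \<omega>" k] by (simp only: t0)
  have "indep_vars (\<lambda>_. borel) (\<lambda>k \<omega>. B (t (Suc k)) \<omega> - B (t k) \<omega>) {..<n}"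
    by (rule independent_increments) (use tpos tmono in auto)
  then have ind: "indep_vars (\<lambda>_. borel) X {..<n}"
    unfolding X_def by (rule indep_vars_compose2) auto
  have "prob {\<omega> \<in> space M. \<exists>k<n. 0 + 2 * a \<le> (\<Sum>i\<le>k. X i \<omega>)} \<le> 2 * prob {\<omega> \<in> space M. 2 * a \<le> (\<Sum>i<n. X i \<omega>)}"
  proof (rule ottaviani[OF ind])
    fix k assume k: "k < n"
    have eq: "(\<Sum>i\<in>{k<..<n}. X i \<omega>) = - (B (t n) \<omega> - B (t (Suc k)) \<omega>)" for \<omega>
    proof -
      have "{..<n} = {..k} \<union> {k<..<n}" using k by auto
      then have "(\<Sum>i<n. X i \<omega>) = (\<Sum>i<Suc k. X i \<omega>) + (\<Sum>i\<in>{k<..<n}. X i \<omega>)"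
        using sum.union_disjoint[of "{..k}" "{k<..<n}" "\<lambda>i. X i \<omega>"] by (simp add: lessThan_Suc_atMost disjoint_iff)
      then show ?thesis unfolding tele by simp
    qed
    show "1 / 2 \<le> prob {\<omega> \<in> space M. - 0 \<le> (\<Sum>i\<in>{k<..<n}. X i \<omega>)}"
    proof (cases "Suc k = n")
      case True
      then show ?thesis unfolding eq by (simp add: prob_space)
    next
      case False
      then have lt: "t (Suc k) < t n" using k by (intro tstrict) auto
      have "prob {\<omega> \<in> space M. B (t n) \<omega> - B (t (Suc k)) \<omega> \<in> {..0}} = measure (gauss (t n - t (Suc k))) {..0}"
        by (rule prob_increment[OF tpos lt]) auto
      then show ?thesis using measure_gauss_half(1)[of "t n - t (Suc k)"] lt unfolding eq by simp
    qed
  qed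
  also have "prob {\<omega> \<in> space M. 2 * a \<le> (\<Sum>i<n. X i \<omega>)} = prob {\<omega> \<in> space M. B (u + h) \<omega> - B u \<omega> \<in> {..- (2 * a)}}"
    unfolding tele tn by (rule arg_cong[where f = prob]) auto
  also have "\<dots> = measure (gauss h) {2 * a..}"
    using prob_increment[of u "u + h" "{..- (2 * a)}"] u h by (simp add: measure_gauss_neg)
  finally have low: "prob {\<omega> \<in> space M. \<exists>k<n. 2 * a \<le> (\<Sum>i\<le>k. X i \<omega>)} \<le> 2 * measure (gauss h) {2 * a..}"
    by simp
  have up: "prob {\<omega> \<in> space M. a \<le> B (u + h) \<omega> - B u \<omega>} = measure (gauss h) {a..}"
    using prob_increment[of u "u + h" "{a..}"] u h by simp
  let ?U = "{\<omega> \<in> space M. a \<le> B (u + h) \<omega> - B u \<omega>}" and ?L = "{\<omega> \<in> space M. \<exists>k<n. 2 * a \<le> (\<Sum>i\<le>k. X i \<omega>)}"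
  have Xm: "X k \<in> borel_measurable M" for k
    unfolding X_def by (intro borel_measurable_uminus measurable_increment tpos)
  have U: "?U \<in> events"
  proof -
    have "(\<lambda>\<omega>. B (u + h) \<omega> - B u \<omega>) \<in> borel_measurable M" using u h by (intro measurable_increment) auto
    then show ?thesis by (simp only: borel_measurable_iff_ge)
  qed
  have L: "?L \<in> events"
  proof -
    have "?L = (\<Union>k<n. {\<omega> \<in> space M. 2 * a \<le> (\<Sum>i\<le>k. X i \<omega>)})" by auto
    also have "\<dots> \<in> events"
    proof (rule sets.finite_UN)
      fix k
      have "(\<lambda>\<omega>. \<Sum>i\<le>k. X i \<omega>) \<in> borel_measurable M" by (intro borel_measurable_sum Xm)
      then show "{\<omega> \<in> space M. 2 * a \<le> (\<Sum>i\<le>k. X i \<omega>)} \<in> events" by (simp only: borel_measurable_iff_ge)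
    qed simp
    finally show ?thesis .
  qed
  have key: "2 * a \<le> (\<Sum>i\<le>k. X i \<omega>) \<longleftrightarrow> \<not> - (2 * a) < B (t (Suc k)) \<omega> - B u \<omega>" for k \<omega>
    unfolding lessThan_Suc_atMost[symmetric] tele by (simp only: not_less) linarith
  have "measure (gauss h) {a..} - 2 * measure (gauss h) {2 * a..} \<le> prob ?U - prob ?L" using low up by simp
  also have "\<dots> \<le> prob (?U - ?L)"
  proof -
    have diff: "prob A - prob C \<le> prob (A - C)" if "A \<in> events" "C \<in> events" for A C
      using finite_measure_Diff'[OF that] finite_measure_mono[of "A \<inter> C" C] that by simp
    show ?thesis by (rule diff[OF U L])
  qed
  also have "?U - ?L = {\<omega> \<in> space M. (\<forall>k<n. - (2 * a) < B (t (Suc k)) \<omega> - B u \<omega>) \<and> a \<le> B (u + h) \<omega> - B u \<omega>}"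
    using key by (intro set_eqI) (simp only: Diff_iff mem_Collect_eq, metis)
  finally show ?thesis .
qed

text \<open>The interval \<open>[0, K h]\<close> is cut into \<open>K\<close> blocks of length \<open>h\<close>, each with \<open>n\<close> grid steps.\<close>

lemma blocks_lower_bound:
  assumes h: "0 < h" and n: "0 < n" and a: "0 < a" and K: "0 < K"
    and \<rho>: "\<rho> \<le> measure (gauss h) {a..} - 2 * measure (gauss h) {2 * a..}" "0 \<le> \<rho>"
  shows "\<rho> ^ K \<le> prob {\<omega> \<in> space M. \<forall>i<K. \<forall>k<n.
    real i * a - 2 * a < B (real i * h + real (Suc k) * h / real n) \<omega> - B 0 \<omega>}"
proof -
  define t where "t k = real k * h / real n" for k :: nat
  have tmono: "t i \<le> t j" if "i \<le> j" for i j
    using that h by (auto simp: t_def intro!: divide_right_mono mult_right_mono)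
  have tpos: "0 \<le> t k" for k using h by (auto simp: t_def)
  have tblock: "t (i * n + k) = real i * h + real k * h / real n" for i k
    using n by (simp add: t_def field_simps)
  define X where "X k \<omega> = B (t (Suc k)) \<omega> - B (t k) \<omega>" for k \<omega>
  have ind: "indep_vars (\<lambda>_. borel) X {..<K * n}"
    unfolding X_def by (rule independent_increments) (use tpos tmono in auto)
  \<comment> \<open>The indices of the increments in block \<open>i\<close>. Distinct blocks use
    disjoint index sets, so their events are independent.\<close>
  define J where "J i = {i * n..<Suc i * n}" for i
  have tele: "(\<Sum>l\<in>{i * n..<i * n + k}. X l \<omega>) = B (real i * h + real k * h / real n) \<omega> - B (real i * h) \<omega>" for i k \<omega>
    using sum_Suc_diff'[of "i * n" "i * n + k" "\<lambda>l. B (t l) \<omega>"] tblock[of i 0] by (simp add: X_def tblock)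
  let ?P = "\<lambda>i. PiM (J i) (\<lambda>_. borel :: real measure)"
  define E where "E i = {f \<in> space (?P i). (\<forall>k\<in>{..<n}. - (2 * a) < (\<Sum>l\<in>{i * n..<i * n + Suc k}. f l)) \<and> a \<le> (\<Sum>l\<in>{i * n..<i * n + n}. f l)}" for i
  have Esets: "E i \<in> sets (?P i)" for i
  proof -
    have sm[measurable]: "(\<lambda>f. \<Sum>l\<in>{i * n..<i * n + k}. f l) \<in> borel_measurable (?P i)" if "k \<le> n" for k
      using that by (intro borel_measurable_sum measurable_component_singleton) (auto simp: J_def)
    have [measurable]: "(\<lambda>f. \<Sum>l\<in>{i * n..<i * n + Suc k}. f l) \<in> borel_measurable (?P i)" if "k \<in> {..<n}" for k
      using that by (intro sm) auto
    show ?thesis unfolding E_def by measurable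
  qed
  let ?R = "\<lambda>i \<omega>. restrict (\<lambda>l. X l \<omega>) (J i)"
  have R: "?R i \<omega> \<in> E i \<longleftrightarrow> (\<forall>k<n. - (2 * a) < B (real i * h + real (Suc k) * h / real n) \<omega> - B (real i * h) \<omega>)
      \<and> a \<le> B (real i * h + h) \<omega> - B (real i * h) \<omega>" for i \<omega>
  proof -
    have "(\<Sum>l\<in>{i * n..<i * n + k}. ?R i \<omega> l) = B (real i * h + real k * h / real n) \<omega> - B (real i * h) \<omega>" if "k \<le> n" for k
      unfolding tele[symmetric] using that by (intro sum.cong) (auto simp: J_def)
    from this[of n] this[of "Suc _"] show ?thesis using n by (simp add: E_def space_PiM Ball_def Suc_le_eq del: of_nat_Suc)
  qed
  have indR: "indep_vars ?P ?R {..<K}"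
  proof (rule indep_vars_restrict[OF ind])
    fix i assume "i \<in> {..<K}"
    then have "Suc i * n \<le> K * n" by (intro mult_le_mono1) auto
    then show "J i \<subseteq> {..<K * n}" by (auto simp: J_def)
  next
    have "J i \<inter> J j = {}" if "i < j" for i j
    proof -
      have "Suc i * n \<le> j * n" using that by (intro mult_le_mono1) auto
      then show ?thesis unfolding J_def by auto
    qed
    then show "disjoint_family_on J {..<K}"
      unfolding disjoint_family_on_def by (metis Int_commute linorder_neqE_nat)
  qed
  have "\<rho> ^ K = (\<Prod>i<K. \<rho>)" by simp
  also have "\<dots> \<le> (\<Prod>i<K. prob (?R i -` E i \<inter> space M))"
  proof (rule prod_mono, safe)
    fix i
    have "?R i -` E i \<inter> space M = {\<omega> \<in> space M. (\<forall>k<n. - (2 * a) < B (real i * h + real (Suc k) * h / real n) \<omega> - B (real i * h) \<omega>)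
      \<and> a \<le> B (real i * h + h) \<omega> - B (real i * h) \<omega>}"
      using R by blast
    then show "\<rho> \<le> prob (?R i -` E i \<inter> space M)"
      using block_event_lower_bound[of "real i * h" h n a] h n a \<rho> by simp
  qed (use \<rho> in auto)
  also have "\<dots> = prob (\<Inter>i<K. ?R i -` E i \<inter> space M)"
    by (rule indep_varsD_finite[OF indR, symmetric]) (use K Esets in auto)
  also have "\<dots> \<le> prob {\<omega> \<in> space M. \<forall>i<K. \<forall>k<n.
    real i * a - 2 * a < B (real i * h + real (Suc k) * h / real n) \<omega> - B 0 \<omega>}"
  proof (rule finite_measure_mono)
    show "(\<Inter>i<K. ?R i -` E i \<inter> space M) \<subseteq> {\<omega> \<in> space M. \<forall>i<K. \<forall>k<n.
      real i * a - 2 * a < B (real i * h + real (Suc k) * h / real n) \<omega> - B 0 \<omega>}"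
    proof
      fix \<omega> assume \<omega>: "\<omega> \<in> (\<Inter>i<K. ?R i -` E i \<inter> space M)"
      have Ei: "?R i \<omega> \<in> E i" "\<omega> \<in> space M" if "i < K" for i
      proof -
        have "\<omega> \<in> ?R i -` E i \<inter> space M" using \<omega> that by (simp only: INT_iff lessThan_iff)
        then show "?R i \<omega> \<in> E i" "\<omega> \<in> space M" by blast+
      qed
      \<comment> \<open>Every block raises the path by at least \<open>a\<close>, so the dips inside
        block \<open>i\<close> start from a height of at least \<open>i * a\<close>.\<close>
      have climb: "real i * a \<le> B (real i * h) \<omega> - B 0 \<omega>" if "i \<le> K" for i
        using that
      proof (induction i)
        case (Suc i)
        then have "a \<le> B (real i * h + h) \<omega> - B (real i * h) \<omega>" using Ei(1)[of i] R[of \<omega> i] by auto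
        moreover have "real (Suc i) * h = real i * h + h" by (simp add: algebra_simps)
        ultimately show ?case using Suc by (simp add: algebra_simps)
      qed simp
      have "real i * a - 2 * a < B (real i * h + real (Suc k) * h / real n) \<omega> - B 0 \<omega>" if "i < K" "k < n" for i k
      proof -
        have "- (2 * a) < B (real i * h + real (Suc k) * h / real n) \<omega> - B (real i * h) \<omega>"
          using Ei(1)[OF that(1)] R[of \<omega> i] that(2) by blast
        then show ?thesis using climb[of i] that by simp
      qed
      then show "\<omega> \<in> {\<omega> \<in> space M. \<forall>i<K. \<forall>k<n.
        real i * a - 2 * a < B (real i * h + real (Suc k) * h / real n) \<omega> - B 0 \<omega>}"
        using Ei(2)[OF K] by blast
    qed
    have "{\<omega> \<in> space M. \<forall>i<K. \<forall>k<n. real i * a - 2 * a < B (real i * h + real (Suc k) * h / real n) \<omega> - B 0 \<omega>}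
      = {\<omega> \<in> space M. \<forall>i\<in>{..<K}. \<forall>k\<in>{..<n}. real i * a - 2 * a < B (real i * h + real (Suc k) * h / real n) \<omega> - B 0 \<omega>}"
      by auto
    also have "\<dots> \<in> events"
    proof -
      have [measurable]: "(\<lambda>\<omega>. B (real i * h + real (Suc k) * h / real n) \<omega> - B 0 \<omega>) \<in> borel_measurable M" for i k
        using h by (intro measurable_increment) auto
      show ?thesis by measurable
    qed
    finally show "{\<omega> \<in> space M. \<forall>i<K. \<forall>k<n. real i * a - 2 * a < B (real i * h + real (Suc k) * h / real n) \<omega> - B 0 \<omega>} \<in> events" .
  qed
  finally show ?thesis .
qed

text \<open>The barrier stays below \<open>e / 4\<close> up to some time \<open>c\<close> and never
  exceeds \<open>H\<close>. A path that gains \<open>a\<close> in every short block and dips by at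
  most \<open>2 * a\<close> in between has climbed to height \<open>H\<close> by the time
  \<open>c\<close>. Finitely many independent blocks make this an event of positive
  probability.\<close>

lemma stays_above_pos_prob:
  assumes L: "mono_on {0..} L" "cadlag L" "L 0 = 0" and e: "0 < e" and T: "0 \<le> T"
  obtains A where "A \<in> events" "0 < prob A" "\<And>\<omega> s. \<omega> \<in> A \<Longrightarrow> 0 \<le> s \<Longrightarrow> s \<le> T \<Longrightarrow> L s < e + B s \<omega>"
proof -
  \<comment> \<open>The dip \<open>2 * a = e / 4\<close> and the early height \<open>e / 4\<close>
    of the barrier use up \<open>e / 2\<close>; the other half restores strictness after the limit
    over grid times.\<close>
  define a where "a = e / 8"
  have a: "0 < a" using e by (simp add: a_def)
  \<comment> \<open>Grid points approach \<open>s \<le> T\<close> from the right and may pass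
    \<open>T\<close>, but they stay within \<open>[0, T']\<close>. The extra length also covers
    \<open>T = 0\<close>.\<close>
  define T' where "T' = T + 1"
  have T': "0 < T'" "T < T'" using T by (auto simp: T'_def)
  define H where "H = L T'"
  have Lmono: "L s \<le> L t" if "0 \<le> s" "s \<le> t" for s t using that by (intro mono_onD[OF L(1)]) auto
  have H: "0 \<le> H" using Lmono[of 0 T'] T' L(3) by (simp add: H_def)
  have "\<forall>\<^sub>F u in at_right 0. L u < e / 4"
    by (rule order_tendstoD(2)[OF cadlag_right[OF L(2)]]) (use L(3) e in auto)
  then obtain c where c: "c > 0" "\<And>u. 0 < u \<Longrightarrow> u < c \<Longrightarrow> L u < e / 4"
    unfolding eventually_at_right_field by auto
  \<comment> \<open>The first bound is what \<open>measure_gauss_double_tail\<close> asks of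
    \<open>h\<close>. The second ensures that a block reaching beyond \<open>c\<close> has index at
    least \<open>H / a\<close>, hence starts at height at least \<open>H\<close>.\<close>
  define \<delta> where "\<delta> = min (a\<^sup>2 / 2) (c / (H / a + 1))"
  have "0 < H / a + 1" using H a by (simp add: add_nonneg_pos)
  then have \<delta>: "0 < \<delta>" using a c by (simp add: \<delta>_def)
  obtain K where K: "T' / \<delta> < real K" using reals_Archimedean2 by blast
  have K0: "0 < K" using K T' \<delta> by (metis divide_pos_pos less_trans of_nat_0_less_iff)
  define h where "h = T' / real K"
  have h: "0 < h" using T' K0 by (simp add: h_def)
  have "h \<le> \<delta>" using K K0 \<delta> by (simp add: h_def field_simps)
  then have ha: "h \<le> a\<^sup>2 / 2" and hc: "h * (H / a + 1) \<le> c"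
    using \<open>0 < H / a + 1\<close> by (auto simp: \<delta>_def pos_le_divide_eq)
  define \<rho> where "\<rho> = measure (gauss h) {a..} - 2 * measure (gauss h) {2 * a..}"
  have \<rho>: "0 < \<rho>" unfolding \<rho>_def using measure_gauss_double_tail[OF h ha a] by simp
  let ?pt = "\<lambda>m i k. real i * h + real (Suc k) * h / real (2 ^ m)"
  define G where "G m = {\<omega> \<in> space M. \<forall>i<K. \<forall>k<2 ^ m. real i * a - 2 * a < B (?pt m i k) \<omega> - B 0 \<omega>}" for m :: nat
  have Gp: "\<rho> ^ K \<le> prob (G m)" for m
    unfolding G_def by (rule blocks_lower_bound[OF h _ a K0]) (use \<rho> in \<open>auto simp: \<rho>_def\<close>)
  have Gm: "G m \<in> events" for m
    using Gp[of m] \<rho> measure_notin_sets[of "G m" M] by (metis not_le zero_less_power)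
  \<comment> \<open>The dyadic grids are nested and the lower bound \<open>\<rho> ^ K\<close> is the
    same for all of them, so it passes to the intersection.\<close>
  have Gdec: "decseq G"
  proof (rule decseq_SucI, rule subsetI)
    fix m \<omega> assume \<omega>: "\<omega> \<in> G (Suc m)"
    have "real i * a - 2 * a < B (?pt m i k) \<omega> - B 0 \<omega>" if "i < K" "k < 2 ^ m" for i k
    proof -
      have "?pt m i k = ?pt (Suc m) i (2 * k + 1)" by (simp add: field_simps)
      moreover have "2 * k + 1 < 2 ^ Suc m" using that by simp
      ultimately show ?thesis using \<omega> that unfolding G_def by (simp only: mem_Collect_eq)
    qed
    then show "\<omega> \<in> G m" using \<omega> unfolding G_def by (simp only: mem_Collect_eq) blast
  qed
  have "(\<lambda>m. prob (G m)) \<longlonglongrightarrow> prob (\<Inter>m. G m)"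
    by (rule finite_Lim_measure_decseq[OF _ Gdec]) (use Gm in auto)
  then have GI: "\<rho> ^ K \<le> prob (\<Inter>m. G m)"
    by (rule LIMSEQ_le_const) (use Gp in auto)
  define A where "A = (\<Inter>m. G m) \<inter> {\<omega> \<in> space M. B 0 \<omega> = 0}"
  have I_ev: "(\<Inter>m. G m) \<in> events" using Gm by (intro sets.countable_INT') auto
  have B0_ev: "{\<omega> \<in> space M. B 0 \<omega> = 0} \<in> events"
  proof -
    have "B 0 \<in> borel_measurable M" by (rule measurable) simp
    from measurable_sets[OF this, of "{0}"] show ?thesis by (simp add: vimage_def Int_def conj_commute)
  qed
  have A_ev: "A \<in> events" unfolding A_def using I_ev B0_ev by (rule sets.Int)
  have "prob (\<Inter>m. G m) = prob A"
  proof (rule finite_measure_eq_AE[OF _ I_ev A_ev])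
    show "AE \<omega> in M. (\<omega> \<in> (\<Inter>m. G m)) = (\<omega> \<in> A)"
      using starts_at_0 by eventually_elim (auto simp: A_def G_def)
  qed
  then have "0 < prob A" using GI \<rho> by (metis less_le_trans zero_less_power)
  moreover have "L s < e + B s \<omega>" if \<omega>: "\<omega> \<in> A" and s: "0 \<le> s" "s \<le> T" for \<omega> s
  proof (cases "s = 0")
    case True
    then show ?thesis using \<omega> L(3) e by (simp add: A_def)
  next
    case False
    then have s0: "0 < s" using s by simp
    have B0: "B 0 \<omega> = 0" and sp: "\<omega> \<in> space M" using \<omega> by (auto simp: A_def)
    \<comment> \<open>Rounding up puts the grid time \<open>q m\<close> to the right of
      \<open>s\<close>, where \<open>L s \<le> L (q m)\<close> by monotonicity; only the continuous
      \<open>B\<close> needs a limit.\<close>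
    define j where "j m = nat \<lceil>s * 2 ^ m / h\<rceil>" for m
    define q where "q m = real (j m) * h / 2 ^ m" for m
    have jb: "s * 2 ^ m / h \<le> real (j m)" "real (j m) < s * 2 ^ m / h + 1" for m
    proof -
      have "0 \<le> s * 2 ^ m / h" using s0 h by simp
      then show "s * 2 ^ m / h \<le> real (j m)" "real (j m) < s * 2 ^ m / h + 1"
        unfolding j_def by linarith+
    qed
    have q1: "s \<le> q m" for m using jb(1)[of m] h by (simp add: q_def field_simps)
    have q2: "q m \<le> s + h * (1 / 2) ^ m" for m
    proof -
      have "real (j m) * h / 2 ^ m \<le> (s * 2 ^ m / h + 1) * h / 2 ^ m"
        using jb(2)[of m] h by (intro divide_right_mono mult_right_mono) auto
      also have "\<dots> = s + h * (1 / 2) ^ m" using h by (simp add: field_simps power_divide)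
      finally show ?thesis by (simp add: q_def)
    qed
    have qlim: "q \<longlonglongrightarrow> s"
    proof (rule tendsto_sandwich[of "\<lambda>_. s" q sequentially "\<lambda>m. s + h * (1 / 2) ^ m"])
      have "(\<lambda>m. s + h * (1 / 2) ^ m) \<longlonglongrightarrow> s + h * 0"
        by (intro tendsto_intros LIMSEQ_power_zero) auto
      then show "(\<lambda>m. s + h * (1 / 2) ^ m) \<longlonglongrightarrow> s" by simp
    qed (use q1 q2 in auto)
    have "L s - e / 2 \<le> B (q m) \<omega>" for m
    proof -
      have j0: "0 < j m" 
      proof -
        have "0 < s * 2 ^ m / h" using s0 h by simp
        then have "0 < real (j m)" using jb(1)[of m] by linarith
        then show ?thesis by simp
      qed
      \<comment> \<open>A block owns its right end but not its left end, hence the index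
        \<open>j m - 1\<close>.\<close>
      define i where "i = (j m - 1) div 2 ^ m"
      define k where "k = (j m - 1) mod 2 ^ m"
      have k: "k < 2 ^ m" by (simp add: k_def)
      have jeq: "j m = i * 2 ^ m + k + 1"
        using j0 div_mult_mod_eq[of "j m - 1" "2 ^ m"] by (simp add: i_def k_def)
      have pt: "?pt m i k = q m" by (simp add: q_def jeq field_simps)
      have Kh: "real K * h = T'" using K0 by (simp add: h_def)
      have "s * 2 ^ m / h < real K * 2 ^ m"
      proof -
        have "s * 2 ^ m < T' * 2 ^ m" using s T' by simp
        then show ?thesis using h Kh by (simp add: field_simps)
      qed
      then have "s * 2 ^ m / h \<le> real (K * 2 ^ m)" by simp
      then have "\<lceil>s * 2 ^ m / h\<rceil> \<le> int (K * 2 ^ m)" by (intro ceiling_le) simp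
      then have jK: "j m \<le> K * 2 ^ m" unfolding j_def by (simp only: nat_le_iff)
      then have "i * 2 ^ m < K * 2 ^ m" using jeq by linarith
      then have iK: "i < K" by simp
      have qT: "q m \<le> T'"
      proof -
        have "real (j m) * h / 2 ^ m \<le> real (K * 2 ^ m) * h / 2 ^ m"
          using jK h by (intro divide_right_mono mult_right_mono) (simp_all only: of_nat_le_iff, auto)
        then show ?thesis using Kh by (simp add: q_def)
      qed
      have "\<omega> \<in> G m" using \<omega> by (auto simp: A_def)
      then have "real i * a - 2 * a < B (?pt m i k) \<omega> - B 0 \<omega>"
        unfolding G_def mem_Collect_eq using iK k by blast
      then have lower: "real i * a - 2 * a < B (q m) \<omega>"
        by (simp only: pt B0 diff_zero)
      have "L (q m) \<le> real i * a - 2 * a + e / 2"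
      proof (cases "q m < c")
        case True
        then have "L (q m) < e / 4" using c(2)[of "q m"] q1[of m] s0 by simp
        moreover have "0 \<le> real i * a" using a by simp
        ultimately show ?thesis by (simp add: a_def)
      next
        case False
        have "q m \<le> (real i + 1) * h"
        proof -
          have "real (Suc k) \<le> real (2 ^ m)" using k by (simp only: of_nat_le_iff Suc_le_eq)
          then have "real (Suc k) * h \<le> real (2 ^ m) * h" using h by (intro mult_right_mono) auto
          moreover have "0 < real (2 ^ m)" by simp
          ultimately have "real (Suc k) * h / real (2 ^ m) \<le> h" by (simp only: pos_divide_le_eq mult.commute)
          then show ?thesis unfolding pt[symmetric] by (simp add: algebra_simps)
        qed
        then have "h * (H / a + 1) \<le> (real i + 1) * h" using hc False by linarith
        then have "H / a + 1 \<le> real i + 1" using h by (simp add: mult.commute)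
        then have "H \<le> real i * a" using a by (simp add: field_simps)
        moreover have "L (q m) \<le> H" unfolding H_def using qT q1[of m] s0 by (intro Lmono) auto
        ultimately show ?thesis using e by (simp add: a_def)
      qed
      then show ?thesis using lower Lmono[OF s(1) q1[of m]] by linarith
    qed
    moreover have "(\<lambda>m. B (q m) \<omega>) \<longlonglongrightarrow> B s \<omega>"
      by (rule continuous_on_tendsto_compose[OF continuous_paths[OF sp] qlim]) (auto intro!: always_eventually order_trans[OF s(1) q1] simp: s)
    ultimately have "L s - e / 2 \<le> B s \<omega>" by (intro LIMSEQ_le_const) auto
    then show ?thesis using e by simp
  qed
  ultimately show ?thesis using that A_ev by blast
qed

section \<open>Uniqueness of the Brownian path law\<close>

lemma distr_increments:
  assumes n: "0 < n" and s: "0 \<le> s 0" "\<And>k. k < n \<Longrightarrow> s k < s (Suc k)"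
  shows "distr M (PiM {..<n} (\<lambda>_. borel)) (\<lambda>\<omega>. \<lambda>k\<in>{..<n}. B (s (Suc k)) \<omega> - B (s k) \<omega>)
    = PiM {..<n} (\<lambda>k. gauss (s (Suc k) - s k))"
proof -
  have spos: "0 \<le> s k" if "k \<le> n" for k
    using that
  proof (induction k)
    case (Suc k)
    then show ?case using s(2)[of k] by simp
  qed (use s in simp)
  have "indep_vars (\<lambda>_. borel) (\<lambda>k \<omega>. B (s (Suc k)) \<omega> - B (s k) \<omega>) {..<n}"
    by (rule independent_increments) (use s in \<open>auto intro: less_imp_le\<close>)
  then have "distr M (PiM {..<n} (\<lambda>_. borel)) (\<lambda>\<omega>. \<lambda>k\<in>{..<n}. B (s (Suc k)) \<omega> - B (s k) \<omega>)
    = PiM {..<n} (\<lambda>k. distr M borel (\<lambda>\<omega>. B (s (Suc k)) \<omega> - B (s k) \<omega>))"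
    by (subst (asm) indep_vars_iff_distr_eq_PiM') (use n spos in \<open>auto intro!: measurable_increment\<close>)
  also have "\<dots> = PiM {..<n} (\<lambda>k. gauss (s (Suc k) - s k))"
    by (rule PiM_cong) (use s spos in \<open>auto intro!: distr_increment\<close>)
  finally show ?thesis .
qed

text \<open>Almost surely the values at the points of \<open>xs\<close> are partial sums of
  independent Gaussian increments from 0. The point of this form is that the right-hand side no
  longer mentions the motion or its probability space.\<close>

lemma emeasure_finite_dim:
  fixes xs :: "real list"
  assumes xs: "sorted_wrt (<) xs" "length xs = Suc n" "xs ! 0 = 0" "0 < n" and J: "J \<subseteq> set xs"
    and A: "\<And>j. j \<in> J \<Longrightarrow> A j \<in> sets borel"
  shows "emeasure M {\<omega> \<in> space M. \<forall>j\<in>J. B j \<omega> \<in> A j}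
    = emeasure (PiM {..<n} (\<lambda>k. gauss (xs ! Suc k - xs ! k)))
        {x \<in> space (PiM {..<n} (\<lambda>_. borel)). \<forall>k\<in>{..n}. xs ! k \<in> J \<longrightarrow> (\<Sum>i<k. x i) \<in> A (xs ! k)}"
proof -
  let ?P = "PiM {..<n} (\<lambda>_. borel :: real measure)"
  let ?E = "{x \<in> space ?P. \<forall>k\<in>{..n}. xs ! k \<in> J \<longrightarrow> (\<Sum>i<k. x i) \<in> A (xs ! k)}"
  let ?I = "\<lambda>\<omega>. \<lambda>k\<in>{..<n}. B (xs ! Suc k) \<omega> - B (xs ! k) \<omega>"
  have xs0: "0 \<le> xs ! k" if "k \<le> n" for k
    using sorted_wrt_nth_less[OF xs(1), of 0 k] that xs(2,3) by (cases "k = 0") auto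
  have Bm: "B (xs ! k) \<in> borel_measurable M" if "k \<le> n" for k
    by (rule measurable[OF xs0[OF that]])
  have Esets: "?E \<in> sets ?P"
  proof -
    have "{x \<in> space ?P. xs ! k \<in> J \<longrightarrow> (\<Sum>i<k. x i) \<in> A (xs ! k)} \<in> sets ?P" if "k \<in> {..n}" for k
    proof (cases "xs ! k \<in> J")
      case True
      have "(\<lambda>x. \<Sum>i<k. x i) \<in> borel_measurable ?P"
        using that by (intro borel_measurable_sum measurable_component_singleton) auto
      from measurable_sets[OF this A[OF True]] show ?thesis
        using True by (simp add: vimage_def Int_def conj_commute)
    qed simp
    then show ?thesis by (intro sets.sets_Collect_finite_All) simp_all
  qed
  have Im: "?I \<in> measurable M ?P"
    by (intro measurable_restrict borel_measurable_diff Bm) auto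
  have "emeasure M {\<omega> \<in> space M. \<forall>j\<in>J. B j \<omega> \<in> A j} = emeasure M (?I -` ?E \<inter> space M)"
  proof (rule emeasure_eq_AE)
    show "AE \<omega> in M. (\<omega> \<in> {\<omega> \<in> space M. \<forall>j\<in>J. B j \<omega> \<in> A j}) = (\<omega> \<in> ?I -` ?E \<inter> space M)"
      using starts_at_0
    proof eventually_elim
      case (elim \<omega>)
      have tele: "(\<Sum>i<k. ?I \<omega> i) = B (xs ! k) \<omega>" if "k \<le> n" for k
      proof -
        have "(\<Sum>i<k. ?I \<omega> i) = (\<Sum>i<k. B (xs ! Suc i) \<omega> - B (xs ! i) \<omega>)"
          by (rule sum.cong) (use that in auto)
        then show ?thesis using sum_lessThan_telescope[of "\<lambda>i. B (xs ! i) \<omega>" k] xs(3) elim by simp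
      qed
      have "(\<forall>j\<in>J. B j \<omega> \<in> A j) \<longleftrightarrow> (\<forall>k\<in>{..n}. xs ! k \<in> J \<longrightarrow> B (xs ! k) \<omega> \<in> A (xs ! k))"
      proof
        assume R: "\<forall>k\<in>{..n}. xs ! k \<in> J \<longrightarrow> B (xs ! k) \<omega> \<in> A (xs ! k)"
        show "\<forall>j\<in>J. B j \<omega> \<in> A j"
        proof
          fix j assume "j \<in> J"
          then have "j \<in> set xs" using J by blast
          then obtain k where k: "k < length xs" "xs ! k = j" by (auto simp: in_set_conv_nth)
          then have "k \<in> {..n}" using xs(2) by simp
          with R have "xs ! k \<in> J \<longrightarrow> B (xs ! k) \<omega> \<in> A (xs ! k)" by blast
          then show "B j \<omega> \<in> A j" using \<open>j \<in> J\<close> by (simp add: k(2))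
        qed
      qed blast
      moreover have "?I \<omega> \<in> ?E \<longleftrightarrow> (\<forall>k\<in>{..n}. xs ! k \<in> J \<longrightarrow> B (xs ! k) \<omega> \<in> A (xs ! k))"
      proof -
        have "?I \<omega> \<in> space ?P" by (simp add: space_PiM)
        then show ?thesis using tele by (simp only: mem_Collect_eq) simp
      qed
      ultimately show ?case by blast
    qed
    show "?I -` ?E \<inter> space M \<in> sets M" by (rule measurable_sets[OF Im Esets])
    have "finite J" using J by (rule finite_subset) simp
    have "{\<omega> \<in> space M. B j \<omega> \<in> A j} \<in> sets M" if "j \<in> J" for j
    proof -
      have "j \<in> set xs" using J that by blast
      then obtain k where "k < length xs" "xs ! k = j" by (auto simp: in_set_conv_nth)
      then have "B j \<in> borel_measurable M" using Bm[of k] xs(2) by auto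
      from measurable_sets[OF this A[OF that]] show ?thesis by (simp add: vimage_def Int_def conj_commute)
    qed
    then show "{\<omega> \<in> space M. \<forall>j\<in>J. B j \<omega> \<in> A j} \<in> sets M"
      using \<open>finite J\<close> by (intro sets.sets_Collect_finite_All) simp_all
  qed
  also have "\<dots> = emeasure (distr M ?P ?I) ?E"
    by (rule emeasure_distr[OF Im Esets, symmetric])
  also have "distr M ?P ?I = PiM {..<n} (\<lambda>k. gauss (xs ! Suc k - xs ! k))"
    by (rule distr_increments) (use xs sorted_wrt_nth_less[OF xs(1)] in auto)
  finally show ?thesis .
qed

lemma measurable_path: "(\<lambda>\<omega>. \<lambda>t\<in>{0..}. B t \<omega>) \<in> measurable M (PiM {0..} (\<lambda>_. borel))"
  by (intro measurable_restrict measurable) auto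

end

text \<open>The particles and the McKean-Vlasov equation use Brownian motions on different
  probability spaces. Equality of the path laws, which is checked on cylinder sets, lets hitting
  probabilities of \<open>\<beta>\<close> be used for the marks of the particles.\<close>

lemma brownian_path_law_unique:
  assumes "standard_brownian_motion M B" "standard_brownian_motion P \<beta>"
  shows "distr M (PiM {0..} (\<lambda>_. borel)) (\<lambda>\<omega>. \<lambda>t\<in>{0..}. B t \<omega>) = distr P (PiM {0..} (\<lambda>_. borel)) (\<lambda>\<omega>. \<lambda>t\<in>{0..}. \<beta> t \<omega>)"
proof (rule measure_eqI_PiM_infinite)
  interpret M: standard_brownian_motion M B by fact
  interpret P: standard_brownian_motion P \<beta> by fact
  show "finite_measure (distr M (PiM {0..} (\<lambda>_. borel)) (\<lambda>\<omega>. \<lambda>t\<in>{0..}. B t \<omega>))"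
    by (rule finite_measure.finite_measure_distr[OF _ M.measurable_path]) unfold_locales
  fix A and J :: "real set"
  assume J: "finite J" "J \<subseteq> {0..}" and A: "\<And>i. i \<in> J \<Longrightarrow> A i \<in> sets (borel :: real measure)"
  have emb: "emeasure (distr N (PiM {0..} (\<lambda>_. borel)) (\<lambda>\<omega>. \<lambda>t\<in>{0..}. X t \<omega>)) (prod_emb {0..} (\<lambda>_. borel) J (Pi\<^sub>E J A))
      = emeasure N {\<omega> \<in> space N. \<forall>j\<in>J. X j \<omega> \<in> A j}"
    if "(\<lambda>\<omega>. \<lambda>t\<in>{0..}. X t \<omega>) \<in> measurable N (PiM {0..} (\<lambda>_. borel))" for N and X :: "real \<Rightarrow> _ \<Rightarrow> real"
  proof -
    have "prod_emb {0..} (\<lambda>_. borel) J (Pi\<^sub>E J A) \<in> sets (PiM {0..} (\<lambda>_. borel :: real measure))"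
      by (rule sets_PiM_I[OF J]) (use A in auto)
    then have "emeasure (distr N (PiM {0..} (\<lambda>_. borel)) (\<lambda>\<omega>. \<lambda>t\<in>{0..}. X t \<omega>)) (prod_emb {0..} (\<lambda>_. borel) J (Pi\<^sub>E J A))
      = emeasure N ((\<lambda>\<omega>. \<lambda>t\<in>{0..}. X t \<omega>) -` prod_emb {0..} (\<lambda>_. borel) J (Pi\<^sub>E J A) \<inter> space N)"
      by (rule emeasure_distr[OF that])
    also have "(\<lambda>\<omega>. \<lambda>t\<in>{0..}. X t \<omega>) -` prod_emb {0..} (\<lambda>_. borel) J (Pi\<^sub>E J A) \<inter> space N = {\<omega> \<in> space N. \<forall>j\<in>J. X j \<omega> \<in> A j}"
      using J(2) by (auto simp: prod_emb_def PiE_iff restrict_def extensional_def split: if_splits)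
    finally show ?thesis .
  qed
  \<comment> \<open>The point 0 anchors the increments, and the point 1 guarantees at least one
    increment even if \<open>J\<close> is empty or \<open>{0}\<close>.\<close>
  define xs where "xs = sorted_list_of_set (J \<union> {0, 1})"
  have fin: "finite (J \<union> {0, 1})" using J by simp
  have set_xs: "set xs = J \<union> {0, 1}" unfolding xs_def by (rule set_sorted_list_of_set[OF fin])
  have sorted: "sorted_wrt (<) xs" by (simp add: xs_def)
  have len: "length xs = card (J \<union> {0, 1})"
    using distinct_card[of xs] strict_sorted_iff[of xs] sorted unfolding set_xs by metis
  have "card {0, 1 :: real} \<le> card (J \<union> {0, 1})" using fin by (intro card_mono) auto
  then have len2: "2 \<le> length xs" using len by simp
  then obtain n where n: "length xs = Suc n" "0 < n" by (cases "length xs") auto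
  have "xs ! 0 = 0"
  proof -
    have "0 \<in> set xs" by (simp add: set_xs)
    then obtain k where k: "k < length xs" "xs ! k = 0" by (auto simp: in_set_conv_nth)
    have "xs ! 0 \<in> set xs" using n by simp
    then have "0 \<le> xs ! 0" using J(2) by (auto simp: set_xs)
    then show ?thesis using k sorted_wrt_nth_less[OF sorted, of 0 k] by (cases "k = 0") auto
  qed
  note * = sorted n(1) this n(2)
  have J': "J \<subseteq> set xs" unfolding set_xs by blast
  show "emeasure (distr M (PiM {0..} (\<lambda>_. borel)) (\<lambda>\<omega>. \<lambda>t\<in>{0..}. B t \<omega>)) (prod_emb {0..} (\<lambda>_. borel) J (Pi\<^sub>E J A))
    = emeasure (distr P (PiM {0..} (\<lambda>_. borel)) (\<lambda>\<omega>. \<lambda>t\<in>{0..}. \<beta> t \<omega>)) (prod_emb {0..} (\<lambda>_. borel) J (Pi\<^sub>E J A))"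
    unfolding emb[OF M.measurable_path] emb[OF P.measurable_path]
    by (simp only: M.emeasure_finite_dim[OF * J' A] P.emeasure_finite_dim[OF * J' A])
qed simp_all

section \<open>Comparison of the particle system with its limit\<close>

lemma Rats_between_nonneg:
  fixes s u :: real assumes "s < u" shows "\<exists>q\<in>\<rat> \<union> {t}. s < q \<and> q < u"
  using Rats_dense_in_real[OF assms] by blast

definition hits :: "(real \<Rightarrow> real) \<Rightarrow> real \<Rightarrow> real \<Rightarrow> (real \<Rightarrow> real) \<Rightarrow> bool" where
  "hits L t x b \<longleftrightarrow> (\<exists>s. 0 \<le> s \<and> s \<le> t \<and> x + b s \<le> L s)"

text \<open>Countably many coordinates of a continuous path decide whether it hits, which makes
  hitting an event of the product space.\<close>

definition hit_set :: "(real \<Rightarrow> real) \<Rightarrow> real \<Rightarrow> (real \<times> (real \<Rightarrow> real)) set" where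
  "hit_set L t = {p \<in> space (borel \<Otimes>\<^sub>M PiM {0..} (\<lambda>_. borel)).
     \<forall>n. \<exists>q\<in>{q \<in> \<rat> \<union> {t}. 0 \<le> q \<and> q \<le> t}. fst p + snd p q < L q + 1 / real (Suc n)}"

lemma hit_set_sets[measurable]: "hit_set L t \<in> sets (borel \<Otimes>\<^sub>M PiM {0..} (\<lambda>_. borel))"
proof -
  let ?Q = "{q \<in> \<rat> \<union> {t}. 0 \<le> q \<and> q \<le> t}" and ?N = "borel \<Otimes>\<^sub>M PiM {0..} (\<lambda>_. borel :: real measure) :: (real \<times> (real \<Rightarrow> real)) measure"
  have cQ: "countable ?Q" by (rule countable_subset[of _ "\<rat> \<union> {t}"]) (auto intro: countable_rat)
  have "{p \<in> space ?N. fst p + snd p q < L q + 1 / real (Suc n)} \<in> sets ?N" if "q \<in> ?Q" for q n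
  proof -
    have "(\<lambda>p. snd p q) \<in> borel_measurable ?N"
      by (rule measurable_compose[OF measurable_snd measurable_component_singleton]) (use that in auto)
    then have "(\<lambda>p. fst p + snd p q) \<in> borel_measurable ?N" by measurable
    then show ?thesis by (simp only: borel_measurable_iff_less)
  qed
  then show ?thesis
    unfolding hit_set_def by (intro sets.sets_Collect_countable_All sets.sets_Collect_countable_Ex'[OF _ cQ])
qed

lemma hit_set_path:
  assumes "continuous_on {0..} b" and L: "mono_on {0..} L" "cadlag L" and t: "0 \<le> t"
  shows "(x, \<lambda>s\<in>{0..}. b s) \<in> hit_set L t \<longleftrightarrow> hits L t x b"
proof -
  have c: "continuous_on {0..} (\<lambda>s. x + b s)" by (intro continuous_intros assms)
  have "hits L t x b \<longleftrightarrow> (\<forall>n. \<exists>q\<in>\<rat> \<union> {t}. 0 \<le> q \<and> q \<le> t \<and> x + b q < L q + 1 / real (Suc n))"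
    unfolding hits_def by (rule hit_iff_dense[OF c L]) (use Rats_between_nonneg in auto)
  also have "\<dots> \<longleftrightarrow> (\<forall>n. \<exists>q\<in>{q \<in> \<rat> \<union> {t}. 0 \<le> q \<and> q \<le> t}. x + (\<lambda>s\<in>{0..}. b s) q < L q + 1 / real (Suc n))"
  proof -
    have "(\<exists>q\<in>\<rat> \<union> {t}. 0 \<le> q \<and> q \<le> t \<and> x + b q < L q + e) \<longleftrightarrow> (\<exists>q\<in>{q \<in> \<rat> \<union> {t}. 0 \<le> q \<and> q \<le> t}. x + (\<lambda>s\<in>{0..}. b s) q < L q + e)" for e
      by (rule iffI) (elim bexE conjE, rule_tac x = q in bexI, auto)+
    then show ?thesis by simp
  qed
  finally have eq: "hits L t x b \<longleftrightarrow> \<dots>" .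
  have "(x, \<lambda>s\<in>{0..}. b s) \<in> space (borel \<Otimes>\<^sub>M PiM {0..} (\<lambda>_. borel))"
    by (simp add: space_pair_measure space_PiM)
  then show ?thesis unfolding eq hit_set_def by (simp only: mem_Collect_eq fst_conv snd_conv simp_thms)
qed

lemma hits_mono: "hits L s x b \<Longrightarrow> s \<le> t \<Longrightarrow> hits L t x b"
  unfolding hits_def by (meson order_trans)

lemma hits_antimono: "hits L t x b \<Longrightarrow> x' \<le> x \<Longrightarrow> hits L t x' b"
  unfolding hits_def by (smt (verit))

lemma hits_shift: "hits (\<lambda>s. L s + \<eta>) t x b \<longleftrightarrow> hits L t (x - \<eta>) b"
  unfolding hits_def by (simp add: algebra_simps)

section \<open>Hitting probabilities and the gain from the feedback condition\<close>

context standard_brownian_motion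
begin

definition hit_prob :: "(real \<Rightarrow> real) \<Rightarrow> real \<Rightarrow> real \<Rightarrow> real" where
  "hit_prob L t x = prob {\<omega> \<in> space M. hits L t x (\<lambda>s. B s \<omega>)}"

context
  fixes L :: "real \<Rightarrow> real"
  assumes L: "mono_on {0..} L" "cadlag L"
begin

lemma hit_event_eq:
  assumes "0 \<le> t"
  shows "{\<omega> \<in> space M. hits L t x (\<lambda>s. B s \<omega>)} = (\<lambda>\<omega>. \<lambda>s\<in>{0..}. B s \<omega>) -` (Pair x -` hit_set L t) \<inter> space M"
  using hit_set_path[OF continuous_paths L assms] by auto

lemma hit_event[measurable]: "0 \<le> t \<Longrightarrow> {\<omega> \<in> space M. hits L t x (\<lambda>s. B s \<omega>)} \<in> events"
  unfolding hit_event_eq by (rule measurable_sets[OF measurable_path sets_Pair1[OF hit_set_sets]])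

lemma hit_prob_bounds: "0 \<le> hit_prob L t x" "hit_prob L t x \<le> 1"
  by (simp_all add: hit_prob_def)

lemma hit_prob_antimono: "0 \<le> t \<Longrightarrow> antimono (hit_prob L t)"
  unfolding hit_prob_def
  by (intro antimonoI finite_measure_mono hit_event) (auto intro: hits_antimono)

lemma hit_prob_mono: "0 \<le> s \<Longrightarrow> s \<le> t \<Longrightarrow> hit_prob L s x \<le> hit_prob L t x"
  unfolding hit_prob_def by (intro finite_measure_mono hit_event) (auto intro: hits_mono)

lemma hit_prob_zero:
  shows "hit_prob L 0 x = of_bool (x \<le> L 0)"
proof -
  have "hit_prob L 0 x = prob {\<omega> \<in> space M. x \<le> L 0}"
    unfolding hit_prob_def
  proof (rule finite_measure_eq_AE)
    show "AE \<omega> in M. (\<omega> \<in> {\<omega> \<in> space M. hits L 0 x (\<lambda>s. B s \<omega>)}) = (\<omega> \<in> {\<omega> \<in> space M. x \<le> L 0})"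
      using starts_at_0
    proof eventually_elim
      case (elim \<omega>)
      have "hits L 0 x (\<lambda>s. B s \<omega>) \<longleftrightarrow> x \<le> L 0"
      proof
        assume "hits L 0 x (\<lambda>s. B s \<omega>)"
        then obtain s where "0 \<le> s" "s \<le> 0" "x + B s \<omega> \<le> L s" unfolding hits_def by blast
        moreover from this have "s = 0" by simp
        ultimately show "x \<le> L 0" using elim by simp
      next
        assume "x \<le> L 0"
        then show "hits L 0 x (\<lambda>s. B s \<omega>)" unfolding hits_def using elim by (intro exI[of _ 0]) simp
      qed
      then show ?case by simp
    qed
  qed (auto intro: hit_event)
  then show ?thesis by (simp add: prob_space)
qed

lemma first_time_hits:
  assumes "\<omega> \<in> space M"
  shows "first_time (\<lambda>s. x + B s \<omega> - L s \<le> 0) \<le> ereal t \<longleftrightarrow> hits L t x (\<lambda>s. B s \<omega>)"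
proof -
  have "first_time (\<lambda>s. x + B s \<omega> - L s \<le> 0) \<le> ereal t \<longleftrightarrow> (\<exists>s. 0 \<le> s \<and> s \<le> t \<and> x + B s \<omega> - L s \<le> 0)"
  proof (rule first_time_le_iff)
    fix s :: real assume s: "0 \<le> s" and n: "\<not> x + B s \<omega> - L s \<le> 0"
    have "((\<lambda>u. x + B u \<omega> - L u) \<longlongrightarrow> x + B s \<omega> - L s) (at_right s)"
      by (intro tendsto_intros continuous_on_at_right[OF continuous_paths[OF assms] s] cadlag_right L s)
    then have "\<forall>\<^sub>F u in at_right s. 0 < x + B u \<omega> - L u" by (rule order_tendstoD) (use n in simp)
    then show "\<forall>\<^sub>F u in at_right s. \<not> x + B u \<omega> - L u \<le> 0" by eventually_elim simp
  qed
  then show ?thesis by (simp add: hits_def)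
qed

lemma hit_prob_lt_1:
  assumes "L 0 = 0" "0 < e" "0 \<le> T"
  shows "hit_prob L T e < 1"
proof -
  obtain A where A: "A \<in> events" "0 < prob A" "\<And>\<omega> s. \<omega> \<in> A \<Longrightarrow> 0 \<le> s \<Longrightarrow> s \<le> T \<Longrightarrow> L s < e + B s \<omega>"
    using stays_above_pos_prob[OF L assms] by blast
  have "hit_prob L T e \<le> prob (space M - A)"
    unfolding hit_prob_def
  proof (rule finite_measure_mono)
    show "{\<omega> \<in> space M. hits L T e (\<lambda>s. B s \<omega>)} \<subseteq> space M - A"
      using A(3) unfolding hits_def by force
  qed (use A in auto)
  also have "\<dots> = 1 - prob A" by (rule prob_compl[OF A(1)])
  finally show ?thesis using A(2) by simp
qed

end

end

lemma mckean_vlasov_hit_prob: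
  assumes "standard_brownian_motion P \<beta>" and mv: "mckean_vlasov_solution P \<beta> g \<Lambda>" and t: "0 \<le> t"
  shows "ennreal (\<Lambda> t) = (\<integral>\<^sup>+x\<in>{0<..}. ennreal (standard_brownian_motion.hit_prob P \<beta> \<Lambda> t x * g x) \<partial>lborel)"
proof -
  interpret standard_brownian_motion P \<beta> by fact
  have L: "mono_on {0..} \<Lambda>" "cadlag \<Lambda>" using mv by (auto simp: mckean_vlasov_solution_def)
  have "{\<omega> \<in> space P. first_time (\<lambda>s. x + \<beta> s \<omega> - \<Lambda> s \<le> 0) \<le> ereal t} = {\<omega> \<in> space P. hits \<Lambda> t x (\<lambda>s. \<beta> s \<omega>)}" for x
    using first_time_hits[OF L] by blast
  then show ?thesis using mv t unfolding mckean_vlasov_solution_def hit_prob_def by simp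
qed

lemma weak_feedback_gap:
  assumes g: "\<And>x. 0 < x \<Longrightarrow> 0 \<le> g x" and wf: "weak_feedback g \<epsilon>"
  obtains c where "0 < c" "c \<le> 1" "\<And>x. 0 < x \<Longrightarrow> x \<le> \<epsilon> \<Longrightarrow> g x \<le> 1 - c"
proof -
  let ?s = "SUP x\<in>{0<..\<epsilon>}. g x"
  have w: "\<And>x. 0 < x \<Longrightarrow> g x \<le> 1" "0 < \<epsilon>" "?s < 1" using wf by (auto simp: weak_feedback_def)
  have le: "g x \<le> ?s" if "0 < x" "x \<le> \<epsilon>" for x
    by (rule cSUP_upper) (use that w in \<open>auto intro!: bdd_aboveI[of _ 1]\<close>)
  show ?thesis
  proof (rule that[of "1 - ?s"])
    show "1 - ?s \<le> 1" using le[of \<epsilon>] g[of \<epsilon>] w by simp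
  qed (use w le in auto)
qed

text \<open>Under \<open>g \<le> 1\<close> alone the bound holds with \<open>\<kappa> = 0\<close>; the weak feedback condition enters
  the argument only through \<open>\<kappa> > 0\<close>.\<close>

lemma shifted_barrier_gain:
  assumes bm: "standard_brownian_motion P \<beta>" and mv: "mckean_vlasov_solution P \<beta> g \<Lambda>"
    and gm: "g \<in> borel_measurable (restrict_space borel {0<..})" and g: "\<And>x. 0 < x \<Longrightarrow> 0 \<le> g x"
    and wf: "weak_feedback g \<epsilon>" and T: "0 \<le> T"
  obtains \<kappa> where "0 < \<kappa>" "\<kappa> \<le> 1"
    "\<And>t \<eta>. 0 \<le> t \<Longrightarrow> t \<le> T \<Longrightarrow> 0 < \<eta> \<Longrightarrow> \<eta> \<le> \<epsilon> / 2 \<Longrightarrow>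
      (\<integral>\<^sup>+x\<in>{0<..}. ennreal (standard_brownian_motion.hit_prob P \<beta> \<Lambda> t (x - \<eta>) * g x) \<partial>lborel)
      \<le> ennreal (\<Lambda> t + (1 - \<kappa>) * \<eta>)"
proof -
  interpret standard_brownian_motion P \<beta> by fact
  have L: "mono_on {0..} \<Lambda>" "cadlag \<Lambda>" "\<And>t. 0 \<le> t \<Longrightarrow> 0 \<le> \<Lambda> t"
    using mv by (auto simp: mckean_vlasov_solution_def)
  obtain c where c: "0 < c" "c \<le> 1" "\<And>x. 0 < x \<Longrightarrow> x \<le> \<epsilon> \<Longrightarrow> g x \<le> 1 - c"
    using weak_feedback_gap[OF g wf] by blast
  have g1: "\<And>x. 0 < x \<Longrightarrow> g x \<le> 1" and \<epsilon>: "0 < \<epsilon>" using wf by (auto simp: weak_feedback_def)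
  have gm': "(\<lambda>x. g x * indicator {0<..} x) \<in> borel_measurable borel"
    using gm by (subst (asm) borel_measurable_restrict_space_iff) (auto simp: mult.commute)
  \<comment> \<open>The limiting barrier starts at 0, so Brownian motion started at the positive
    point \<open>\<epsilon> / 2\<close> stays above it up to \<open>T\<close> with positive
    probability.\<close>
  have "\<Lambda> 0 = 0"
  proof (rule feedback_fixed_point_zero[OF _ L(3) g g1 c(3,1,2) \<epsilon>])
    show "ennreal (\<Lambda> 0) = (\<integral>\<^sup>+x\<in>{0<..}. ennreal (of_bool (x \<le> \<Lambda> 0) * g x) \<partial>lborel)"
      using mckean_vlasov_hit_prob[OF bm mv, of 0] by (simp add: hit_prob_zero[OF L(1,2)])
  qed auto
  then have lt: "hit_prob \<Lambda> T (\<epsilon> / 2) < 1"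
    using \<epsilon> T by (intro hit_prob_lt_1[OF L(1,2)]) auto
  \<comment> \<open>The gap of \<open>g\<close> below 1 near 0 times the probability of surviving up
    to \<open>T\<close> from \<open>\<epsilon> / 2\<close>. Taking the horizon \<open>T\<close>
    makes it independent of \<open>t\<close>.\<close>
  define \<kappa> where "\<kappa> = c * (1 - hit_prob \<Lambda> T (\<epsilon> / 2))"
  show ?thesis
  proof (rule that[of \<kappa>])
    show "0 < \<kappa>" using c(1) lt by (simp add: \<kappa>_def)
    show "\<kappa> \<le> 1" unfolding \<kappa>_def using c lt hit_prob_bounds[OF L(1,2), of T "\<epsilon> / 2"] by (intro mult_le_one) auto
    fix t \<eta> :: real assume t: "0 \<le> t" "t \<le> T" and \<eta>: "0 < \<eta>" "\<eta> \<le> \<epsilon> / 2"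
    \<comment> \<open>The bound \<open>\<eta> \<le> \<epsilon> / 2\<close> keeps the lowered start
      at or above \<open>\<epsilon> / 2\<close>, so the same \<open>\<kappa>\<close> serves all
      \<open>\<eta>\<close>.\<close>
    have "hit_prob \<Lambda> t (\<epsilon> - \<eta>) \<le> hit_prob \<Lambda> t (\<epsilon> / 2)"
      using antimonoD[OF hit_prob_antimono[OF L(1,2) t(1)], of "\<epsilon> / 2" "\<epsilon> - \<eta>"] \<eta> by simp
    also have "\<dots> \<le> hit_prob \<Lambda> T (\<epsilon> / 2)" by (rule hit_prob_mono[OF L(1,2) t])
    finally have "c * hit_prob \<Lambda> t (\<epsilon> - \<eta>) \<le> c * hit_prob \<Lambda> T (\<epsilon> / 2)"
      using c by (intro mult_left_mono) auto
    moreover have "(1 - c) * hit_prob \<Lambda> t (- \<eta>) \<le> (1 - c) * 1"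
      using c hit_prob_bounds[OF L(1,2)] by (intro mult_left_mono) auto
    ultimately have "(1 - c) * hit_prob \<Lambda> t (- \<eta>) + c * hit_prob \<Lambda> t (\<epsilon> - \<eta>) \<le> 1 - \<kappa>"
      by (simp add: \<kappa>_def algebra_simps)
    then have le: "\<eta> * ((1 - c) * hit_prob \<Lambda> t (- \<eta>) + c * hit_prob \<Lambda> t (\<epsilon> - \<eta>)) \<le> (1 - \<kappa>) * \<eta>"
      using \<eta> by (subst mult.commute) (intro mult_right_mono, auto)
    have "(\<integral>\<^sup>+x\<in>{0<..}. ennreal (hit_prob \<Lambda> t (x - \<eta>) * g x) \<partial>lborel)
      \<le> (\<integral>\<^sup>+x\<in>{0<..}. ennreal (hit_prob \<Lambda> t x * g x) \<partial>lborel)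
        + ennreal (\<eta> * ((1 - c) * hit_prob \<Lambda> t (- \<eta>) + c * hit_prob \<Lambda> t (\<epsilon> - \<eta>)))"
      by (rule shifted_absorption_le) (use hit_prob_antimono[OF L(1,2) t(1)] hit_prob_bounds[OF L(1,2)] \<eta> gm' g g1 c \<epsilon> in auto)
    also have "\<dots> \<le> ennreal (\<Lambda> t) + ennreal ((1 - \<kappa>) * \<eta>)"
      unfolding mckean_vlasov_hit_prob[OF bm mv t(1), symmetric] using le by (intro add_left_mono ennreal_leI)
    also have "\<dots> = ennreal (\<Lambda> t + (1 - \<kappa>) * \<eta>)"
    proof -
      have "0 \<le> (1 - \<kappa>) * \<eta>" using \<open>\<kappa> \<le> 1\<close> \<eta> by simp
      then show ?thesis using L(3)[OF t(1)] by (simp add: ennreal_plus)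
    qed
    finally show "(\<integral>\<^sup>+x\<in>{0<..}. ennreal (hit_prob \<Lambda> t (x - \<eta>) * g x) \<partial>lborel) \<le> ennreal (\<Lambda> t + (1 - \<kappa>) * \<eta>)" .
  qed
qed

text \<open>The overshoot happens at a random time, while the Poisson inequality speaks of grid
  times. A grid time to the right of \<open>\<sigma>\<close> still counts all crossings up to
  \<open>\<sigma>\<close>, and right continuity lets it be so close that \<open>L\<close>, and with
  it the mean, hardly grows.\<close>

lemma dyadic_grid_point:
  fixes L :: "real \<Rightarrow> real"
  assumes "cadlag L" and \<sigma>: "0 \<le> \<sigma>" "\<sigma> \<le> T" and e: "0 < e"
  obtains m k :: nat where "k \<le> 2 ^ m" "\<sigma> \<le> T * real k / 2 ^ m" "L (T * real k / 2 ^ m) < L \<sigma> + e"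
proof (cases "\<sigma> = T")
  case True
  then show ?thesis using e by (intro that[of 1 0]) auto
next
  case False
  then have T: "\<sigma> < T" "0 < T" using \<sigma> by auto
  have "\<forall>\<^sub>F u in at_right \<sigma>. L u < L \<sigma> + e"
    by (rule order_tendstoD(2)[OF cadlag_right[OF assms(1) \<sigma>(1)]]) (use e in auto)
  then obtain c where c: "c > \<sigma>" "\<And>u. \<sigma> < u \<Longrightarrow> u < c \<Longrightarrow> L u < L \<sigma> + e"
    unfolding eventually_at_right_field by auto
  define d where "d = min c T - \<sigma>"
  have d: "0 < d" using c T by (simp add: d_def)
  obtain m where m: "T / d < 2 ^ m" using real_arch_pow[of 2 "T / d"] by auto
  define k where "k = nat \<lfloor>\<sigma> * 2 ^ m / T\<rfloor> + 1"
  have "0 \<le> \<sigma> * 2 ^ m / T" using \<sigma> T by simp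
  then have k: "\<sigma> * 2 ^ m / T < real k" "real k \<le> \<sigma> * 2 ^ m / T + 1"
    unfolding k_def by linarith+
  have lo: "\<sigma> < T * real k / 2 ^ m" using k(1) T by (simp add: field_simps)
  have "T * real k / 2 ^ m \<le> T * (\<sigma> * 2 ^ m / T + 1) / 2 ^ m"
    using k(2) T by (intro divide_right_mono mult_left_mono) auto
  also have "\<dots> = \<sigma> + T / 2 ^ m" using T by (simp add: field_simps)
  also have "T / 2 ^ m < d" using m d by (simp add: field_simps)
  finally have hi: "T * real k / 2 ^ m < min c T" by (simp add: d_def)
  show ?thesis
  proof (rule that[of k m])
    have "T * real k < T * 2 ^ m" using hi by (simp add: field_simps)
    then have "real k < real (2 ^ m)" using T by simp
    then show "k \<le> 2 ^ m" by (simp only: of_nat_less_iff)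
  qed (use lo hi c in auto)
qed

section \<open>From the barrier of the particles to counts of marked points\<close>

lemma marked_particles:
  assumes ps: "particle_system M g N W0 B Z" and bm: "standard_brownian_motion P \<beta>"
  shows "marked_poisson_points M (density lborel (\<lambda>x. ennreal (real N * g x) * indicator {0<..} x)) W0
    (PiM {0..} (\<lambda>_. borel)) (\<lambda>i \<omega>. \<lambda>t\<in>{0..}. B i t \<omega>) (distr P (PiM {0..} (\<lambda>_. borel)) (\<lambda>\<omega>. \<lambda>t\<in>{0..}. \<beta> t \<omega>))"
proof -
  interpret particle_system M g N W0 B Z by fact
  interpret I: poisson_points M "density lborel (\<lambda>x. ennreal (real N * g x) * indicator {0<..} x)" W0
    by (rule initial_points)
  show ?thesis
  proof
    show "indep_vars (\<lambda>_. PiM {0..} (\<lambda>_. borel)) (\<lambda>i \<omega>. \<lambda>t\<in>{0..}. B i t \<omega>) UNIV" by (rule brownian_indep)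
    show "distr M (PiM {0..} (\<lambda>_. borel)) (\<lambda>\<omega>. \<lambda>t\<in>{0..}. B i t \<omega>) = distr P (PiM {0..} (\<lambda>_. borel)) (\<lambda>\<omega>. \<lambda>t\<in>{0..}. \<beta> t \<omega>)" for i
      by (rule brownian_path_law_unique[OF brownian bm])
  qed (simp_all add: initial_brownian_indep)
qed

text \<open>A single event \<open>U\<close> has to serve all times: it is the union over the dyadic
  grids of the events that, at some grid time, the number of crossings of
  \<open>\<Lambda> + \<eta>\<close> exceeds its mean by at least
  \<open>\<kappa> * N * \<eta> / 2\<close>. These events increase with the grid and obey a bound
  free of the mesh, so the union obeys it too.\<close>

lemma particle_overshoot:
  assumes bm: "standard_brownian_motion P \<beta>" and mv: "mckean_vlasov_solution P \<beta> g \<Lambda>"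
    and gm: "g \<in> borel_measurable (restrict_space borel {0<..})" and g: "\<And>x. 0 < x \<Longrightarrow> 0 \<le> g x"
    and ps: "particle_system M g N W0 B Z" and N: "1 \<le> N" and T: "0 \<le> T" and \<eta>: "0 < \<eta>" and \<kappa>: "0 < \<kappa>" "\<kappa> \<le> 1"
    and gain: "\<And>t. 0 \<le> t \<Longrightarrow> t \<le> T \<Longrightarrow>
      (\<integral>\<^sup>+x\<in>{0<..}. ennreal (standard_brownian_motion.hit_prob P \<beta> \<Lambda> t (x - \<eta>) * g x) \<partial>lborel)
      \<le> ennreal (\<Lambda> t + (1 - \<kappa>) * \<eta>)"
    and V: "\<Lambda> T + \<eta> \<le> V" and r: "0 \<le> r" "r \<le> 1"
  obtains U where "U \<in> sets M" "measure M U \<le> 2 * exp (r\<^sup>2 * (real N * V) - r * (real N * \<kappa> * \<eta> / 4))"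
    "AE \<omega> in M. \<forall>t. 0 \<le> t \<and> t \<le> T \<and> \<Lambda> t + \<eta> < Z t \<omega> \<longrightarrow> \<omega> \<in> U"
proof -
  interpret P: standard_brownian_motion P \<beta> by fact
  interpret particle_system M g N W0 B Z by fact
  define \<nu> where "\<nu> = density lborel (\<lambda>x. ennreal (real N * g x) * indicator {0<..} x)"
  define S where "S = PiM {0::real..} (\<lambda>_. borel :: real measure)"
  define X where "X i \<omega> = (\<lambda>t\<in>{0..}. B i t \<omega>)" for i \<omega>
  define Q where "Q = distr P S (\<lambda>\<omega>. \<lambda>t\<in>{0..}. \<beta> t \<omega>)"
  interpret mp: marked_poisson_points M \<nu> W0 S X Q
    unfolding \<nu>_def S_def X_def[abs_def] Q_def by (rule marked_particles[OF ps bm])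
  interpret Q: prob_space Q by (rule mp.prob_space_marks)
  have L: "mono_on {0..} \<Lambda>" "cadlag \<Lambda>" "\<And>t. 0 \<le> t \<Longrightarrow> 0 \<le> \<Lambda> t"
    using mv by (auto simp: mckean_vlasov_solution_def)
  have N0: "0 < real N" using N by simp
  define tt where "tt m k = T * real k / 2 ^ m" for m k :: nat
  have tt: "0 \<le> tt m k" for m k using T by (simp add: tt_def)
  have ttT: "tt m k \<le> T" if "k \<le> 2 ^ m" for m k
  proof -
    have "real k \<le> 2 ^ m" using that by (metis of_nat_le_iff of_nat_numeral of_nat_power)
    then have "T * real k \<le> T * 2 ^ m" using T by (rule mult_left_mono)
    then show ?thesis by (simp add: tt_def field_simps)
  qed
  have tt_mono: "tt m j \<le> tt m k" if "j \<le> k" for m j k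
    using that T by (simp add: tt_def divide_right_mono mult_left_mono)
  define cnt where "cnt t \<omega> = (\<Sum>i. of_bool (\<exists>s. 0 \<le> s \<and> s \<le> t \<and> W0 i \<omega> + ereal (B i s \<omega>) \<le> ereal (\<Lambda> s + \<eta>)) :: ennreal)" for t \<omega>
  define I where "I t = ennreal (real N) * (\<integral>\<^sup>+x\<in>{0<..}. ennreal (P.hit_prob \<Lambda> t (x - \<eta>) * g x) \<partial>lborel)" for t
  have I_le: "I t \<le> ennreal (real N * (\<Lambda> t + (1 - \<kappa>) * \<eta>))" if "0 \<le> t" "t \<le> T" for t
    unfolding I_def using N0 mult_left_mono[OF gain[OF that], of "ennreal (real N)"] by (simp add: ennreal_mult')
  \<comment> \<open>The sets \<open>hit_set\<close> grow with time only along continuous paths. The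
    union over the earlier grid times makes \<open>E m k\<close> increasing in \<open>k\<close> on
    the whole product space and changes nothing for continuous paths.\<close>
  define E where "E m k = {p \<in> space (borel \<Otimes>\<^sub>M S). 0 < fst p \<and> (\<exists>j\<in>{..k}. (fst p - \<eta>, snd p) \<in> hit_set \<Lambda> (tt m j))}" for m k
  have E_sets: "E m k \<in> sets (borel \<Otimes>\<^sub>M S)" for m k
  proof -
    have [measurable]: "hit_set \<Lambda> (tt m j) \<in> sets (borel \<Otimes>\<^sub>M S)" for j unfolding S_def by (rule hit_set_sets)
    show ?thesis unfolding E_def by measurable
  qed
  have path_S: "(\<lambda>t\<in>{0..}. b t) \<in> space S" for b :: "real \<Rightarrow> real" by (simp add: S_def space_PiM)
  have E_path: "(x, \<lambda>t\<in>{0..}. b t) \<in> E m k \<longleftrightarrow> 0 < x \<and> hits \<Lambda> (tt m k) (x - \<eta>) b"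
    if "continuous_on {0..} b" for x b m k
  proof -
    have "(x, \<lambda>t\<in>{0..}. b t) \<in> E m k \<longleftrightarrow> 0 < x \<and> (\<exists>j\<in>{..k}. hits \<Lambda> (tt m j) (x - \<eta>) b)"
      using path_S[of b] by (simp add: E_def space_pair_measure hit_set_path[OF that L(1,2) tt])
    also have "(\<exists>j\<in>{..k}. hits \<Lambda> (tt m j) (x - \<eta>) b) \<longleftrightarrow> hits \<Lambda> (tt m k) (x - \<eta>) b"
      using hits_mono[OF _ tt_mono] by blast
    finally show ?thesis .
  qed
  \<comment> \<open>\<open>E_path\<close> applies for every outcome, since all paths of
    \<open>B i\<close> are continuous; an index without a particle stays at infinity and is counted
    on neither side.\<close>
  have count: "mp.mark_count (E m k) \<omega> = cnt (tt m k) \<omega>" if \<omega>: "\<omega> \<in> space M" for m k \<omega>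
    unfolding mp.mark_count_def cnt_def
  proof (intro suminf_cong arg_cong[where f = of_bool])
    fix i
    have cont: "continuous_on {0..} (\<lambda>t. B i t \<omega>)"
      by (rule standard_brownian_motion.continuous_paths[OF brownian \<omega>])
    have pos: "0 < W0 i \<omega>" by (rule mp.positive[OF \<omega>])
    show "(\<exists>x. W0 i \<omega> = ereal x \<and> (x, X i \<omega>) \<in> E m k) = (\<exists>s. 0 \<le> s \<and> s \<le> tt m k \<and> W0 i \<omega> + ereal (B i s \<omega>) \<le> ereal (\<Lambda> s + \<eta>))"
    proof (cases "W0 i \<omega>")
      case (real x)
      then show ?thesis using pos
        by (simp add: X_def E_path[OF cont] hits_shift[symmetric]) (simp add: hits_def)
    qed (use pos in auto)
  qed
  \<comment> \<open>Raising the barrier by \<open>\<eta>\<close> is lowering the start by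
    \<open>\<eta>\<close>, so the section of \<open>E m k\<close> at \<open>x > 0\<close> has mass
    \<open>hit_prob\<close> at \<open>x - \<eta>\<close>.\<close>
  have em: "emeasure (\<nu> \<Otimes>\<^sub>M Q) (E m k) = I (tt m k)" for m k
  proof -
    have sets_eq: "sets (borel \<Otimes>\<^sub>M S) = sets (\<nu> \<Otimes>\<^sub>M Q)"
      by (rule sets_pair_measure_cong) (simp_all add: mp.sets_intensity mp.sets_marks)
    have gm': "(\<lambda>x. g x * indicator {0<..} x) \<in> borel_measurable borel"
      using gm by (subst (asm) borel_measurable_restrict_space_iff) (auto simp: mult.commute)
    have gN: "(\<lambda>x. ennreal (real N * g x) * indicator {0<..} x) \<in> borel_measurable lborel"
    proof -
      have "(\<lambda>x. ennreal (real N * g x) * indicator {0<..} x) = (\<lambda>x. ennreal (real N * (g x * indicator {0<..} x)))"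
        by (auto simp: indicator_def)
      then show ?thesis using gm' by simp
    qed
    have "antimono (\<lambda>x. P.hit_prob \<Lambda> (tt m k) (x - \<eta>))"
      using antimonoD[OF P.hit_prob_antimono[OF L(1,2) tt]] by (intro antimonoI) simp
    then have hm[measurable]: "(\<lambda>x. P.hit_prob \<Lambda> (tt m k) (x - \<eta>)) \<in> borel_measurable borel"
      by (rule borel_measurable_antimono)
    have sec: "emeasure Q (Pair x -` E m k) = (if 0 < x then ennreal (P.hit_prob \<Lambda> (tt m k) (x - \<eta>)) else 0)" for x
    proof -
      have "emeasure Q (Pair x -` E m k) = emeasure P ((\<lambda>\<omega>. \<lambda>t\<in>{0..}. \<beta> t \<omega>) -` (Pair x -` E m k) \<inter> space P)"
        unfolding Q_def by (rule emeasure_distr) (use P.measurable_path E_sets in \<open>auto simp: S_def intro: sets_Pair1\<close>)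
      also have "(\<lambda>\<omega>. \<lambda>t\<in>{0..}. \<beta> t \<omega>) -` (Pair x -` E m k) \<inter> space P = {\<omega> \<in> space P. 0 < x \<and> hits \<Lambda> (tt m k) (x - \<eta>) (\<lambda>s. \<beta> s \<omega>)}"
        using E_path[OF P.continuous_paths] by auto
      finally show ?thesis by (simp add: P.hit_prob_def P.emeasure_eq_measure)
    qed
    have "emeasure (\<nu> \<Otimes>\<^sub>M Q) (E m k) = (\<integral>\<^sup>+x. emeasure Q (Pair x -` E m k) \<partial>\<nu>)"
      by (rule Q.emeasure_pair_measure_alt) (use E_sets sets_eq in auto)
    also have "\<dots> = (\<integral>\<^sup>+x. ennreal (real N * g x) * indicator {0<..} x * (if 0 < x then ennreal (P.hit_prob \<Lambda> (tt m k) (x - \<eta>)) else 0) \<partial>lborel)"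
      unfolding sec \<nu>_def by (rule nn_integral_density[OF gN]) measurable
    also have "\<dots> = (\<integral>\<^sup>+x. ennreal (real N) * (ennreal (P.hit_prob \<Lambda> (tt m k) (x - \<eta>) * g x) * indicator {0<..} x) \<partial>lborel)"
      by (intro nn_integral_cong)
        (use g P.hit_prob_bounds[OF L(1,2)] in \<open>auto simp: indicator_def mult_ac simp flip: ennreal_mult\<close>)
    also have "\<dots> = I (tt m k)"
      unfolding I_def
    proof (rule nn_integral_cmult)
      have "(\<lambda>x. ennreal (P.hit_prob \<Lambda> (tt m k) (x - \<eta>) * g x) * indicator {0<..} x)
        = (\<lambda>x. ennreal (P.hit_prob \<Lambda> (tt m k) (x - \<eta>) * (g x * indicator {0<..} x)))"
        by (auto simp: indicator_def)
      then show "(\<lambda>x. ennreal (P.hit_prob \<Lambda> (tt m k) (x - \<eta>) * g x) * indicator {0<..} x) \<in> borel_measurable lborel"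
        using gm' hm by simp
    qed
    finally show ?thesis .
  qed
  \<comment> \<open>The gain \<open>N * \<kappa> * \<eta>\<close> is divided into two halves: one
    pays for moving \<open>\<sigma>\<close> to a grid time, the other is \<open>2 * x\<close>, the
    excess over the mean in the maximal inequality.\<close>
  define x where "x = real N * \<kappa> * \<eta> / 4"
  define U where "U m = {\<omega> \<in> space M. \<exists>k<Suc (2 ^ m). ennreal (measure (\<nu> \<Otimes>\<^sub>M Q) (E m k) + 2 * x) \<le> mp.mark_count (E m k) \<omega>}" for m
  have U_eq: "\<omega> \<in> U m \<longleftrightarrow> \<omega> \<in> space M \<and> (\<exists>k\<le>2 ^ m. ennreal (enn2real (I (tt m k)) + 2 * x) \<le> cnt (tt m k) \<omega>)" for m \<omega>
    unfolding U_def using count[of \<omega> m] by (auto simp: measure_def em less_Suc_eq_le)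
  have U_sets: "U m \<in> sets M" for m
  proof -
    have [measurable]: "mp.mark_count (E m k) \<in> borel_measurable M" for k
      by (rule mp.measurable_mark_count[OF E_sets])
    have "U m = (\<Union>k<Suc (2 ^ m). {\<omega> \<in> space M. ennreal (measure (\<nu> \<Otimes>\<^sub>M Q) (E m k) + 2 * x) \<le> mp.mark_count (E m k) \<omega>})"
      unfolding U_def by auto
    also have "\<dots> \<in> sets M" by (rule sets.finite_UN) (simp, measurable)
    finally show ?thesis .
  qed
  have U_prob: "prob (U m) \<le> 2 * exp (r\<^sup>2 * (real N * V) - r * x)" for m
    unfolding U_def
  proof (rule mp.mark_count_maximal_inequality[OF E_sets _ _ _ _ r])
    show "E m k \<subseteq> {0<..} \<times> UNIV" for k by (auto simp: E_def)
    show "E m j \<subseteq> E m k" if "j \<le> k" for j k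
    proof
      fix p assume "p \<in> E m j"
      then show "p \<in> E m k" unfolding E_def using that by (auto intro: order_trans)
    qed
    show "emeasure (\<nu> \<Otimes>\<^sub>M Q) (E m k) \<le> ennreal (real N * V)" if "k < Suc (2 ^ m)" for k
    proof -
      have k: "tt m k \<le> T" using ttT that by simp
      have "(1 - \<kappa>) * \<eta> \<le> 1 * \<eta>" using \<kappa> \<eta> by (intro mult_right_mono) auto
      moreover have "\<Lambda> (tt m k) \<le> \<Lambda> T" using L(1) tt k T by (intro mono_onD[OF L(1)]) auto
      ultimately have "real N * (\<Lambda> (tt m k) + (1 - \<kappa>) * \<eta>) \<le> real N * V"
        using V N0 by (intro mult_left_mono) auto
      then show ?thesis unfolding em using I_le[OF tt k] by (meson ennreal_leI order_trans)
    qed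
    have "0 \<le> V" using V L(3)[OF T] \<eta> by simp
    then show "0 \<le> real N * V" by simp
  qed
  have U_inc: "incseq U"
  proof (rule incseq_SucI, rule subsetI)
    fix m \<omega> assume "\<omega> \<in> U m"
    then obtain k where k: "\<omega> \<in> space M" "k \<le> 2 ^ m" "ennreal (enn2real (I (tt m k)) + 2 * x) \<le> cnt (tt m k) \<omega>"
      unfolding U_eq by blast
    have "tt m k = tt (Suc m) (2 * k)" by (simp add: tt_def)
    then have "ennreal (enn2real (I (tt (Suc m) (2 * k))) + 2 * x) \<le> cnt (tt (Suc m) (2 * k)) \<omega>" using k(3) by simp
    moreover have "2 * k \<le> 2 ^ Suc m" using k(2) by simp
    ultimately show "\<omega> \<in> U (Suc m)" unfolding U_eq using k(1) by blast
  qed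
  show ?thesis
  proof (rule that[of "\<Union>m. U m"])
    show "(\<Union>m. U m) \<in> sets M" using U_sets by auto
    have "(\<lambda>m. prob (U m)) \<longlonglongrightarrow> prob (\<Union>m. U m)"
      by (rule finite_Lim_measure_incseq[OF _ U_inc]) (use U_sets in auto)
    then show "prob (\<Union>m. U m) \<le> 2 * exp (r\<^sup>2 * (real N * V) - r * (real N * \<kappa> * \<eta> / 4))"
      using U_prob unfolding x_def by (intro LIMSEQ_le_const2) auto
    show "AE \<omega> in M. \<forall>t. 0 \<le> t \<and> t \<le> T \<and> \<Lambda> t + \<eta> < Z t \<omega> \<longrightarrow> \<omega> \<in> (\<Union>m. U m)"
      using barrier_equations AE_space
    proof eventually_elim
      case (elim \<omega>)
      show ?case
      proof (intro allI impI)
        fix t assume t: "0 \<le> t \<and> t \<le> T \<and> \<Lambda> t + \<eta> < Z t \<omega>"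
        obtain \<sigma> where \<sigma>: "0 \<le> \<sigma>" "\<sigma> \<le> t" "ennreal (real N * (\<Lambda> \<sigma> + \<eta>)) \<le> cnt \<sigma> \<omega>"
          unfolding cnt_def
          by (rule barrier_overshoot[OF elim(1) N barrier_mono[OF elim(2)] barrier_cadlag[OF elim(2)] L \<eta>])
            (use t in auto)
        have "0 < \<kappa> * \<eta> / 2" using \<kappa> \<eta> by simp
        then obtain m k :: nat where k: "k \<le> 2 ^ m" "\<sigma> \<le> tt m k" "\<Lambda> (tt m k) < \<Lambda> \<sigma> + \<kappa> * \<eta> / 2"
          using dyadic_grid_point[OF L(2) \<sigma>(1), of T] \<sigma>(2) t unfolding tt_def by (metis order_trans)
        have nn: "0 \<le> \<Lambda> (tt m k) + (1 - \<kappa>) * \<eta>" using L(3)[OF tt] \<kappa> \<eta> by simp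
        have "enn2real (I (tt m k)) \<le> real N * (\<Lambda> (tt m k) + (1 - \<kappa>) * \<eta>)"
          using I_le[OF tt ttT[OF k(1)]] nn N0 by (intro enn2real_leI) auto
        moreover have "real N * (\<Lambda> (tt m k) + (1 - \<kappa>) * \<eta>) \<le> real N * (\<Lambda> \<sigma> + \<kappa> * \<eta> / 2 + (1 - \<kappa>) * \<eta>)"
          using k(3) N0 by (intro mult_left_mono) auto
        ultimately have "enn2real (I (tt m k)) + 2 * x \<le> real N * (\<Lambda> \<sigma> + \<eta>)"
          by (simp add: x_def algebra_simps)
        then have "ennreal (enn2real (I (tt m k)) + 2 * x) \<le> cnt \<sigma> \<omega>"
          using \<sigma>(3) by (meson ennreal_leI order_trans)
        also have "\<dots> \<le> cnt (tt m k) \<omega>"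
          unfolding cnt_def
        proof (intro suminf_le of_bool_mono_ennreal)
          show "\<exists>s. 0 \<le> s \<and> s \<le> tt m k \<and> W0 i \<omega> + ereal (B i s \<omega>) \<le> ereal (\<Lambda> s + \<eta>)"
            if "\<exists>s. 0 \<le> s \<and> s \<le> \<sigma> \<and> W0 i \<omega> + ereal (B i s \<omega>) \<le> ereal (\<Lambda> s + \<eta>)" for i
            using that k(2) order_trans by blast
        qed auto
        finally show "\<omega> \<in> (\<Union>m. U m)" using U_eq[of \<omega> m] elim(2) k(1) by blast
      qed
    qed
  qed
qed

theorem theorem4p5:
  fixes g :: "real \<Rightarrow> real" and \<epsilon> :: real and \<Lambda> :: "real \<Rightarrow> real"
    and P :: "'b measure" and \<beta> :: "real \<Rightarrow> 'b \<Rightarrow> real"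
    and M :: "nat \<Rightarrow> 'a measure"
    and W0 :: "nat \<Rightarrow> nat \<Rightarrow> 'a \<Rightarrow> ereal"
    and B :: "nat \<Rightarrow> nat \<Rightarrow> real \<Rightarrow> 'a \<Rightarrow> real"
    and \<Lambda>N :: "nat \<Rightarrow> real \<Rightarrow> 'a \<Rightarrow> real"
    and T :: real
  assumes "g \<in> borel_measurable (restrict_space borel {0<..})"
    and "\<And>x. 0 < x \<Longrightarrow> 0 \<le> g x"
    and "weak_feedback g \<epsilon>"
    and "standard_brownian_motion P \<beta>"
    and "mckean_vlasov_solution P \<beta> g \<Lambda>"
    and "\<And>N. 1 \<le> N \<Longrightarrow> particle_system (M N) g N (W0 N) (B N) (\<Lambda>N N)"
    and "0 \<le> T"
  shows "\<exists>K>0. \<forall>N\<ge>1. \<forall>y. 0 < y \<and> y \<le> sqrt (real N) * \<epsilon> / 2 \<longrightarrow>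
           measure (M N) {\<omega> \<in> space (M N).
             (SUP t\<in>{0..T}. sqrt (real N) * (\<Lambda>N N t \<omega> - \<Lambda> t)) \<ge> y}
           \<le> 2 * exp (- (K * y\<^sup>2 / (1 + y / sqrt (real N))))"
proof -
  have \<epsilon>: "0 < \<epsilon>" using assms(3) by (simp add: weak_feedback_def)
  have \<Lambda>T: "0 \<le> \<Lambda> T" using assms(5,7) by (simp add: mckean_vlasov_solution_def)
  obtain \<kappa> where \<kappa>: "0 < \<kappa>" "\<kappa> \<le> 1"
    and gain: "\<And>t \<eta>. 0 \<le> t \<Longrightarrow> t \<le> T \<Longrightarrow> 0 < \<eta> \<Longrightarrow> \<eta> \<le> \<epsilon> / 2 \<Longrightarrow>
      (\<integral>\<^sup>+x\<in>{0<..}. ennreal (standard_brownian_motion.hit_prob P \<beta> \<Lambda> t (x - \<eta>) * g x) \<partial>lborel)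
      \<le> ennreal (\<Lambda> t + (1 - \<kappa>) * \<eta>)"
    using shifted_barrier_gain[OF assms(4,5,1,2,3,7)] by blast
  \<comment> \<open>A bound for \<open>\<Lambda> T + \<eta>\<close> that depends neither on
    \<open>N\<close> nor on \<open>y\<close>, so that it may enter \<open>K\<close>.\<close>
  define V where "V = \<Lambda> T + \<epsilon>"
  have V: "0 < V" using \<Lambda>T \<epsilon> by (simp add: V_def)
  \<comment> \<open>The tilt will be \<open>r * \<eta>\<close>. The bound
    \<open>\<kappa> / (8 * V)\<close> keeps the quadratic term of the Chernoff exponent at most half
    of the linear one, and \<open>1 / \<epsilon>\<close> keeps the tilt at most 1.\<close>
  define r where "r = min (\<kappa> / (8 * V)) (1 / \<epsilon>)"
  have r: "0 < r" using \<kappa> V \<epsilon> by (simp add: r_def)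
  have rV: "r * V \<le> \<kappa> / 8"
  proof -
    have "r * V \<le> \<kappa> / (8 * V) * V" using V by (intro mult_right_mono) (auto simp: r_def)
    then show ?thesis using V by simp
  qed
  \<comment> \<open>The exponent will be at most \<open>- r * \<kappa> * N * \<eta>^2 / 8\<close>,
    and \<open>N * \<eta>^2 = y^2 / 4\<close>.\<close>
  define K where "K = r * \<kappa> / 32"
  have K: "0 < K" using r \<kappa> by (simp add: K_def)
  show ?thesis
  proof (intro exI[of _ K] conjI K allI impI, elim conjE)
    fix N :: nat and y :: real
    assume N: "1 \<le> N" and y: "0 < y" "y \<le> sqrt (real N) * \<epsilon> / 2"
    interpret particle_system "M N" g N "W0 N" "B N" "\<Lambda>N N" by (rule assms(6)[OF N])
    have N0: "0 < sqrt (real N)" using N by simp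
    \<comment> \<open>Halving gives strictness: the supremum need not be attained, but if it is at
      least \<open>y\<close>, then some value exceeds \<open>y / 2\<close>, and the overshoot
      argument starts from a strict crossing.\<close>
    define \<eta> where "\<eta> = y / sqrt (real N) / 2"
    have \<eta>: "0 < \<eta>" "\<eta> \<le> \<epsilon> / 4" using y N0 by (auto simp: \<eta>_def field_simps)
    have N\<eta>: "real N * \<eta>\<^sup>2 = y\<^sup>2 / 4" using N0 by (simp add: \<eta>_def power_divide)
    have r1: "r * \<eta> \<le> 1"
    proof -
      have "r * \<eta> \<le> 1 / \<epsilon> * \<epsilon>" using r \<eta> \<epsilon> by (intro mult_mono) (auto simp: r_def)
      then show ?thesis using \<epsilon> by simp
    qed
    obtain U where U: "U \<in> sets (M N)"
      "measure (M N) U \<le> 2 * exp ((r * \<eta>)\<^sup>2 * (real N * V) - (r * \<eta>) * (real N * \<kappa> * \<eta> / 4))"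
      "AE \<omega> in M N. \<forall>t. 0 \<le> t \<and> t \<le> T \<and> \<Lambda> t + \<eta> < \<Lambda>N N t \<omega> \<longrightarrow> \<omega> \<in> U"
    proof (rule particle_overshoot[OF assms(4,5,1,2) assms(6)[OF N] N assms(7) \<eta>(1) \<kappa>])
      show "\<Lambda> T + \<eta> \<le> V" using \<eta> \<epsilon> by (simp add: V_def)
      show "0 \<le> r * \<eta>" using r \<eta> by simp
    qed (use gain \<eta> r1 \<epsilon> in auto)
    have "measure (M N) {\<omega> \<in> space (M N). (SUP t\<in>{0..T}. sqrt (real N) * (\<Lambda>N N t \<omega> - \<Lambda> t)) \<ge> y} \<le> measure (M N) U"
    proof (rule finite_measure_mono_AE[OF _ U(1)])
      show "AE \<omega> in M N. \<omega> \<in> {\<omega> \<in> space (M N). (SUP t\<in>{0..T}. sqrt (real N) * (\<Lambda>N N t \<omega> - \<Lambda> t)) \<ge> y} \<longrightarrow> \<omega> \<in> U"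
        using U(3)
      proof eventually_elim
        case (elim \<omega>)
        show ?case
        proof
          assume "\<omega> \<in> {\<omega> \<in> space (M N). (SUP t\<in>{0..T}. sqrt (real N) * (\<Lambda>N N t \<omega> - \<Lambda> t)) \<ge> y}"
          then have sup: "y \<le> (SUP t\<in>{0..T}. sqrt (real N) * (\<Lambda>N N t \<omega> - \<Lambda> t))" by simp
          have "\<exists>t\<in>{0..T}. y / 2 < sqrt (real N) * (\<Lambda>N N t \<omega> - \<Lambda> t)"
          proof (rule ccontr)
            assume "\<not> ?thesis"
            then have "(SUP t\<in>{0..T}. sqrt (real N) * (\<Lambda>N N t \<omega> - \<Lambda> t)) \<le> y / 2"
              using assms(7) by (intro cSUP_least) (auto simp: not_less)
            then show False using sup y by simp
          qed
          then obtain t where t: "0 \<le> t" "t \<le> T" "y / 2 < sqrt (real N) * (\<Lambda>N N t \<omega> - \<Lambda> t)" by auto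
          then have "\<Lambda> t + \<eta> < \<Lambda>N N t \<omega>" using N0 by (simp add: \<eta>_def field_simps)
          then show "\<omega> \<in> U" using elim t by blast
        qed
      qed
    qed
    also have "\<dots> \<le> 2 * exp ((r * \<eta>)\<^sup>2 * (real N * V) - (r * \<eta>) * (real N * \<kappa> * \<eta> / 4))" by (rule U(2))
    also have "\<dots> \<le> 2 * exp (- (K * y\<^sup>2 / (1 + y / sqrt (real N))))"
    proof -
      have "(r * \<eta>)\<^sup>2 * (real N * V) - (r * \<eta>) * (real N * \<kappa> * \<eta> / 4) = r * (real N * \<eta>\<^sup>2) * (r * V - \<kappa> / 4)"
        by (simp add: power2_eq_square algebra_simps)
      also have "\<dots> \<le> r * (real N * \<eta>\<^sup>2) * (\<kappa> / 8 - \<kappa> / 4)"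
        using rV r by (intro mult_left_mono) auto
      also have "\<dots> = - (K * y\<^sup>2)" by (simp add: N\<eta> K_def)
      also have "\<dots> \<le> - (K * y\<^sup>2 / (1 + y / sqrt (real N)))"
      proof -
        have "1 \<le> 1 + y / sqrt (real N)" using y N0 by simp
        then have "K * y\<^sup>2 / (1 + y / sqrt (real N)) \<le> K * y\<^sup>2 / 1"
          using K by (intro divide_left_mono) auto
        then show ?thesis by simp
      qed
      finally show ?thesis by simp
    qed
    finally show "measure (M N) {\<omega> \<in> space (M N). (SUP t\<in>{0..T}. sqrt (real N) * (\<Lambda>N N t \<omega> - \<Lambda> t)) \<ge> y}
           \<le> 2 * exp (- (K * y\<^sup>2 / (1 + y / sqrt (real N))))" .
  qed
qed

end
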